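(* Let $N,M\ge 1$, let $\Omega\subset\mathbb{R}^N$ be a bounded open set with Lipschitz boundary, and let $W\colon\Omega\times\mathbb{R}^M\to[0,\infty)$ satisfy the following assumptions. (H1) $W$ is a Carathéodory function. (H2) There exist $a,b\in BV(\Omega;\mathbb{R}^M)\cap L^\infty(\Omega;\mathbb{R}^M)$ such that, for a.e. $x\in\Omega$, $W(x,u)=0$ if and only if $u\in\{a(x),b(x)\}$. (H3) There exists $\delta>0$ such that $|a(x)-b(x)|\ge\delta$ for a.e. $x\in\Omega$. (H4) There exist a continuous non-decreasing function $f\colon[0,\infty)\to[0,\infty)$ with $f(t)=0$ if and only if $t=0$, and a constant $C_1>0$, such that $$\tfrac1{C_1} f\big(\min\{|u-a(x)|,|u-b(x)|\}\big)\le W(x,u)\le C_1 f\big(\min\{|u-a(x)|,|u-b(x)|\}\big)$$ for a.e. $x\in\Omega$ and all $u\in\mathbb{R}^M$. (H5) There exists $C_2>0$ such that $W(x,u)\ge\frac1{C_2}|u|$ for a.e. $x\in\Omega$ and all $u\in\mathbb{R}^M$ with $|u|\ge C_2$. Let $\{\varepsilon_n\}_n$ be a sequence of positive numbers with $\varepsilon_n\to0$, and let $\{u_n\}_n\subset H^1(\Omega;\mathbb{R}^M)$ be such that $$\sup_{n\in\mathbb{N}}\mathcal{F}_{\varepsilon_n}(u_n)<+\infty .$$ Then there exist a subsequence (not relabeled) and a function $u\in BV(\Omega;\{a,b\})$ such that $u_n\to u$ strongly in $L^1(\Omega;\mathbb{R}^M)$.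
   Context: For $\varepsilon>0$ the functional $\mathcal{F}_\varepsilon\colon L^1(\Omega;\mathbb{R}^M)\to[0,+\infty]$ is $$\mathcal{F}_\varepsilon(u)=\int_\Omega\Big[\tfrac1\varepsilon W(x,u(x))+\varepsilon|\nabla u(x)|^2\Big]\,dx$$ if $u\in H^1(\Omega;\mathbb{R}^M)$, and $\mathcal{F}_\varepsilon(u)=+\infty$ otherwise in $L^1(\Omega;\mathbb{R}^M)$. $BV(\Omega;\{a,b\})$ denotes the set of functions $u\in BV(\Omega;\mathbb{R}^M)$ such that $u(x)\in\{a(x),b(x)\}$ for a.e. $x\in\Omega$. *)

theory Defs
  imports "HOL-Analysis.Analysis"
begin

text \<open>
  Functions on \<open>\<Omega>\<close> are total functions on \<open>real ^ 'n\<close> whose values outside \<open>\<Omega>\<close> are never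
  looked at: measurability, integrals and almost-everywhere statements always refer to
  \<open>lebesgue_on \<Omega>\<close>, and no quotient by almost-everywhere equality is taken.
\<close>

text \<open>
  The boundary of \<open>\<Omega>\<close> is locally the graph of a Lipschitz function, with \<open>\<Omega>\<close> on one side of it.
  The unit vector \<open>\<nu>\<close> plays the role of the last axis of a rotated coordinate system; the
  hyperplane orthogonal to \<open>\<nu>\<close> is the copy of \<open>(N - 1)\<close>-dimensional space carrying the
  parametrisation \<open>\<gamma>\<close>, so that no separate type of dimension \<open>N - 1\<close> is needed.
\<close>

definition lipschitz_boundary :: "(real ^ 'n) set \<Rightarrow> bool" where
  "lipschitz_boundary \<Omega> \<longleftrightarrow>
     (\<forall>p \<in> frontier \<Omega>. \<exists>r > 0. \<exists>\<nu> (\<gamma> :: real ^ 'n \<Rightarrow> real) L.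
        norm \<nu> = 1 \<and> L-lipschitz_on {z. z \<bullet> \<nu> = 0} \<gamma> \<and>
        \<Omega> \<inter> ball p r = {y \<in> ball p r. \<gamma> (y - (y \<bullet> \<nu>) *\<^sub>R \<nu>) < y \<bullet> \<nu>})"

definition partial_deriv ::
  "'n \<Rightarrow> (real ^ 'n \<Rightarrow> 'b::real_normed_vector) \<Rightarrow> real ^ 'n \<Rightarrow> 'b" where
  "partial_deriv i \<phi> x = frechet_derivative \<phi> (at x) (axis i 1)"

text \<open>\<open>C\<^sup>1\<close> functions with compact support contained in \<open>\<Omega>\<close>, extended by zero.\<close>

definition C1c :: "(real ^ 'n) set \<Rightarrow> (real ^ 'n \<Rightarrow> 'b::real_normed_vector) set" where
  "C1c \<Omega> = {\<phi>. (\<forall>x. \<phi> differentiable (at x)) \<and> (\<forall>i. continuous_on UNIV (partial_deriv i \<phi>)) \<and>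
               compact (closure {x. \<phi> x \<noteq> 0}) \<and> closure {x. \<phi> x \<noteq> 0} \<subseteq> \<Omega>}"

definition Linfinity :: "(real ^ 'n) set \<Rightarrow> (real ^ 'n \<Rightarrow> 'b::real_normed_vector) set" where
  "Linfinity \<Omega> = {u. u \<in> borel_measurable (lebesgue_on \<Omega>) \<and>
                     (\<exists>C. AE x in lebesgue_on \<Omega>. norm (u x) \<le> C)}"

definition L2 :: "(real ^ 'n) set \<Rightarrow> (real ^ 'n \<Rightarrow> 'b::real_normed_vector) set" where
  "L2 \<Omega> = {u. u \<in> borel_measurable (lebesgue_on \<Omega>) \<and>
              integrable (lebesgue_on \<Omega>) (\<lambda>x. (norm (u x))\<^sup>2)}"

definition L1_loc ::
  "(real ^ 'n) set \<Rightarrow> (real ^ 'n \<Rightarrow> 'b::{banach, second_countable_topology}) set" where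
  "L1_loc \<Omega> = {u. \<forall>K. compact K \<longrightarrow> K \<subseteq> \<Omega> \<longrightarrow> integrable (lebesgue_on K) u}"

text \<open>
  The entry \<open>G x $ j $ i\<close> is the weak \<open>i\<close>-th partial derivative of the \<open>j\<close>-th component of \<open>u\<close>;
  the norm of \<open>real ^ 'n ^ 'm\<close> is the Frobenius norm.
\<close>

definition is_weak_gradient ::
  "(real ^ 'n) set \<Rightarrow> (real ^ 'n \<Rightarrow> real ^ 'm) \<Rightarrow> (real ^ 'n \<Rightarrow> real ^ 'n ^ 'm) \<Rightarrow> bool" where
  "is_weak_gradient \<Omega> u G \<longleftrightarrow>
     u \<in> L1_loc \<Omega> \<and> G \<in> L1_loc \<Omega> \<and>
     (\<forall>\<phi> \<in> C1c \<Omega>. \<forall>i j.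
        (LINT x|lebesgue_on \<Omega>. u x $ j * partial_deriv i \<phi> x) =
        - (LINT x|lebesgue_on \<Omega>. G x $ j $ i * \<phi> x))"

definition H1 :: "(real ^ 'n) set \<Rightarrow> (real ^ 'n \<Rightarrow> real ^ 'm) set" where
  "H1 \<Omega> = {u. u \<in> L2 \<Omega> \<and> (\<exists>G. is_weak_gradient \<Omega> u G \<and> G \<in> L2 \<Omega>)}"

text \<open>On an open set the weak gradient is unique up to null sets, so the choice is immaterial.\<close>

definition weak_gradient ::
  "(real ^ 'n) set \<Rightarrow> (real ^ 'n \<Rightarrow> real ^ 'm) \<Rightarrow> real ^ 'n \<Rightarrow> real ^ 'n ^ 'm" where
  "weak_gradient \<Omega> u = (SOME G. is_weak_gradient \<Omega> u G)"

text \<open>Row-wise divergence of a matrix field.\<close>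

definition divergence :: "(real ^ 'n \<Rightarrow> real ^ 'n ^ 'm) \<Rightarrow> real ^ 'n \<Rightarrow> real ^ 'm" where
  "divergence \<phi> x = (\<chi> j. \<Sum>i\<in>UNIV. partial_deriv i \<phi> x $ j $ i)"

definition variation :: "(real ^ 'n) set \<Rightarrow> (real ^ 'n \<Rightarrow> real ^ 'm) \<Rightarrow> ereal" where
  "variation \<Omega> u = (SUP \<phi> \<in> {\<phi> \<in> C1c \<Omega>. \<forall>x. norm (\<phi> x) \<le> 1}.
                       ereal (LINT x|lebesgue_on \<Omega>. u x \<bullet> divergence \<phi> x))"

definition BV :: "(real ^ 'n) set \<Rightarrow> (real ^ 'n \<Rightarrow> real ^ 'm) set" where
  "BV \<Omega> = {u. integrable (lebesgue_on \<Omega>) u \<and> variation \<Omega> u < \<infinity>}"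

definition BV_wells ::
  "(real ^ 'n) set \<Rightarrow> (real ^ 'n \<Rightarrow> real ^ 'm) \<Rightarrow> (real ^ 'n \<Rightarrow> real ^ 'm) \<Rightarrow>
   (real ^ 'n \<Rightarrow> real ^ 'm) set" where
  "BV_wells \<Omega> a b = {u \<in> BV \<Omega>. AE x in lebesgue_on \<Omega>. u x \<in> {a x, b x}}"

definition caratheodory :: "(real ^ 'n) set \<Rightarrow> (real ^ 'n \<Rightarrow> real ^ 'm \<Rightarrow> real) \<Rightarrow> bool" where
  "caratheodory \<Omega> W \<longleftrightarrow>
     (\<forall>v. (\<lambda>x. W x v) \<in> borel_measurable (lebesgue_on \<Omega>)) \<and>
     (AE x in lebesgue_on \<Omega>. continuous_on UNIV (W x))"

definition energy ::
  "(real ^ 'n) set \<Rightarrow> (real ^ 'n \<Rightarrow> real ^ 'm \<Rightarrow> real) \<Rightarrow> real \<Rightarrow> (real ^ 'n \<Rightarrow> real ^ 'm) \<Rightarrow> ennreal"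
  where
  "energy \<Omega> W \<epsilon> u =
     (if u \<in> H1 \<Omega>
      then \<integral>\<^sup>+ x. ennreal (1 / \<epsilon> * W x (u x) + \<epsilon> * (norm (weak_gradient \<Omega> u x))\<^sup>2) \<partial>lebesgue_on \<Omega>
      else \<infinity>)"

text \<open>Strong convergence in \<open>L\<^sup>1\<close>; integrability of all functions involved is part of the notion.\<close>

definition tendsto_L1 ::
  "(real ^ 'n) set \<Rightarrow> (nat \<Rightarrow> real ^ 'n \<Rightarrow> real ^ 'm) \<Rightarrow> (real ^ 'n \<Rightarrow> real ^ 'm) \<Rightarrow> bool" where
  "tendsto_L1 \<Omega> u v \<longleftrightarrow>
     (\<forall>n. integrable (lebesgue_on \<Omega>) (u n)) \<and> integrable (lebesgue_on \<Omega>) v \<and>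
     (\<lambda>n. LINT x|lebesgue_on \<Omega>. norm (u n x - v x)) \<longlonglongrightarrow> 0"

end

theory Submission
  imports Defs "HOL-Complex_Analysis.Great_Picard"
begin

text \<open>
  The phase \<open>v\<^sub>n = \<Phi>(|u\<^sub>n - a|)\<close>, where \<open>\<Phi>\<close> increases from \<open>0\<close> to \<open>1\<close> on \<open>[\<delta>/4, \<delta>/2]\<close> and is
  constant elsewhere, varies only where \<open>a\<close> varies or where \<open>u\<^sub>n\<close> crosses the zone
  \<open>\<delta>/4 \<le> |u\<^sub>n - a| \<le> \<delta>/2\<close>. There both wells are at distance at least \<open>\<delta>/4\<close>, so \<open>W\<close> is bounded below
  and \<open>|\<nabla>u\<^sub>n| \<le> 1/\<epsilon> + \<epsilon> |\<nabla>u\<^sub>n|\<^sup>2\<close> is controlled by the energy density. Hence \<open>v\<^sub>n\<close> has uniformly bounded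
  variation and converges along a subsequence, necessarily to the characteristic function of a set;
  together with \<open>min (|u\<^sub>n - a|, |u\<^sub>n - b|) \<longlonglongrightarrow> 0\<close> in \<open>L\<^sup>1\<close> this determines the limit of \<open>u\<^sub>n\<close>.

  Bounded variation is expressed throughout by the interior translation estimate
  \<open>\<integral>\<^sub>K |v (x + h) - v x| dx \<le> C |h|\<close>, for compact \<open>K\<close> whose \<open>r\<close>-neighbourhood lies in \<open>\<Omega>\<close> and \<open>|h| < r\<close>.
  It passes to compositions, products and almost everywhere limits without any chain rule in BV, and,
  since the phases are bounded and \<open>\<Omega>\<close> has finite measure, interior estimates already give compactness
  in \<open>L\<^sup>1(\<Omega>)\<close>.
\<close>

section \<open>Translations of integrable functions\<close>

text \<open>The obstacle is that \<open>a\<close> may jump: \<open>|u_n - a|\<close> need not be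
  Sobolev, and differentiating \<open>\<Phi>(|u_n - a|)\<close> would mix the gradient of
  \<open>u_n\<close> with a singular measure. Translations avoid this because their
  \<open>L1\<close> cost adds up along a segment. Over a very short step, the increment of
  \<open>u_n\<close> is its weak gradient times the step up to a vanishing relative error, while the
  motion of \<open>a\<close> costs at most a multiple of the step; summing the steps returns a
  multiple of \<open>|h|\<close>. The two lower bounds on \<open>W\<close> do different work. The
  bound by \<open>f\<close> makes the zone expensive and keeps \<open>u_n\<close> near the wells in
  measure. Linear growth upgrades this to \<open>L1\<close>, since it prevents mass from escaping
  where \<open>|u_n|\<close> is large. Both passages between derivatives and translations rest on
  one function, \<open>t \<mapsto> \<integral> v(x) \<phi>(x - t h) dx\<close>: its mean value
  theorem turns a derivative bound into a translation bound, and its derivative at \<open>0\<close>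
  gives the converse.\<close>

lemma nn_integral_translation:
  fixes f :: "'a::euclidean_space \<Rightarrow> ennreal"
  assumes [measurable]: "f \<in> borel_measurable borel"
  shows "(\<integral>\<^sup>+x. f (x + h) \<partial>lborel) = (\<integral>\<^sup>+x. f x \<partial>lborel)"
proof -
  have "(\<integral>\<^sup>+x. f x \<partial>lborel) = (\<integral>\<^sup>+x. f x \<partial>(distr lborel borel ((+) h)))"
    by (simp add: lborel_distr_plus)
  also have "\<dots> = (\<integral>\<^sup>+x. f (x + h) \<partial>lborel)"
    by (subst nn_integral_distr) (auto simp: add.commute)
  finally show ?thesis by simp
qed

lemma integrable_translation:
  fixes f :: "'a::euclidean_space \<Rightarrow> 'b::{banach, second_countable_topology}"
  assumes "integrable lborel f"
  shows "integrable lborel (\<lambda>x. f (x + h))"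
proof -
  have [measurable]: "f \<in> borel_measurable borel"
    using borel_measurable_integrable[OF assms] by simp
  have "integrable (distr lborel borel ((+) h)) f"
    using assms by (simp add: lborel_distr_plus)
  then show ?thesis
    by (subst (asm) integrable_distr_eq) (auto simp: add.commute)
qed

lemma integral_translation:
  fixes f :: "'a::euclidean_space \<Rightarrow> 'b::{banach, second_countable_topology}"
  assumes [measurable]: "f \<in> borel_measurable borel"
  shows "(LBINT x. f (x + h)) = (LBINT x. f x)"
proof -
  have "(LBINT x. f x) = (\<integral>x. f x \<partial>(distr lborel borel ((+) h)))"
    by (simp add: lborel_distr_plus)
  also have "\<dots> = (LBINT x. f (x + h))"
    by (subst integral_distr) (auto simp: add.commute)
  finally show ?thesis by simp
qed

lemma AE_translation:
  fixes P :: "'a::euclidean_space \<Rightarrow> bool"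
  assumes "AE x in lborel. P x"
  shows "AE x in lborel. P (x + h)"
proof -
  from assms obtain N where N: "N \<in> null_sets lborel" "{x. \<not> P x} \<subseteq> N"
    by (auto simp: eventually_ae_filter)
  then have [measurable]: "N \<in> sets borel" by auto
  have "(\<integral>\<^sup>+x. indicator N (x + h) \<partial>lborel) = (\<integral>\<^sup>+x. indicator N x \<partial>lborel)"
    by (rule nn_integral_translation) measurable
  also have "\<dots> = 0" using N by auto
  finally have "AE x in lborel. indicator N (x + h) = (0::ennreal)"
    by (subst (asm) nn_integral_0_iff_AE) auto
  then show ?thesis
  proof eventually_elim
    case (elim x)
    then have "x + h \<notin> N" by (simp add: indicator_def split: if_splits)
    with N(2) show ?case by blast
  qed
qed

lemma integrable_lborel_bounded_support:
  fixes f :: "'a::euclidean_space \<Rightarrow> real"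
  assumes [measurable]: "f \<in> borel_measurable borel" and K: "bounded K"
    and "\<And>x. \<bar>f x\<bar> \<le> B" "\<And>x. x \<notin> K \<Longrightarrow> f x = 0"
  shows "integrable lborel f"
proof -
  obtain R where R: "K \<subseteq> cball 0 R"
    using K unfolding bounded_iff by (auto simp: subset_eq)
  have "integrable lborel (\<lambda>x. indicator (cball 0 R :: 'a set) x * \<bar>B\<bar>)"
    using emeasure_lborel_cball_finite[of "0::'a" R]
    by (intro integrable_mult_left integrable_real_indicator) auto
  then show ?thesis
  proof (rule Bochner_Integration.integrable_bound)
    show "AE x in lborel. norm (f x) \<le> norm (indicator (cball 0 R) x * \<bar>B\<bar> :: real)"
    proof (rule AE_I2)
      fix x
      show "norm (f x) \<le> norm (indicator (cball 0 R) x * \<bar>B\<bar> :: real)"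
        using assms(3)[of x] assms(4)[of x] R by (cases "x \<in> K") (auto simp: indicator_def)
    qed
  qed simp
qed

text \<open>The library predicate \<open>measurable_on\<close> is defined through limits of
  continuous functions off a negligible set; the detour through \<open>lebesgue\<close> makes this
  available for Borel functions.\<close>

lemma continuous_approximants:
  fixes g :: "'a::euclidean_space \<Rightarrow> real"
  assumes "g \<in> borel_measurable borel"
  obtains G where "\<And>n::nat. continuous_on UNIV (G n)" "AE x in lborel. (\<lambda>n. G n x) \<longlonglongrightarrow> g x"
proof -
  have "g \<in> borel_measurable lebesgue"
    using assms by (simp add: measurable_completion)
  then have "g measurable_on UNIV"
    by (simp add: lebesgue_measurable_imp_measurable_on)
  then obtain N G where "negligible N" "\<And>n::nat. continuous_on UNIV (G n)"
    and G: "\<And>x. x \<notin> N \<Longrightarrow> (\<lambda>n. G n x) \<longlonglongrightarrow> g x"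
    by (auto simp: measurable_on_def)
  moreover have "AE x in lborel. x \<notin> N"
  proof -
    have "AE x in lebesgue. x \<notin> N"
      using \<open>negligible N\<close> by (intro AE_not_in) (simp add: negligible_iff_null_sets)
    then show ?thesis by (simp add: AE_completion_iff)
  qed
  then have "AE x in lborel. (\<lambda>n. G n x) \<longlonglongrightarrow> g x"
    by eventually_elim (rule G)
  ultimately show ?thesis using that by blast
qed

text \<open>Almost everywhere approximation by continuous functions carries no domination. Clipping
  values with \<open>T M\<close> and cutting off in space with \<open>c M\<close> costs little in
  \<open>L1\<close>, and afterwards everything is bounded by \<open>M\<close> on a fixed ball, so
  dominated convergence applies to the clipped approximants.\<close>

lemma continuous_dense_L1:
  fixes g :: "'a::euclidean_space \<Rightarrow> real"
  assumes g: "integrable lborel g" and e: "0 < e"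
  obtains k R B where "continuous_on UNIV k" "\<And>x. R < norm x \<Longrightarrow> k x = 0" "\<And>x. \<bar>k x\<bar> \<le> B"
    "integrable lborel k" "(LBINT x. \<bar>g x - k x\<bar>) < e"
proof -
  have [measurable]: "g \<in> borel_measurable borel"
    using borel_measurable_integrable[OF g] by simp
  obtain G where G: "\<And>n::nat. continuous_on UNIV (G n)" "AE x in lborel. (\<lambda>n. G n x) \<longlonglongrightarrow> g x"
    using continuous_approximants[of g] by auto
  define c where "c M x = max 0 (min 1 (real M + 1 - norm x))" for M and x :: 'a
  define T where "T M y = max (- real M) (min (real M) y)" for M y
  have c: "0 \<le> c M x" "c M x \<le> 1" "real M + 1 < norm x \<Longrightarrow> c M x = 0" "continuous_on UNIV (c M)" for M x
    by (auto simp: c_def intro!: continuous_intros)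
  have T: "\<bar>T M y\<bar> \<le> real M" "\<bar>T M y\<bar> \<le> \<bar>y\<bar>" "continuous_on UNIV (T M)" for M y
    by (auto simp: T_def intro!: continuous_intros)
  have [measurable]: "G n \<in> borel_measurable borel" "c M \<in> borel_measurable borel" "T M \<in> borel_measurable borel" for n M
    using G(1) c(4) T(3) by (auto intro: borel_measurable_continuous_onI)
  have "(\<lambda>M. LBINT x. \<bar>g x - T M (g x) * c M x\<bar>) \<longlonglongrightarrow> (\<integral>x. 0 \<partial>(lborel :: 'a measure))"
  proof (rule integral_dominated_convergence)
    show "integrable lborel (\<lambda>x. 2 * \<bar>g x\<bar>)" using g by auto
    show "AE x in lborel. norm \<bar>g x - T M (g x) * c M x\<bar> \<le> 2 * \<bar>g x\<bar>" for M
    proof (rule AE_I2)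
      fix x
      have "\<bar>T M (g x) * c M x\<bar> \<le> \<bar>g x\<bar> * 1"
        unfolding abs_mult using c(1,2)[of M x] T(2)[of M "g x"] by (intro mult_mono) auto
      then show "norm \<bar>g x - T M (g x) * c M x\<bar> \<le> 2 * \<bar>g x\<bar>" by auto
    qed
    show "AE x in lborel. (\<lambda>M. \<bar>g x - T M (g x) * c M x\<bar>) \<longlonglongrightarrow> 0"
    proof (rule AE_I2)
      fix x
      obtain M0 :: nat where "max \<bar>g x\<bar> (norm x) \<le> real M0" using real_arch_simple by blast
      then have "\<forall>M\<ge>M0. \<bar>g x - T M (g x) * c M x\<bar> = 0"
        by (auto simp: T_def c_def)
      then show "(\<lambda>M. \<bar>g x - T M (g x) * c M x\<bar>) \<longlonglongrightarrow> 0"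
        by (intro tendsto_eventually) (auto simp: eventually_sequentially)
    qed
  qed measurable
  then have "\<forall>\<^sub>F M in sequentially. (LBINT x. \<bar>g x - T M (g x) * c M x\<bar>) < e / 2"
    using e by (intro order_tendstoD) auto
  then obtain M where M: "(LBINT x. \<bar>g x - T M (g x) * c M x\<bar>) < e / 2"
    by (auto simp: eventually_sequentially)
  have bd: "\<bar>T M y * c M x\<bar> \<le> real M" for x y
  proof -
    have "\<bar>T M y * c M x\<bar> \<le> real M * 1"
      unfolding abs_mult using c(1,2)[of M x] T(1)[of M y] by (intro mult_mono) auto
    then show ?thesis by simp
  qed
  have int: "integrable lborel (\<lambda>x. T M (f x) * c M x)" if [measurable]: "f \<in> borel_measurable borel" for f
  proof (rule integrable_lborel_bounded_support[where K="cball 0 (real M + 1)" and B="real M"])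
    show "T M (f x) * c M x = 0" if "x \<notin> cball 0 (real M + 1)" for x
      using c(3)[of M x] that by simp
  qed (simp_all add: bd)
  have "(\<lambda>n. LBINT x. \<bar>T M (g x) * c M x - T M (G n x) * c M x\<bar>) \<longlonglongrightarrow> (\<integral>x. 0 \<partial>(lborel :: 'a measure))"
  proof (rule integral_dominated_convergence)
    show "integrable lborel (\<lambda>x::'a. 2 * (real M * indicator (cball 0 (real M + 1)) x) :: real)"
      using emeasure_lborel_cball_finite[of "0::'a" "real M + 1"]
      by (intro integrable_mult_right integrable_real_indicator) auto
    show "AE x in lborel. norm \<bar>T M (g x) * c M x - T M (G n x) * c M x\<bar>
        \<le> 2 * (real M * indicator (cball 0 (real M + 1)) x)" for n
    proof (rule AE_I2)
      fix x
      show "norm \<bar>T M (g x) * c M x - T M (G n x) * c M x\<bar> \<le> 2 * (real M * indicator (cball 0 (real M + 1)) x)"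
        using bd[of "g x" x] bd[of "G n x" x] c(3)[of M x] by (auto simp: indicator_def)
    qed
    show "AE x in lborel. (\<lambda>n. \<bar>T M (g x) * c M x - T M (G n x) * c M x\<bar>) \<longlonglongrightarrow> 0"
      using G(2)
    proof eventually_elim
      case (elim x)
      have "(\<lambda>n. T M (G n x)) \<longlonglongrightarrow> T M (g x)"
        unfolding T_def by (intro tendsto_intros elim)
      then have "(\<lambda>n. \<bar>T M (g x) * c M x - T M (G n x) * c M x\<bar>) \<longlonglongrightarrow> \<bar>T M (g x) * c M x - T M (g x) * c M x\<bar>"
        by (intro tendsto_intros)
      then show ?case by simp
    qed
  qed measurable
  then have "\<forall>\<^sub>F n in sequentially. (LBINT x. \<bar>T M (g x) * c M x - T M (G n x) * c M x\<bar>) < e / 2"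
    using e by (intro order_tendstoD) auto
  then obtain n where n: "(LBINT x. \<bar>T M (g x) * c M x - T M (G n x) * c M x\<bar>) < e / 2"
    by (auto simp: eventually_sequentially)
  show ?thesis
  proof (rule that[of "\<lambda>x. T M (G n x) * c M x" "real M + 1" "real M"])
    show "continuous_on UNIV (\<lambda>x. T M (G n x) * c M x)"
      using c(4) continuous_on_compose2[OF T(3) G(1)] by (intro continuous_intros) auto
    have i: "integrable lborel (\<lambda>x. T M (g x) * c M x)" "integrable lborel (\<lambda>x. T M (G n x) * c M x)"
      by (rule int, simp)+
    have i': "integrable lborel (\<lambda>x. \<bar>g x - T M (g x) * c M x\<bar>)" "integrable lborel (\<lambda>x. \<bar>g x - T M (G n x) * c M x\<bar>)"
      "integrable lborel (\<lambda>x. \<bar>T M (g x) * c M x - T M (G n x) * c M x\<bar>)"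
      by (rule integrable_abs, rule Bochner_Integration.integrable_diff, fact, fact)+
    have "(LBINT x. \<bar>g x - T M (G n x) * c M x\<bar>)
        \<le> (LBINT x. \<bar>g x - T M (g x) * c M x\<bar> + \<bar>T M (g x) * c M x - T M (G n x) * c M x\<bar>)"
      by (rule integral_mono[OF i'(2) Bochner_Integration.integrable_add[OF i'(1,3)]]) arith
    also have "\<dots> = (LBINT x. \<bar>g x - T M (g x) * c M x\<bar>) + (LBINT x. \<bar>T M (g x) * c M x - T M (G n x) * c M x\<bar>)"
      by (rule Bochner_Integration.integral_add[OF i'(1,3)])
    finally show "(LBINT x. \<bar>g x - T M (G n x) * c M x\<bar>) < e" using M n by linarith
    show "T M (G n x) * c M x = 0" if "real M + 1 < norm x" for x
      using c(3)[of M x] that by simp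
    show "integrable lborel (\<lambda>x. T M (G n x) * c M x)" by (rule int) simp
  qed (rule bd)
qed

lemma L1_translation_continuous:
  fixes g :: "'a::euclidean_space \<Rightarrow> real"
  assumes g: "integrable lborel g" and h: "h \<longlonglongrightarrow> 0"
  shows "(\<lambda>n. LBINT x. \<bar>g (x + h n) - g x\<bar>) \<longlonglongrightarrow> 0"
proof (rule LIMSEQ_I)
  fix e :: real assume e: "0 < e"
  obtain k R B where k: "continuous_on UNIV k" "\<And>x. R < norm x \<Longrightarrow> k x = 0" "\<And>x. \<bar>k x\<bar> \<le> B"
    "integrable lborel k" "(LBINT x. \<bar>g x - k x\<bar>) < e / 4"
    using continuous_dense_L1[OF g, of "e / 4"] e by auto
  have km [measurable]: "k \<in> borel_measurable borel" "g \<in> borel_measurable borel"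
    using borel_measurable_integrable[OF k(4)] borel_measurable_integrable[OF g] by auto
  have hb: "\<forall>\<^sub>F n in sequentially. norm (h n) < 1"
    using tendstoD[OF h, of 1] by (auto simp: dist_norm)
  \<comment> \<open>The \<open>if\<close> restricts to displacements of length below 1, so that a
    single ball of radius \<open>R + 1\<close> carries a dominating function for all
    \<open>n\<close>; the other indices are discarded by \<open>hb\<close>.\<close>
  have "(\<lambda>n. LBINT x. (if norm (h n) < 1 then \<bar>k (x + h n) - k x\<bar> else 0)) \<longlonglongrightarrow> (\<integral>x. 0 \<partial>(lborel :: 'a measure))"
  proof (rule integral_dominated_convergence)
    show "integrable lborel (\<lambda>x::'a. indicator (cball 0 (R + 1)) x * (2 * B))"
      using emeasure_lborel_cball_finite[of "0::'a" "R + 1"]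
      by (intro integrable_mult_left integrable_real_indicator) auto
    show "AE x in lborel. norm (if norm (h n) < 1 then \<bar>k (x + h n) - k x\<bar> else 0)
        \<le> indicator (cball 0 (R + 1)) x * (2 * B)" for n
    proof (rule AE_I2)
      fix x
      have B: "0 \<le> B" using k(3)[of x] by linarith
      show "norm (if norm (h n) < 1 then \<bar>k (x + h n) - k x\<bar> else 0)
          \<le> indicator (cball 0 (R + 1)) x * (2 * B)"
      proof (cases "norm x \<le> R + 1")
        case True
        then show ?thesis using k(3)[of x] k(3)[of "x + h n"] B by auto
      next
        case False
        then have "norm (h n) < 1 \<Longrightarrow> k (x + h n) = 0" "k x = 0"
          using norm_triangle_ineq2[of x "- h n"] by (auto intro!: k(2))
        then show ?thesis using False by auto
      qed
    qed
    show "AE x in lborel. (\<lambda>n. if norm (h n) < 1 then \<bar>k (x + h n) - k x\<bar> else 0) \<longlonglongrightarrow> 0"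
    proof (rule AE_I2)
      fix x
      have "(\<lambda>n. x + h n) \<longlonglongrightarrow> x + 0" by (intro tendsto_intros h)
      then have "(\<lambda>n. k (x + h n)) \<longlonglongrightarrow> k x"
        using k(1) by (auto intro!: continuous_on_tendsto_compose[OF k(1)])
      then have "(\<lambda>n. \<bar>k (x + h n) - k x\<bar>) \<longlonglongrightarrow> \<bar>k x - k x\<bar>" by (intro tendsto_intros)
      then have "(\<lambda>n. \<bar>k (x + h n) - k x\<bar>) \<longlonglongrightarrow> 0" by simp
      then show "(\<lambda>n. if norm (h n) < 1 then \<bar>k (x + h n) - k x\<bar> else 0) \<longlonglongrightarrow> 0"
        by (rule Lim_transform_eventually) (use hb in eventually_elim, auto)
    qed
  qed measurable
  then have "\<forall>\<^sub>F n in sequentially. (LBINT x. (if norm (h n) < 1 then \<bar>k (x + h n) - k x\<bar> else 0)) < e / 4"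
    using e by (intro order_tendstoD) auto
  with hb have "\<forall>\<^sub>F n in sequentially. (LBINT x. \<bar>g (x + h n) - g x\<bar>) < e"
  proof eventually_elim
    case (elim n)
    note i = g k(4) integrable_translation[OF g, of "h n"] integrable_translation[OF k(4), of "h n"]
    have i': "integrable lborel (\<lambda>x. \<bar>g (x + h n) - g x\<bar>)" "integrable lborel (\<lambda>x. \<bar>g (x + h n) - k (x + h n)\<bar>)"
      "integrable lborel (\<lambda>x. \<bar>k (x + h n) - k x\<bar>)" "integrable lborel (\<lambda>x. \<bar>g x - k x\<bar>)"
      using i by (auto intro!: integrable_abs Bochner_Integration.integrable_diff)
    have "(LBINT x. \<bar>g (x + h n) - g x\<bar>) \<le>
        (LBINT x. (\<bar>g (x + h n) - k (x + h n)\<bar> + \<bar>k (x + h n) - k x\<bar>) + \<bar>g x - k x\<bar>)"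
      by (intro integral_mono i' Bochner_Integration.integrable_add) auto
    also have "\<dots> = ((LBINT x. \<bar>g (x + h n) - k (x + h n)\<bar>) + (LBINT x. \<bar>k (x + h n) - k x\<bar>)) + (LBINT x. \<bar>g x - k x\<bar>)"
      by (simp only: Bochner_Integration.integral_add Bochner_Integration.integrable_add i')
    also have "(LBINT x. \<bar>g (x + h n) - k (x + h n)\<bar>) = (LBINT x. \<bar>g x - k x\<bar>)"
      by (rule integral_translation[of "\<lambda>x. \<bar>g x - k x\<bar>"]) measurable
    finally show ?case using elim k(5) e by simp
  qed
  then show "\<exists>N. \<forall>n\<ge>N. norm ((LBINT x. \<bar>g (x + h n) - g x\<bar>) - 0) < e"
    by (auto simp: eventually_sequentially)
qed

lemma L1_translation_small:
  fixes g :: "'a::euclidean_space \<Rightarrow> real"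
  assumes g: "integrable lborel g" and e: "0 < e"
  obtains d where "0 < d" "\<And>z. norm z < d \<Longrightarrow> (LBINT x. \<bar>g (x + z) - g x\<bar>) < e"
proof -
  let ?w = "\<lambda>z. LBINT x. \<bar>g (x + z) - g x\<bar>"
  have "isCont ?w 0"
    unfolding continuous_at_sequentially comp_def using L1_translation_continuous[OF g] by simp
  then have "(?w \<longlongrightarrow> ?w 0) (nhds 0)"
    unfolding isCont_def by (rule tendsto_at_iff_tendsto_nhds[of ?w 0, THEN iffD1])
  then have "\<forall>\<^sub>F z in nhds 0. ?w z < e"
    by (rule order_tendstoD) (use e in simp)
  then show ?thesis
    using that unfolding eventually_nhds_metric by (auto simp: dist_norm)
qed

section \<open>Continuously differentiable functions with compact support\<close>

text \<open>Continuity of the derivative is asked for one direction \<open>h\<close> at a time. On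
  finite-dimensional spaces this is the usual notion, and it is stable under sums, products and
  composition without coordinates; \<open>C1c_eq\<close> links it to the partial derivatives in
  \<open>C1c\<close>.\<close>

definition C1_fun :: "('a::real_normed_vector \<Rightarrow> real) \<Rightarrow> bool" where
  "C1_fun f \<longleftrightarrow> (\<exists>D. (\<forall>x. (f has_derivative D x) (at x)) \<and> (\<forall>h. continuous_on UNIV (\<lambda>x. D x h)))"

lemma C1_funI:
  assumes "\<And>x. (f has_derivative D x) (at x)" "\<And>h. continuous_on UNIV (\<lambda>x. D x h)"
  shows "C1_fun f"
  using assms unfolding C1_fun_def by blast

lemma C1_fun_continuous: "C1_fun f \<Longrightarrow> continuous_on UNIV f"
  unfolding C1_fun_def by (meson continuous_at_imp_continuous_on has_derivative_continuous)

lemma C1_fun_const: "C1_fun (\<lambda>x. c)"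
  by (rule C1_funI[where D="\<lambda>x h. 0"]) auto

lemma C1_fun_add:
  assumes "C1_fun f" "C1_fun g"
  shows "C1_fun (\<lambda>x. f x + g x)"
proof -
  obtain D E where D: "\<And>x. (f has_derivative D x) (at x)" "\<And>h. continuous_on UNIV (\<lambda>x. D x h)"
    and E: "\<And>x. (g has_derivative E x) (at x)" "\<And>h. continuous_on UNIV (\<lambda>x. E x h)"
    using assms unfolding C1_fun_def by blast
  show ?thesis
    by (rule C1_funI[where D="\<lambda>x h. D x h + E x h"]) (auto intro!: derivative_intros continuous_intros D E)
qed

lemma C1_fun_mult:
  assumes "C1_fun f" "C1_fun g"
  shows "C1_fun (\<lambda>x. f x * g x)"
proof -
  obtain D E where D: "\<And>x. (f has_derivative D x) (at x)" "\<And>h. continuous_on UNIV (\<lambda>x. D x h)"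
    and E: "\<And>x. (g has_derivative E x) (at x)" "\<And>h. continuous_on UNIV (\<lambda>x. E x h)"
    using assms unfolding C1_fun_def by blast
  show ?thesis
    by (rule C1_funI[where D="\<lambda>x h. f x * E x h + D x h * g x"])
      (auto intro!: derivative_intros continuous_intros D E C1_fun_continuous[OF assms(1)] C1_fun_continuous[OF assms(2)])
qed

lemma C1_fun_compose:
  assumes "C1_fun f" and g: "\<And>t. (g has_field_derivative g' t) (at t)" "continuous_on UNIV g'"
  shows "C1_fun (\<lambda>x. g (f x))"
proof -
  obtain D where D: "\<And>x. (f has_derivative D x) (at x)" "\<And>h. continuous_on UNIV (\<lambda>x. D x h)"
    using assms unfolding C1_fun_def by blast
  show ?thesis
  proof (rule C1_funI[where D="\<lambda>x h. g' (f x) * D x h"])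
    show "((\<lambda>x. g (f x)) has_derivative (\<lambda>h. g' (f x) * D x h)) (at x)" for x
      using has_derivative_compose[OF D(1) g(1)[unfolded has_field_derivative_def]] by simp
    show "continuous_on UNIV (\<lambda>x. g' (f x) * D x h)" for h
      using continuous_on_compose2[OF g(2) C1_fun_continuous[OF assms(1)]]
      by (intro continuous_intros D) auto
  qed
qed

lemma C1_fun_real_polynomial_function:
  "real_polynomial_function p \<Longrightarrow> C1_fun p"
proof (induction rule: real_polynomial_function.induct)
  case (linear f)
  then show ?case
    by (intro C1_funI[where D="\<lambda>x. f"]) (auto intro: bounded_linear_imp_has_derivative)
qed (auto intro: C1_fun_const C1_fun_add C1_fun_mult)

lemma C1_fun_sum:
  "finite I \<Longrightarrow> (\<And>i. i \<in> I \<Longrightarrow> C1_fun (f i)) \<Longrightarrow> C1_fun (\<lambda>x. \<Sum>i\<in>I. f i x)"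
  by (induction I rule: finite_induct) (auto intro: C1_fun_const C1_fun_add)

lemma C1_fun_translation:
  assumes "C1_fun f"
  shows "C1_fun (\<lambda>x. f (x - z))"
proof -
  obtain D where D: "\<And>x. (f has_derivative D x) (at x)" "\<And>h. continuous_on UNIV (\<lambda>x. D x h)"
    using assms unfolding C1_fun_def by blast
  show ?thesis
  proof (rule C1_funI[where D="\<lambda>x. D (x - z)"])
    have "((\<lambda>x. x - z) has_derivative (\<lambda>h. h)) (at x)" for x
      by (auto intro!: derivative_eq_intros)
    from has_derivative_compose[OF this D(1)]
    show "((\<lambda>x. f (x - z)) has_derivative D (x - z)) (at x)" for x by simp
    show "continuous_on UNIV (\<lambda>x. D (x - z) h)" for h
      by (rule continuous_on_compose2[OF D(2)]) (auto intro: continuous_intros)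
  qed
qed

text \<open>Squaring removes the corner of the positive part at 0. This is the profile from which
  \<open>C1c_bump\<close> makes compactly supported test functions.\<close>

lemma has_field_derivative_pos_part_power2:
  "((\<lambda>t::real. (max 0 t)\<^sup>2) has_field_derivative 2 * max 0 t) (at t)"
proof -
  consider "t > 0" | "t < 0" | "t = 0" by linarith
  then show ?thesis
  proof cases
    case 1
    have "((\<lambda>t::real. t\<^sup>2) has_field_derivative 2 * max 0 t) (at t)"
      using 1 by (auto intro!: derivative_eq_intros)
    then show ?thesis
      by (rule has_field_derivative_transform_within_open[where S="{0<..}"]) (use 1 in auto)
  next
    case 2
    have "((\<lambda>t::real. 0) has_field_derivative 2 * max 0 t) (at t)"
      using 2 by (auto intro!: derivative_eq_intros)
    then show ?thesis
      by (rule has_field_derivative_transform_within_open[where S="{..<0}"]) (use 2 in auto)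
  next
    case 3
    have "((\<lambda>h. (max 0 h)\<^sup>2 / h) \<longlongrightarrow> 0) (at (0::real))"
    proof (rule Lim_null_comparison)
      show "\<forall>\<^sub>F h in at (0::real). norm ((max 0 h)\<^sup>2 / h) \<le> \<bar>h\<bar>"
        by (intro always_eventually allI) (auto simp: max_def power2_eq_square)
      show "((\<lambda>h::real. \<bar>h\<bar>) \<longlongrightarrow> 0) (at 0)" by (intro tendsto_eq_intros) auto
    qed
    then show ?thesis using 3 by (simp add: DERIV_def)
  qed
qed

lemma frechet_derivative_eq_sum_partial_deriv:
  fixes \<phi> :: "real ^ 'n \<Rightarrow> 'b::real_normed_vector"
  assumes "\<phi> differentiable (at x)"
  shows "frechet_derivative \<phi> (at x) h = (\<Sum>i\<in>UNIV. h $ i *\<^sub>R partial_deriv i \<phi> x)"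
proof -
  interpret bounded_linear "frechet_derivative \<phi> (at x)"
    using assms frechet_derivative_works has_derivative_bounded_linear by blast
  have "h = (\<Sum>i\<in>UNIV. h $ i *\<^sub>R axis i 1)"
    using basis_expansion[of h] by (simp add: scalar_mult_eq_scaleR)
  then have "frechet_derivative \<phi> (at x) h = frechet_derivative \<phi> (at x) (\<Sum>i\<in>UNIV. h $ i *\<^sub>R axis i 1)"
    by (rule arg_cong)
  then show ?thesis by (simp add: sum scaleR partial_deriv_def)
qed

lemma C1c_eq:
  "\<phi> \<in> C1c \<Omega> \<longleftrightarrow> C1_fun \<phi> \<and> compact (closure {x. \<phi> x \<noteq> 0}) \<and> closure {x. \<phi> x \<noteq> 0} \<subseteq> \<Omega>"
  for \<phi> :: "real ^ 'n \<Rightarrow> real"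
proof -
  have "C1_fun \<phi>" if *: "\<forall>x. \<phi> differentiable (at x)" "\<forall>i. continuous_on UNIV (partial_deriv i \<phi>)"
  proof (rule C1_funI[where D="\<lambda>x. frechet_derivative \<phi> (at x)"])
    fix x show D: "(\<phi> has_derivative frechet_derivative \<phi> (at x)) (at x)"
      using * frechet_derivative_works by blast
  next
    fix h :: "real ^ 'n"
    have "frechet_derivative \<phi> (at x) h = (\<Sum>i\<in>UNIV. h $ i * partial_deriv i \<phi> x)" for x
      using * by (simp add: frechet_derivative_eq_sum_partial_deriv)
    then show "continuous_on UNIV (\<lambda>x. frechet_derivative \<phi> (at x) h)"
      using *(2) by (simp add: continuous_on_sum continuous_on_mult)
  qed
  moreover have "(\<forall>x. \<phi> differentiable (at x)) \<and> (\<forall>i. continuous_on UNIV (partial_deriv i \<phi>))" if C: "C1_fun \<phi>"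
  proof -
    obtain D where D: "\<And>x. (\<phi> has_derivative D x) (at x)" "\<And>h. continuous_on UNIV (\<lambda>x. D x h)"
      using C unfolding C1_fun_def by blast
    have "frechet_derivative \<phi> (at x) = D x" for x
      using frechet_derivative_at[OF D(1)] by simp
    then show ?thesis using D by (auto simp: differentiable_def partial_deriv_def[abs_def])
  qed
  ultimately show ?thesis unfolding C1c_def by blast
qed

lemma C1cI:
  fixes \<phi> :: "real ^ 'n \<Rightarrow> real"
  assumes "C1_fun \<phi>" "compact K" "K \<subseteq> \<Omega>" "\<And>x. x \<notin> K \<Longrightarrow> \<phi> x = 0"
  shows "\<phi> \<in> C1c \<Omega>"
proof -
  have "closure {x. \<phi> x \<noteq> 0} \<subseteq> K"
    using assms by (intro closure_minimal) (auto simp: compact_imp_closed)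
  moreover from this have "compact (closure {x. \<phi> x \<noteq> 0})"
    using compact_Int_closed[OF assms(2), of "closure {x. \<phi> x \<noteq> 0}"] by (simp add: Int_absorb1)
  ultimately show ?thesis using assms by (auto simp: C1c_eq)
qed

lemma C1c_has_derivative:
  fixes \<phi> :: "real ^ 'n \<Rightarrow> real"
  assumes "\<phi> \<in> C1c \<Omega>"
  shows "(\<phi> has_derivative frechet_derivative \<phi> (at x)) (at x)"
  using assms frechet_derivative_works unfolding C1c_def by blast

lemma C1c_continuous:
  fixes \<phi> :: "real ^ 'n \<Rightarrow> real"
  assumes "\<phi> \<in> C1c \<Omega>"
  shows "continuous_on UNIV \<phi>" "continuous_on UNIV (\<lambda>x. frechet_derivative \<phi> (at x) h)"
proof -
  have C: "C1_fun \<phi>" using assms by (simp add: C1c_eq)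
  then show "continuous_on UNIV \<phi>" by (rule C1_fun_continuous)
  obtain D where D: "\<And>x. (\<phi> has_derivative D x) (at x)" "\<And>h. continuous_on UNIV (\<lambda>x. D x h)"
    using C unfolding C1_fun_def by blast
  have "frechet_derivative \<phi> (at x) = D x" for x
    using frechet_derivative_at[OF D(1)] by simp
  then show "continuous_on UNIV (\<lambda>x. frechet_derivative \<phi> (at x) h)" using D(2) by simp
qed

lemma C1c_support:
  fixes \<phi> :: "real ^ 'n \<Rightarrow> real"
  assumes "\<phi> \<in> C1c \<Omega>"
  obtains K where "compact K" "K \<subseteq> \<Omega>" "\<And>x. x \<notin> K \<Longrightarrow> \<phi> x = 0" "\<And>x h. x \<notin> K \<Longrightarrow> frechet_derivative \<phi> (at x) h = 0"
proof -
  let ?K = "closure {x. \<phi> x \<noteq> 0}"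
  have z: "\<phi> x = 0" if "x \<notin> ?K" for x
    using that closure_subset[of "{x. \<phi> x \<noteq> 0}"] by auto
  have "frechet_derivative \<phi> (at x) h = 0" if "x \<notin> ?K" for x h
  proof -
    have "((\<lambda>x. 0) has_derivative (\<lambda>h. 0)) (at x)" by simp
    then have "(\<phi> has_derivative (\<lambda>h. 0)) (at x)"
    proof (rule has_derivative_transform_within_open)
      show "open (- ?K)" by (rule open_Compl) (rule closed_closure)
      show "x \<in> - ?K" using that by simp
      show "0 = \<phi> y" if "y \<in> - ?K" for y using z[of y] that by simp
    qed
    then have "(\<lambda>h. 0) = frechet_derivative \<phi> (at x)"
      by (rule frechet_derivative_at)
    then show ?thesis by metis
  qed
  moreover have "compact ?K" "?K \<subseteq> \<Omega>" using assms by (simp_all add: C1c_eq)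
  ultimately show ?thesis by (intro that[of ?K] z)
qed

lemma C1c_line_derivative:
  fixes \<phi> :: "real ^ 'n \<Rightarrow> real"
  assumes \<phi>: "\<phi> \<in> C1c \<Omega>"
  shows "((\<lambda>q. \<phi> (x - q *\<^sub>R h)) has_field_derivative - frechet_derivative \<phi> (at (x - t *\<^sub>R h)) h) (at t)"
proof -
  have *: "((\<lambda>q. x - q *\<^sub>R h) has_derivative (\<lambda>d. - (d *\<^sub>R h))) (at t)"
    by (auto intro!: derivative_eq_intros)
  have "linear (frechet_derivative \<phi> (at (x - t *\<^sub>R h)))"
    using C1c_has_derivative[OF \<phi>] has_derivative_linear by blast
  then have "(\<lambda>d. frechet_derivative \<phi> (at (x - t *\<^sub>R h)) (- (d *\<^sub>R h))) = (*) (- frechet_derivative \<phi> (at (x - t *\<^sub>R h)) h)"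
    by (simp add: linear_neg linear_scale fun_eq_iff)
  with has_derivative_compose[OF * C1c_has_derivative[OF \<phi>]]
  show ?thesis by (simp only: has_field_derivative_def)
qed

text \<open>The third bound, the mean value inequality along lines in direction \<open>h\<close>,
  dominates the difference quotients when differentiating under the integral sign.\<close>

lemma C1c_bounded:
  fixes \<phi> :: "real ^ 'n \<Rightarrow> real"
  assumes "\<phi> \<in> C1c \<Omega>"
  obtains B where "\<And>x. \<bar>\<phi> x\<bar> \<le> B" "\<And>x. \<bar>frechet_derivative \<phi> (at x) h\<bar> \<le> B"
    "\<And>x t s. \<bar>\<phi> (x - t *\<^sub>R h) - \<phi> (x - s *\<^sub>R h)\<bar> \<le> B * \<bar>t - s\<bar>"
proof -
  obtain K where K: "compact K" "\<And>x. x \<notin> K \<Longrightarrow> \<phi> x = 0" "\<And>x h. x \<notin> K \<Longrightarrow> frechet_derivative \<phi> (at x) h = 0"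
    using C1c_support[OF assms] by metis
  have "bounded (\<phi> ` K)" "bounded ((\<lambda>x. frechet_derivative \<phi> (at x) h) ` K)"
    using C1c_continuous[OF assms] K(1)
    by (auto intro!: compact_imp_bounded compact_continuous_image intro: continuous_on_subset)
  then obtain B1 B2 where B: "\<And>x. x \<in> K \<Longrightarrow> \<bar>\<phi> x\<bar> \<le> B1" "\<And>x. x \<in> K \<Longrightarrow> \<bar>frechet_derivative \<phi> (at x) h\<bar> \<le> B2"
    unfolding bounded_iff by (auto simp: image_iff)
  define B where "B = max 0 (max B1 B2)"
  have B': "\<bar>\<phi> x\<bar> \<le> B" "\<bar>frechet_derivative \<phi> (at x) h\<bar> \<le> B" for x
    using B[of x] K(2,3)[of x] unfolding B_def by (cases "x \<in> K"; force)+
  have "\<bar>\<phi> (x - t *\<^sub>R h) - \<phi> (x - s *\<^sub>R h)\<bar> \<le> B * \<bar>t - s\<bar>" for x t s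
  proof -
    have "norm (\<phi> (x - t *\<^sub>R h) - \<phi> (x - s *\<^sub>R h)) \<le> B * norm (t - s)"
    proof (rule field_differentiable_bound[OF convex_UNIV])
      fix q :: real
      show "((\<lambda>q. \<phi> (x - q *\<^sub>R h)) has_field_derivative - frechet_derivative \<phi> (at (x - q *\<^sub>R h)) h) (at q within UNIV)"
        by (rule C1c_line_derivative[OF assms])
      show "norm (- frechet_derivative \<phi> (at (x - q *\<^sub>R h)) h) \<le> B" using B'(2) by simp
    qed auto
    then show ?thesis by simp
  qed
  with B' show ?thesis by (rule that)
qed

lemma C1c_translation:
  fixes \<phi> :: "real ^ 'n \<Rightarrow> real"
  assumes \<phi>: "\<phi> \<in> C1c U" and z: "\<And>x. x \<in> U \<Longrightarrow> x + z \<in> \<Omega>"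
  shows "(\<lambda>x. \<phi> (x - z)) \<in> C1c \<Omega>"
    and "frechet_derivative (\<lambda>x. \<phi> (x - z)) (at x) = frechet_derivative \<phi> (at (x - z))"
proof -
  obtain K where K: "compact K" "K \<subseteq> U" "\<And>x. x \<notin> K \<Longrightarrow> \<phi> x = 0"
    using C1c_support[OF \<phi>] by metis
  show "(\<lambda>x. \<phi> (x - z)) \<in> C1c \<Omega>"
  proof (rule C1cI[where K="(+) z ` K"])
    show "C1_fun (\<lambda>x. \<phi> (x - z))" using \<phi> by (intro C1_fun_translation) (simp add: C1c_eq)
    show "compact ((+) z ` K)" using K(1) by (rule compact_translation)
    show "(+) z ` K \<subseteq> \<Omega>" using K(2) z by (auto simp: add.commute)
    show "\<phi> (x - z) = 0" if "x \<notin> (+) z ` K" for x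
    proof (rule K(3))
      show "x - z \<notin> K"
      proof
        assume "x - z \<in> K"
        then have "z + (x - z) \<in> (+) z ` K" by (rule imageI)
        with that show False by simp
      qed
    qed
  qed
  have "((\<lambda>x. x - z) has_derivative (\<lambda>h. h)) (at x)"
    by (auto intro!: derivative_eq_intros)
  from has_derivative_compose[OF this C1c_has_derivative[OF \<phi>]]
  show "frechet_derivative (\<lambda>x. \<phi> (x - z)) (at x) = frechet_derivative \<phi> (at (x - z))"
    by (intro frechet_derivative_at[symmetric]) simp
qed

section \<open>Bump functions and duality for the \<open>L1\<close> norm\<close>

lemma C1c_bump:
  fixes c :: "real ^ 'n"
  assumes r: "0 < r"
  shows "(\<lambda>x. (max 0 (1 - (x - c) \<bullet> (x - c) / r\<^sup>2))\<^sup>2) \<in> C1c (cball c r)"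
proof (rule C1cI[where K="cball c r"])
  have "C1_fun (\<lambda>x. (x - c) \<bullet> (x - c))"
    by (rule C1_funI[where D="\<lambda>x h. 2 * ((x - c) \<bullet> h)"])
      (auto intro!: derivative_eq_intros continuous_intros simp: inner_commute)
  from C1_fun_add[OF C1_fun_const[of 1] C1_fun_mult[OF C1_fun_const[of "- 1 / r\<^sup>2"] this]]
  have "C1_fun (\<lambda>x. 1 - (x - c) \<bullet> (x - c) / r\<^sup>2)" by simp
  then show "C1_fun (\<lambda>x. (max 0 (1 - (x - c) \<bullet> (x - c) / r\<^sup>2))\<^sup>2)"
    by (rule C1_fun_compose[OF _ has_field_derivative_pos_part_power2]) (intro continuous_intros)
  show "(max 0 (1 - (x - c) \<bullet> (x - c) / r\<^sup>2))\<^sup>2 = 0" if "x \<notin> cball c r" for x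
  proof -
    have "r < norm (x - c)" using that by (simp add: dist_norm norm_minus_commute)
    then have "r\<^sup>2 \<le> (norm (x - c))\<^sup>2" using r by (intro power_mono) auto
    then show ?thesis using r by (simp add: power2_norm_eq_inner)
  qed
qed auto

text \<open>A finite subcover of \<open>K\<close> by balls yields a finite sum of bumps. No
  normalisation to 1 on \<open>K\<close> is attempted: the duality argument composes
  \<open>S\<close> with functions that tend to 1 wherever \<open>S\<close> is nonzero.\<close>

lemma C1c_positive_on_compact:
  fixes K :: "(real ^ 'n) set"
  assumes K: "compact K" and U: "open U" "K \<subseteq> U"
  obtains S :: "real ^ 'n \<Rightarrow> real" where "S \<in> C1c U" "\<And>x. 0 \<le> S x" "\<And>x. x \<in> K \<Longrightarrow> 0 < S x"
proof -
  have "\<forall>x\<in>K. \<exists>r>0. cball x r \<subseteq> U" using U open_contains_cball by blast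
  then obtain r where r: "\<And>x. x \<in> K \<Longrightarrow> 0 < r x \<and> cball x (r x) \<subseteq> U" by metis
  obtain C where C: "C \<subseteq> K" "finite C" "K \<subseteq> (\<Union>c\<in>C. ball c (r c))"
    by (rule compactE_image[OF K, of K "\<lambda>c. ball c (r c)"]) (use r in auto)
  define \<beta> where "\<beta> c x = (max 0 (1 - (x - c) \<bullet> (x - c) / (r c)\<^sup>2))\<^sup>2" for c x :: "real ^ 'n"
  have \<beta>: "\<beta> c \<in> C1c (cball c (r c))" if "c \<in> C" for c
    using C1c_bump[of "r c" c] r that C(1) unfolding \<beta>_def[abs_def] by auto
  show ?thesis
  proof (rule that[of "\<lambda>x. \<Sum>c\<in>C. \<beta> c x"])
    show "(\<lambda>x. \<Sum>c\<in>C. \<beta> c x) \<in> C1c U"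
    proof (rule C1cI[where K="\<Union>c\<in>C. cball c (r c)"])
      show "C1_fun (\<lambda>x. \<Sum>c\<in>C. \<beta> c x)"
        using \<beta> C(2) by (intro C1_fun_sum) (auto simp: C1c_eq)
      show "compact (\<Union>c\<in>C. cball c (r c))" using C(2) by (intro compact_UN) auto
      show "(\<Union>c\<in>C. cball c (r c)) \<subseteq> U" using r C(1) by blast
      show "(\<Sum>c\<in>C. \<beta> c x) = 0" if "x \<notin> (\<Union>c\<in>C. cball c (r c))" for x
      proof (rule sum.neutral, rule ballI)
        fix c assume c: "c \<in> C"
        then have "x \<notin> cball c (r c)" using that by blast
        then show "\<beta> c x = 0" using C1c_support[OF \<beta>[OF c]] by (metis subsetD)
      qed
    qed
    show "0 \<le> (\<Sum>c\<in>C. \<beta> c x)" for x by (intro sum_nonneg) (auto simp: \<beta>_def)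
    show "0 < (\<Sum>c\<in>C. \<beta> c x)" if x: "x \<in> K" for x
    proof -
      obtain c where c: "c \<in> C" "x \<in> ball c (r c)" using C(3) x by blast
      then have "norm (x - c) < r c" by (simp add: dist_norm norm_minus_commute)
      then have "(norm (x - c))\<^sup>2 < (r c)\<^sup>2" by (intro power_strict_mono) auto
      moreover have "0 < r c" using r c C(1) by blast
      ultimately have "(x - c) \<bullet> (x - c) / (r c)\<^sup>2 < 1"
        by (subst divide_less_eq_1_pos) (simp_all only: power2_norm_eq_inner zero_less_power)
      then have "0 < \<beta> c x" unfolding \<beta>_def by (intro zero_less_power) simp
      from sum_pos2[OF C(2) c(1), of "\<lambda>c. \<beta> c x", OF this] show ?thesis by (simp add: \<beta>_def)
    qed
  qed
qed

text \<open>The ideal test function \<open>sgn g\<close> is neither smooth nor supported in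
  \<open>U\<close>. Polynomials supply the smoothness and \<open>S\<close> the support; in the limit
  the pairing becomes the integral of \<open>\<bar>g\<bar>\<close> over
  \<open>{x. S x \<noteq> 0}\<close>, a set that contains \<open>K\<close>.\<close>

lemma L1_norm_le_by_duality:
  fixes g :: "real ^ 'n \<Rightarrow> real"
  assumes g: "integrable lborel g" and K: "compact K" and U: "open U" "K \<subseteq> U"
    and dual: "\<And>\<phi>. \<phi> \<in> C1c U \<Longrightarrow> (\<And>x. \<bar>\<phi> x\<bar> \<le> 1) \<Longrightarrow> (LBINT x. g x * \<phi> x) \<le> V"
  shows "(LBINT x. indicator K x * \<bar>g x\<bar>) \<le> V"
proof -
  have [measurable]: "g \<in> borel_measurable borel" "K \<in> sets borel"
    using borel_measurable_integrable[OF g] compact_imp_closed[OF K] by auto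
  obtain S :: "real ^ 'n \<Rightarrow> real" where S: "S \<in> C1c U" "\<And>x. 0 \<le> S x" "\<And>x. x \<in> K \<Longrightarrow> 0 < S x"
    using C1c_positive_on_compact[OF K U] by blast
  obtain L where L: "compact L" "L \<subseteq> U" "\<And>x. x \<notin> L \<Longrightarrow> S x = 0"
    using C1c_support[OF S(1)] by metis
  have [measurable]: "S \<in> borel_measurable borel"
    using C1c_continuous(1)[OF S(1)] by (rule borel_measurable_continuous_onI)
  define s where "s x = sgn (g x)" for x
  have [measurable]: "s \<in> borel_measurable borel" unfolding s_def[abs_def] by measurable
  obtain G where G: "\<And>n::nat. continuous_on UNIV (G n)" "AE x in lborel. (\<lambda>n. G n x) \<longlonglongrightarrow> s x"
    using continuous_approximants[of s] by auto
  \<comment> \<open>Closeness to \<open>G n\<close> is asked only on the compact set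
    \<open>L\<close>, outside which \<open>S\<close> vanishes. The error bound
    \<open>1 / (n + 1)\<close> lets \<open>p n\<close> inherit on \<open>L\<close> the almost
    everywhere limit of \<open>G n\<close>.\<close>
  have "\<exists>p. real_polynomial_function p \<and> (\<forall>x\<in>L. \<bar>G n x - p x\<bar> < inverse (real (Suc n)))" for n
  proof -
    have cont: "continuous_on L (G n)" using G(1) by (rule continuous_on_subset) simp
    show ?thesis
      by (rule Stone_Weierstrass_real_polynomial_function[OF L(1) cont, of "inverse (real (Suc n))"]) (simp, blast)
  qed
  then obtain p where p: "\<And>n. real_polynomial_function (p n)" "\<And>n x. x \<in> L \<Longrightarrow> \<bar>G n x - p n x\<bar> < inverse (real (Suc n))"
    by metis
  \<comment> \<open>Test functions \<open>\<sigma>\<^sub>n(S) \<tau>(p\<^sub>n) \<longlonglongrightarrow> sgn g\<close> on \<open>S \<noteq> 0\<close>: \<open>\<tau>\<close> truncates to \<open>[-1, 1]\<close> and fixes \<open>-1, 0, 1\<close>.\<close>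
  define \<sigma> where "\<sigma> n t = t\<^sup>2 / (t\<^sup>2 + inverse (real (Suc n)))" for n and t :: real
  define \<tau> where "\<tau> t = 2 * t / (1 + t\<^sup>2)" for t :: real
  have pos: "t\<^sup>2 + inverse (real (Suc n)) > 0" for t :: real and n by (simp add: add_nonneg_pos)
  have pos': "1 + t\<^sup>2 > 0" for t :: real by (simp add: add_pos_nonneg)
  have \<sigma>: "C1_fun (\<lambda>x. \<sigma> n (S x))" for n
  proof (rule C1_fun_compose[where g="\<sigma> n" and f=S])
    show "C1_fun S" using S(1) by (simp add: C1c_eq)
    show "(\<sigma> n has_field_derivative
        (2 * t * (t\<^sup>2 + inverse (real (Suc n))) - t\<^sup>2 * (2 * t)) / (t\<^sup>2 + inverse (real (Suc n)))\<^sup>2) (at t)" for t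
      unfolding \<sigma>_def[abs_def] using pos[of t n] by (auto intro!: derivative_eq_intros simp: power2_eq_square)
    show "continuous_on UNIV (\<lambda>t. (2 * t * (t\<^sup>2 + inverse (real (Suc n))) - t\<^sup>2 * (2 * t)) / (t\<^sup>2 + inverse (real (Suc n)))\<^sup>2)"
      using pos[of _ n] by (intro continuous_intros) (metis less_irrefl power_eq_0_iff)
  qed
  have \<tau>: "C1_fun (\<lambda>x. \<tau> (p n x))" for n
  proof (rule C1_fun_compose[where g=\<tau> and f="p n"])
    show "C1_fun (p n)" using p(1) by (rule C1_fun_real_polynomial_function)
    show "(\<tau> has_field_derivative (2 * (1 + t\<^sup>2) - 2 * t * (2 * t)) / (1 + t\<^sup>2)\<^sup>2) (at t)" for t
      unfolding \<tau>_def[abs_def] using pos'[of t] by (auto intro!: derivative_eq_intros simp: power2_eq_square)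
    show "continuous_on UNIV (\<lambda>t::real. (2 * (1 + t\<^sup>2) - 2 * t * (2 * t)) / (1 + t\<^sup>2)\<^sup>2)"
      using pos' by (intro continuous_intros) (metis less_irrefl power_eq_0_iff)
  qed
  have b1: "\<bar>\<sigma> n t\<bar> \<le> 1" for n t
    using pos[of t n] by (simp add: \<sigma>_def abs_of_pos)
  have b2: "\<bar>\<tau> t\<bar> \<le> 1" for t
  proof -
    have "0 \<le> (1 - t)\<^sup>2" "0 \<le> (1 + t)\<^sup>2" by auto
    then have "\<bar>2 * t\<bar> \<le> 1 + t\<^sup>2" by (auto simp: power2_eq_square algebra_simps abs_if)
    then show ?thesis using pos'[of t] by (simp add: \<tau>_def abs_divide)
  qed
  have tau_cont: "continuous_on UNIV \<tau>"
    unfolding \<tau>_def[abs_def] using pos' by (intro continuous_intros) (metis less_irrefl)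
  define \<phi> where "\<phi> n x = \<sigma> n (S x) * \<tau> (p n x)" for n x
  have \<phi>: "\<phi> n \<in> C1c U" for n
    unfolding \<phi>_def
    by (rule C1cI[OF C1_fun_mult[OF \<sigma> \<tau>] L(1,2)]) (simp add: L(3) \<sigma>_def)
  have \<phi>1: "\<bar>\<phi> n x\<bar> \<le> 1" for n x
  proof -
    have "\<bar>\<phi> n x\<bar> \<le> 1 * 1"
      unfolding \<phi>_def abs_mult using b1 b2 by (intro mult_mono) auto
    then show ?thesis by simp
  qed
  have [measurable]: "\<phi> n \<in> borel_measurable borel" for n
    using C1c_continuous(1)[OF \<phi>] by (rule borel_measurable_continuous_onI)
  have sgn: "\<tau> (sgn t) = sgn t" for t by (auto simp: \<tau>_def sgn_if)
  have "(\<lambda>n. LBINT x. g x * \<phi> n x) \<longlonglongrightarrow> (LBINT x. indicator {x. S x \<noteq> 0} x * \<bar>g x\<bar>)"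
  proof (rule integral_dominated_convergence)
    show "integrable lborel (\<lambda>x. \<bar>g x\<bar>)" using g by auto
    show "AE x in lborel. norm (g x * \<phi> n x) \<le> \<bar>g x\<bar>" for n
      using \<phi>1[of n] by (auto simp: abs_mult mult_left_le)
    show "AE x in lborel. (\<lambda>n. g x * \<phi> n x) \<longlonglongrightarrow> indicator {x. S x \<noteq> 0} x * \<bar>g x\<bar>"
      using G(2)
    proof eventually_elim
      case (elim x)
      show ?case
      proof (cases "S x = 0")
        case True
        then show ?thesis by (simp add: \<phi>_def \<sigma>_def)
      next
        case False
        then have x: "x \<in> L" using L(3) by blast
        have "(\<lambda>n. G n x - p n x) \<longlonglongrightarrow> 0"
          by (rule Lim_null_comparison[OF _ LIMSEQ_inverse_real_of_nat])
            (use p(2)[OF x] in \<open>auto intro!: always_eventually less_imp_le\<close>)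
        from tendsto_diff[OF elim this] have "(\<lambda>n. p n x) \<longlonglongrightarrow> s x" by simp
        then have "(\<lambda>n. \<tau> (p n x)) \<longlonglongrightarrow> \<tau> (s x)"
          by (rule continuous_on_tendsto_compose[OF tau_cont]) auto
        moreover have "(\<lambda>n. \<sigma> n (S x)) \<longlonglongrightarrow> (S x)\<^sup>2 / ((S x)\<^sup>2 + 0)"
          unfolding \<sigma>_def by (intro tendsto_intros LIMSEQ_inverse_real_of_nat) (use False in auto)
        ultimately have "(\<lambda>n. g x * (\<sigma> n (S x) * \<tau> (p n x))) \<longlonglongrightarrow> g x * ((S x)\<^sup>2 / ((S x)\<^sup>2 + 0) * \<tau> (s x))"
          by (intro tendsto_intros)
        moreover have "g x * ((S x)\<^sup>2 / ((S x)\<^sup>2 + 0) * \<tau> (s x)) = indicator {x. S x \<noteq> 0} x * \<bar>g x\<bar>"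
          using False by (simp add: sgn s_def abs_sgn)
        ultimately show ?thesis by (simp add: \<phi>_def)
      qed
    qed
  qed measurable
  then have "(LBINT x. indicator {x. S x \<noteq> 0} x * \<bar>g x\<bar>) \<le> V"
    by (rule LIMSEQ_le_const2) (use dual[OF \<phi> \<phi>1] in blast)
  moreover have "(LBINT x. indicator K x * \<bar>g x\<bar>) \<le> (LBINT x. indicator {x. S x \<noteq> 0} x * \<bar>g x\<bar>)"
  proof (rule integral_mono)
    show "integrable lborel (\<lambda>x. indicator K x * \<bar>g x\<bar>)" "integrable lborel (\<lambda>x. indicator {x. S x \<noteq> 0} x * \<bar>g x\<bar>)"
      using g by (auto intro!: integrable_real_mult_indicator simp: mult.commute[of "indicator _ _"])
    show "indicator K x * \<bar>g x\<bar> \<le> indicator {x. S x \<noteq> 0} x * \<bar>g x\<bar>" for x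
      using S(3)[of x] by (auto simp: indicator_def)
  qed
  ultimately show ?thesis by linarith
qed

section \<open>Translation estimates from weak derivatives\<close>

lemma integrable_mult_C1c:
  fixes v :: "real ^ 'n \<Rightarrow> real"
  assumes v: "integrable lborel v" and \<phi>: "\<phi> \<in> C1c \<Omega>"
  shows "integrable lborel (\<lambda>x. v x * \<phi> (x - z))"
    and "integrable lborel (\<lambda>x. v x * frechet_derivative \<phi> (at (x - z)) h)"
proof -
  have [measurable]: "\<phi> \<in> borel_measurable borel" "(\<lambda>x. frechet_derivative \<phi> (at x) h) \<in> borel_measurable borel"
    "v \<in> borel_measurable borel"
    using C1c_continuous[OF \<phi>] borel_measurable_integrable[OF v] by (auto intro: borel_measurable_continuous_onI)
  obtain B where B: "\<And>x. \<bar>\<phi> x\<bar> \<le> B" "\<And>x. \<bar>frechet_derivative \<phi> (at x) h\<bar> \<le> B"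
    using C1c_bounded[OF \<phi>, of h] by metis
  have i: "integrable lborel (\<lambda>x. \<bar>v x\<bar> * B)" using v by auto
  have B0: "0 \<le> B" using B(1)[of 0] by linarith
  show "integrable lborel (\<lambda>x. v x * \<phi> (x - z))"
  proof (rule Bochner_Integration.integrable_bound[OF i])
    show "AE x in lborel. norm (v x * \<phi> (x - z)) \<le> norm (\<bar>v x\<bar> * B)"
      by (intro always_eventually allI) (simp add: abs_mult B0 mult_left_mono B)
  qed measurable
  have m: "(\<lambda>x. frechet_derivative \<phi> (at (x - z)) h) \<in> borel_measurable borel"
    by (rule measurable_compose[of "\<lambda>x. x - z" borel borel "\<lambda>x. frechet_derivative \<phi> (at x) h"]) measurable
  show "integrable lborel (\<lambda>x. v x * frechet_derivative \<phi> (at (x - z)) h)"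
  proof (rule Bochner_Integration.integrable_bound[OF i])
    show "AE x in lborel. norm (v x * frechet_derivative \<phi> (at (x - z)) h) \<le> norm (\<bar>v x\<bar> * B)"
      by (intro always_eventually allI) (simp add: abs_mult B0 mult_left_mono B)
  qed (use m in measurable)
qed

text \<open>The derivative falls on the test function, so integrability of \<open>v\<close> is
  enough: the quotients are dominated by \<open>\<bar>v x\<bar> * B\<close> with the Lipschitz
  constant \<open>B\<close> of \<open>\<phi>\<close> along \<open>h\<close>.\<close>

lemma has_field_derivative_integral_translated:
  fixes v :: "real ^ 'n \<Rightarrow> real"
  assumes v: "integrable lborel v" and \<phi>: "\<phi> \<in> C1c \<Omega>"
  shows "((\<lambda>t. LBINT x. v x * \<phi> (x - t *\<^sub>R h)) has_field_derivative
    - (LBINT x. v x * frechet_derivative \<phi> (at (x - t *\<^sub>R h)) h)) (at t)"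
  unfolding has_field_derivative_iff tendsto_at_iff_sequentially comp_def
proof (intro allI impI)
  fix X :: "nat \<Rightarrow> real" assume X: "\<forall>i. X i \<in> UNIV - {t}" "X \<longlonglongrightarrow> t"
  obtain B where B: "\<And>x. \<bar>\<phi> x\<bar> \<le> B" "\<And>x. \<bar>frechet_derivative \<phi> (at x) h\<bar> \<le> B"
    "\<And>x t s. \<bar>\<phi> (x - t *\<^sub>R h) - \<phi> (x - s *\<^sub>R h)\<bar> \<le> B * \<bar>t - s\<bar>"
    using C1c_bounded[OF \<phi>, of h] by metis
  have B0: "0 \<le> B" using B(1)[of 0] by linarith
  let ?q = "\<lambda>n x. v x * ((\<phi> (x - X n *\<^sub>R h) - \<phi> (x - t *\<^sub>R h)) / (X n - t))"
  have "(\<lambda>n. LBINT x. ?q n x) \<longlonglongrightarrow> (LBINT x. v x * - frechet_derivative \<phi> (at (x - t *\<^sub>R h)) h)"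
  proof (rule integral_dominated_convergence)
    show "integrable lborel (\<lambda>x. \<bar>v x\<bar> * B)" using v by auto
    have m: "\<phi> \<in> borel_measurable borel" "(\<lambda>x. frechet_derivative \<phi> (at (x - t *\<^sub>R h)) h) \<in> borel_measurable borel"
      "v \<in> borel_measurable borel"
      using C1c_continuous[OF \<phi>] borel_measurable_integrable[OF v]
      by (auto intro!: borel_measurable_continuous_onI continuous_on_compose2[OF C1c_continuous(2)[OF \<phi>]] continuous_intros)
    show "(\<lambda>x. v x * - frechet_derivative \<phi> (at (x - t *\<^sub>R h)) h) \<in> borel_measurable lborel"
      using m(2,3) by (auto intro: borel_measurable_times)
    show "?q n \<in> borel_measurable lborel" for n using m(1,3) by measurable
    show "AE x in lborel. norm (?q n x) \<le> \<bar>v x\<bar> * B" for n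
    proof (intro always_eventually allI)
      fix x
      have "\<bar>\<phi> (x - X n *\<^sub>R h) - \<phi> (x - t *\<^sub>R h)\<bar> \<le> B * \<bar>X n - t\<bar>" "X n \<noteq> t"
        using B(3) X(1) by auto
      then have "\<bar>(\<phi> (x - X n *\<^sub>R h) - \<phi> (x - t *\<^sub>R h)) / (X n - t)\<bar> \<le> B"
        by (simp add: abs_divide field_simps)
      then show "norm (?q n x) \<le> \<bar>v x\<bar> * B" by (simp only: real_norm_def abs_mult mult_left_mono abs_ge_zero)
    qed
    show "AE x in lborel. (\<lambda>n. ?q n x) \<longlonglongrightarrow> v x * - frechet_derivative \<phi> (at (x - t *\<^sub>R h)) h"
    proof (intro always_eventually allI tendsto_intros)
      fix x
      have "((\<lambda>q. \<phi> (x - q *\<^sub>R h)) has_field_derivative - frechet_derivative \<phi> (at (x - t *\<^sub>R h)) h) (at t)"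
        by (rule C1c_line_derivative[OF \<phi>])
      then show "(\<lambda>n. (\<phi> (x - X n *\<^sub>R h) - \<phi> (x - t *\<^sub>R h)) / (X n - t)) \<longlonglongrightarrow> - frechet_derivative \<phi> (at (x - t *\<^sub>R h)) h"
        using X unfolding has_field_derivative_iff tendsto_at_iff_sequentially comp_def by blast
    qed
  qed
  moreover have "(LBINT x. ?q n x) = ((LBINT x. v x * \<phi> (x - X n *\<^sub>R h)) - (LBINT x. v x * \<phi> (x - t *\<^sub>R h))) / (X n - t)" for n
  proof -
    have "(LBINT x. v x * \<phi> (x - X n *\<^sub>R h)) - (LBINT x. v x * \<phi> (x - t *\<^sub>R h))
      = (LBINT x. v x * \<phi> (x - X n *\<^sub>R h) - v x * \<phi> (x - t *\<^sub>R h))"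
      by (rule Bochner_Integration.integral_diff[symmetric]) (rule integrable_mult_C1c[OF v \<phi>])+
    then show ?thesis by (simp add: algebra_simps flip: integral_divide_zero)
  qed
  ultimately show "(\<lambda>n. ((LBINT x. v x * \<phi> (x - X n *\<^sub>R h)) - (LBINT x. v x * \<phi> (x - t *\<^sub>R h))) / (X n - t)) \<longlonglongrightarrow>
      - (LBINT x. v x * frechet_derivative \<phi> (at (x - t *\<^sub>R h)) h)"
    by (simp only: mult_minus_right Bochner_Integration.integral_minus)
qed

lemma integral_translation_mult:
  fixes v :: "real ^ 'n \<Rightarrow> real"
  assumes v: "integrable lborel v" and \<phi>: "\<phi> \<in> C1c \<Omega>"
  shows "(LBINT x. v x * \<phi> (x - h)) = (LBINT x. v (x + h) * \<phi> x)"
proof -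
  have "(\<lambda>x. v x * \<phi> (x - h)) \<in> borel_measurable borel"
    using borel_measurable_integrable[OF integrable_mult_C1c(1)[OF v \<phi>]] by simp
  from integral_translation[OF this, of h] show ?thesis by simp
qed

text \<open>By duality it suffices to pair \<open>v (x + h) - v x - g x\<close> with a test
  function. Moving the shift onto \<open>\<phi>\<close> turns the difference of \<open>v\<close>
  into \<open>?F 1 - ?F 0\<close>, and the mean value theorem reduces this to the distributional
  derivative of \<open>v\<close>, tested with a single shift of \<open>\<phi>\<close>. The term
  \<open>g\<close> allows one argument to serve both functions of bounded variation, with
  \<open>g = 0\<close>, and difference quotients of weakly differentiable functions.\<close>

lemma translation_estimate_by_duality:
  fixes v g :: "real ^ 'n \<Rightarrow> real"
  assumes v: "integrable lborel v" and g: "integrable lborel g"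
    and K: "compact K" "\<And>x. x \<in> K \<Longrightarrow> cball x r \<subseteq> \<Omega>" and h: "norm h < r"
    and le: "\<And>\<phi> t. \<phi> \<in> C1c UNIV \<Longrightarrow> (\<And>x. \<bar>\<phi> x\<bar> \<le> 1) \<Longrightarrow> 0 \<le> t \<Longrightarrow> t \<le> 1 \<Longrightarrow> (\<lambda>x. \<phi> (x - t *\<^sub>R h)) \<in> C1c \<Omega> \<Longrightarrow>
      - (LBINT x. v x * frechet_derivative (\<lambda>x. \<phi> (x - t *\<^sub>R h)) (at x) h) - (LBINT x. g x * \<phi> x) \<le> V"
  shows "(LBINT x. indicator K x * \<bar>v (x + h) - v x - g x\<bar>) \<le> V"
proof (rule L1_norm_le_by_duality)
  \<comment> \<open>The radius is \<open>r - norm h\<close>, so that a support in \<open>?U\<close>,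
    moved by any \<open>t *\<^sub>R h\<close> with \<open>t\<close> between 0 and 1, stays within
    distance \<open>r\<close> of \<open>K\<close> and hence inside \<open>\<Omega>\<close>.\<close>
  let ?U = "\<Union>x\<in>K. ball x (r - norm h)"
  show "integrable lborel (\<lambda>x. v (x + h) - v x - g x)"
    by (intro Bochner_Integration.integrable_diff integrable_translation v g)
  show "compact K" by fact
  show "open ?U" by auto
  show "K \<subseteq> ?U" using h by auto
  fix \<phi> :: "real ^ 'n \<Rightarrow> real" assume \<phi>: "\<phi> \<in> C1c ?U" "\<And>x. \<bar>\<phi> x\<bar> \<le> 1"
  have \<phi>': "\<phi> \<in> C1c UNIV" using \<phi>(1) by (simp add: C1c_eq)
  have shift: "(\<lambda>x. \<phi> (x - t *\<^sub>R h)) \<in> C1c \<Omega>" if t: "0 \<le> t" "t \<le> 1" for t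
  proof (rule C1c_translation(1)[OF \<phi>(1)])
    fix y assume "y \<in> ?U"
    then obtain x where x: "x \<in> K" "dist x y < r - norm h" by auto
    have "dist x (y + t *\<^sub>R h) \<le> dist x y + dist y (y + t *\<^sub>R h)" by (rule dist_triangle)
    also have "dist y (y + t *\<^sub>R h) = t * norm h" using t by (simp add: dist_norm)
    also have "\<dots> \<le> 1 * norm h" using t by (intro mult_right_mono) auto
    finally have "y + t *\<^sub>R h \<in> cball x r" using x by simp
    then show "y + t *\<^sub>R h \<in> \<Omega>" using K(2)[OF x(1)] by blast
  qed
  let ?F = "\<lambda>t. LBINT x. v x * \<phi> (x - t *\<^sub>R h)"
  have "\<exists>z::real. z > 0 \<and> z < 1 \<and> ?F 1 - ?F 0 = (1 - 0) * - (LBINT x. v x * frechet_derivative \<phi> (at (x - z *\<^sub>R h)) h)"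
    by (rule MVT2) (auto intro: has_field_derivative_integral_translated[OF v \<phi>'])
  then obtain z :: real where z: "0 < z" "z < 1" "?F 1 - ?F 0 = - (LBINT x. v x * frechet_derivative \<phi> (at (x - z *\<^sub>R h)) h)"
    by auto
  have F: "?F 1 - ?F 0 - (LBINT x. g x * \<phi> x) \<le> V"
    using le[OF \<phi>' \<phi>(2), of z] shift[of z] z by (simp add: C1c_translation(2)[OF \<phi>' UNIV_I])
  have "(LBINT x. (v (x + h) - v x - g x) * \<phi> x) = (LBINT x. v (x + h) * \<phi> x - v x * \<phi> x - g x * \<phi> x)"
    by (simp add: algebra_simps)
  also have "\<dots> = (LBINT x. v (x + h) * \<phi> x) - (LBINT x. v x * \<phi> x) - (LBINT x. g x * \<phi> x)"
    using integrable_mult_C1c(1)[OF v \<phi>', of 0] integrable_mult_C1c(1)[OF g \<phi>', of 0]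
      integrable_mult_C1c(1)[OF integrable_translation[OF v, of h] \<phi>', of 0]
    by simp
  also have "\<dots> = ?F 1 - ?F 0 - (LBINT x. g x * \<phi> x)"
    using integral_translation_mult[OF v \<phi>', of h] by simp
  finally show "(LBINT x. (v (x + h) - v x - g x) * \<phi> x) \<le> V" using F by simp
qed

lemma translation_estimate_bounded_variation:
  fixes v :: "real ^ 'n \<Rightarrow> real"
  assumes v: "integrable lborel v"
    and K: "compact K" "\<And>x. x \<in> K \<Longrightarrow> cball x r \<subseteq> \<Omega>" and h: "norm h < r"
    and var: "\<And>\<phi>. \<phi> \<in> C1c \<Omega> \<Longrightarrow> (\<And>x. \<bar>\<phi> x\<bar> \<le> 1) \<Longrightarrow> \<bar>LBINT x. v x * frechet_derivative \<phi> (at x) h\<bar> \<le> V"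
  shows "(LBINT x. indicator K x * \<bar>v (x + h) - v x\<bar>) \<le> V"
proof -
  have "(LBINT x. indicator K x * \<bar>v (x + h) - v x - 0\<bar>) \<le> V"
  proof (rule translation_estimate_by_duality[OF v _ K h])
    fix \<phi> :: "real ^ 'n \<Rightarrow> real" and t :: real
    assume "\<And>x. \<bar>\<phi> x\<bar> \<le> 1" "(\<lambda>x. \<phi> (x - t *\<^sub>R h)) \<in> C1c \<Omega>"
    then show "- (LBINT x. v x * frechet_derivative (\<lambda>x. \<phi> (x - t *\<^sub>R h)) (at x) h) - (LBINT x. 0 * \<phi> x) \<le> V"
      using var[of "\<lambda>x. \<phi> (x - t *\<^sub>R h)"] by auto
  qed auto
  then show ?thesis by simp
qed

text \<open>The duality lemma is applied to the displacement \<open>s *\<^sub>R h\<close> and to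
  \<open>s * g x\<close>. Integration by parts rewrites the shifted pairing as \<open>s\<close>
  times the pairing of \<open>\<phi>\<close> with \<open>g (x + (t * s) *\<^sub>R h) - g x\<close>,
  so the error is governed by the \<open>L1\<close> modulus of continuity of
  \<open>g\<close>.\<close>

lemma difference_quotient_estimate:
  fixes v g :: "real ^ 'n \<Rightarrow> real"
  assumes v: "integrable lborel v" and g: "integrable lborel g"
    and K: "compact K" "\<And>x. x \<in> K \<Longrightarrow> cball x r \<subseteq> \<Omega>" and s: "0 < s" "norm (s *\<^sub>R h) < r"
    and weak: "\<And>\<phi>. \<phi> \<in> C1c \<Omega> \<Longrightarrow> (LBINT x. v x * frechet_derivative \<phi> (at x) h) = - (LBINT x. g x * \<phi> x)"
    and \<omega>: "\<And>t. 0 \<le> t \<Longrightarrow> t \<le> s \<Longrightarrow> (LBINT x. \<bar>g (x + t *\<^sub>R h) - g x\<bar>) \<le> \<omega>"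
  shows "(LBINT x. indicator K x * \<bar>(v (x + s *\<^sub>R h) - v x) / s - g x\<bar>) \<le> \<omega>"
proof -
  have "(LBINT x. indicator K x * \<bar>v (x + s *\<^sub>R h) - v x - s * g x\<bar>) \<le> s * \<omega>"
  proof (rule translation_estimate_by_duality[OF v _ K s(2)])
    show "integrable lborel (\<lambda>x. s * g x)" using g by auto
    fix \<phi> :: "real ^ 'n \<Rightarrow> real" and t :: real
    assume \<phi>: "\<phi> \<in> C1c UNIV" "\<And>x. \<bar>\<phi> x\<bar> \<le> 1" "(\<lambda>x. \<phi> (x - t *\<^sub>R s *\<^sub>R h)) \<in> C1c \<Omega>" and t: "0 \<le> t" "t \<le> 1"
    let ?\<psi> = "\<lambda>x. \<phi> (x - t *\<^sub>R s *\<^sub>R h)"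
    have lin: "linear (frechet_derivative ?\<psi> (at x))" for x
      using C1c_has_derivative[OF \<phi>(3)] has_derivative_linear by blast
    have "- (LBINT x. v x * frechet_derivative ?\<psi> (at x) (s *\<^sub>R h)) = - s * (LBINT x. v x * frechet_derivative ?\<psi> (at x) h)"
    proof -
      have "frechet_derivative ?\<psi> (at x) (s *\<^sub>R h) = s * frechet_derivative ?\<psi> (at x) h" for x
        using linear_scale[OF lin] by simp
      then show ?thesis by (simp only: mult.left_commute[of _ s]) simp
    qed
    also have "\<dots> = s * (LBINT x. g x * ?\<psi> x)" using weak[OF \<phi>(3)] by simp
    also have "(LBINT x. g x * ?\<psi> x) = (LBINT x. g (x + (t * s) *\<^sub>R h) * \<phi> x)"
      using integral_translation_mult[OF g \<phi>(1), of "(t * s) *\<^sub>R h"] by simp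
    finally have eq: "- (LBINT x. v x * frechet_derivative ?\<psi> (at x) (s *\<^sub>R h)) - (LBINT x. s * g x * \<phi> x)
        = s * ((LBINT x. g (x + (t * s) *\<^sub>R h) * \<phi> x) - (LBINT x. g x * \<phi> x))"
      by (simp add: algebra_simps)
    note i = integrable_mult_C1c(1)[OF g \<phi>(1), of 0, simplified]
      integrable_mult_C1c(1)[OF integrable_translation[OF g, of "(t * s) *\<^sub>R h"] \<phi>(1), of 0, simplified]
    have "(LBINT x. g (x + (t * s) *\<^sub>R h) * \<phi> x) - (LBINT x. g x * \<phi> x)
        = (LBINT x. g (x + (t * s) *\<^sub>R h) * \<phi> x - g x * \<phi> x)"
      using i by simp
    also have "\<dots> \<le> (LBINT x. \<bar>g (x + (t * s) *\<^sub>R h) - g x\<bar>)"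
    proof (rule integral_mono)
      fix x
      have "(g (x + (t * s) *\<^sub>R h) - g x) * \<phi> x \<le> \<bar>g (x + (t * s) *\<^sub>R h) - g x\<bar> * \<bar>\<phi> x\<bar>"
        using abs_ge_self[of "(g (x + (t * s) *\<^sub>R h) - g x) * \<phi> x"] by (simp add: abs_mult)
      also have "\<dots> \<le> \<bar>g (x + (t * s) *\<^sub>R h) - g x\<bar>" using \<phi>(2)[of x] by (simp add: mult_left_le)
      finally show "g (x + (t * s) *\<^sub>R h) * \<phi> x - g x * \<phi> x \<le> \<bar>g (x + (t * s) *\<^sub>R h) - g x\<bar>"
        by (simp add: algebra_simps)
    qed (use i in \<open>auto intro!: integrable_abs Bochner_Integration.integrable_diff integrable_translation g\<close>)
    also have "\<dots> \<le> \<omega>" using t s by (intro \<omega>) (auto simp: mult_left_le_one_le)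
    finally show "- (LBINT x. v x * frechet_derivative ?\<psi> (at x) (s *\<^sub>R h)) - (LBINT x. s * g x * \<phi> x) \<le> s * \<omega>"
      unfolding eq using s(1) by (intro mult_left_mono) auto
  qed auto
  moreover have "\<bar>v (x + s *\<^sub>R h) - v x - s * g x\<bar> = s * \<bar>(v (x + s *\<^sub>R h) - v x) / s - g x\<bar>" for x
    using s(1) by (simp add: abs_if field_simps)
  ultimately have "s * (LBINT x. indicator K x * \<bar>(v (x + s *\<^sub>R h) - v x) / s - g x\<bar>) \<le> s * \<omega>"
    by (simp add: mult.left_commute[of _ s])
  then show ?thesis using s(1) by simp
qed

lemma difference_quotient_tendsto:
  fixes v g :: "real ^ 'n \<Rightarrow> real"
  assumes v: "integrable lborel v" and g: "integrable lborel g"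
    and K: "compact K" "\<And>x. x \<in> K \<Longrightarrow> cball x r \<subseteq> \<Omega>" "0 < r"
    and weak: "\<And>\<phi>. \<phi> \<in> C1c \<Omega> \<Longrightarrow> (LBINT x. v x * frechet_derivative \<phi> (at x) h) = - (LBINT x. g x * \<phi> x)"
    and s: "\<And>n. 0 < s n" "s \<longlonglongrightarrow> 0"
  shows "(\<lambda>n. LBINT x. indicator K x * \<bar>(v (x + s n *\<^sub>R h) - v x) / s n - g x\<bar>) \<longlonglongrightarrow> 0"
proof (rule LIMSEQ_I)
  fix e :: real assume e: "0 < e"
  let ?w = "\<lambda>z. LBINT x. \<bar>g (x + z) - g x\<bar>"
  obtain d where d: "0 < d" "\<And>z. norm z < d \<Longrightarrow> ?w z < e / 2"
    using L1_translation_small[OF g, of "e / 2"] e by auto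
  have "(\<lambda>n. norm (s n *\<^sub>R h)) \<longlonglongrightarrow> norm (0 *\<^sub>R h)" by (intro tendsto_intros s)
  then have "\<forall>\<^sub>F n in sequentially. norm (s n *\<^sub>R h) < min r d"
    using d(1) K(3) by (intro order_tendstoD) auto
  then have "\<forall>\<^sub>F n in sequentially. norm (LBINT x. indicator K x * \<bar>(v (x + s n *\<^sub>R h) - v x) / s n - g x\<bar>) < e"
  proof eventually_elim
    case (elim n)
    have "(LBINT x. indicator K x * \<bar>(v (x + s n *\<^sub>R h) - v x) / s n - g x\<bar>) \<le> e / 2"
    proof (rule difference_quotient_estimate[OF v g K(1,2) s(1) _ weak])
      fix t assume t: "0 \<le> t" "t \<le> s n"
      then have "norm (t *\<^sub>R h) \<le> norm (s n *\<^sub>R h)" by (simp add: mult_right_mono)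
      then show "?w (t *\<^sub>R h) \<le> e / 2" using elim d(2)[of "t *\<^sub>R h"] by simp
    qed (use elim in auto)
    moreover have "0 \<le> (LBINT x. indicator K x * \<bar>(v (x + s n *\<^sub>R h) - v x) / s n - g x\<bar>)"
      by (rule Bochner_Integration.integral_nonneg) simp
    ultimately show ?case using e by simp
  qed
  then show "\<exists>N. \<forall>n\<ge>N. norm ((LBINT x. indicator K x * \<bar>(v (x + s n *\<^sub>R h) - v x) / s n - g x\<bar>) - 0) < e"
    by (simp add: eventually_sequentially)
qed

lemma compact_cball_subset_open:
  fixes K :: "'a::euclidean_space set"
  assumes "compact K" "open U" "K \<subseteq> U"
  obtains r where "0 < r" "\<And>x. x \<in> K \<Longrightarrow> cball x r \<subseteq> U"
proof -
  show ?thesis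
  proof (cases "K = {}")
    case True
    then show ?thesis using that[of 1] by simp
  next
    case False
    obtain e where e: "0 < e" "{x. infdist x K \<le> e} \<subseteq> U"
      by (rule compact_in_open_separated[OF False assms])
    show ?thesis
    proof (rule that[OF e(1)])
      fix x assume "x \<in> K"
      then show "cball x e \<subseteq> U"
        using e(2) infdist_le2[of x K _ e] by (auto simp: dist_commute)
    qed
  qed
qed

text \<open>Converse to \<open>translation_estimate_bounded_variation\<close>. Up to sign, the
  pairing with the derivative of \<open>\<phi>\<close> is the derivative of \<open>?F\<close> at 0,
  hence a limit of quotients that the hypothesis controls once the shift has been moved from
  \<open>\<phi>\<close> to \<open>v\<close>.\<close>

lemma variation_bound_of_translation_estimate:
  fixes v :: "real ^ 'n \<Rightarrow> real"
  assumes v: "integrable lborel v" and \<Omega>: "open \<Omega>"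
    and le: "\<And>K r h. compact K \<Longrightarrow> (\<And>x. x \<in> K \<Longrightarrow> cball x r \<subseteq> \<Omega>) \<Longrightarrow> norm h < r \<Longrightarrow>
      (LBINT x. indicator K x * \<bar>v (x + h) - v x\<bar>) \<le> C * norm h"
    and \<phi>: "\<phi> \<in> C1c \<Omega>" "\<And>x. \<bar>\<phi> x\<bar> \<le> 1"
  shows "\<bar>LBINT x. v x * frechet_derivative \<phi> (at x) h\<bar> \<le> C * norm h"
proof -
  obtain K where K: "compact K" "K \<subseteq> \<Omega>" "\<And>x. x \<notin> K \<Longrightarrow> \<phi> x = 0"
    using C1c_support[OF \<phi>(1)] by metis
  obtain r where r: "0 < r" "\<And>x. x \<in> K \<Longrightarrow> cball x r \<subseteq> \<Omega>"
    using compact_cball_subset_open[OF K(1) \<Omega> K(2)] by metis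
  let ?F = "\<lambda>t. LBINT x. v x * \<phi> (x - t *\<^sub>R h)"
  have "((\<lambda>t. (?F t - ?F 0) / t) \<longlongrightarrow> - (LBINT x. v x * frechet_derivative \<phi> (at x) h)) (at 0)"
    using has_field_derivative_integral_translated[OF v \<phi>(1), where h=h and t=0] unfolding has_field_derivative_iff by simp
  then have lim: "((\<lambda>t. \<bar>(?F t - ?F 0) / t\<bar>) \<longlongrightarrow> \<bar>- (LBINT x. v x * frechet_derivative \<phi> (at x) h)\<bar>) (at_right 0)"
    by (intro tendsto_rabs) (auto intro: tendsto_mono at_le)
  have "\<forall>\<^sub>F t in at_right (0::real). t * norm h < r"
  proof -
    have "((\<lambda>t. t * norm h) \<longlongrightarrow> 0 * norm h) (at_right 0)" by (intro tendsto_intros)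
    then show ?thesis using r(1) by (intro order_tendstoD) auto
  qed
  moreover have "\<forall>\<^sub>F t in at_right (0::real). 0 < t" by (simp add: eventually_at_right_less)
  ultimately have "\<forall>\<^sub>F t in at_right 0. \<bar>(?F t - ?F 0) / t\<bar> \<le> C * norm h"
  proof eventually_elim
    case (elim t)
    have i: "integrable lborel (\<lambda>x. v (x + t *\<^sub>R h) * \<phi> x)" "integrable lborel (\<lambda>x. v x * \<phi> x)"
      using integrable_mult_C1c(1)[OF v \<phi>(1), of 0] integrable_mult_C1c(1)[OF integrable_translation[OF v, of "t *\<^sub>R h"] \<phi>(1), of 0]
      by simp_all
    have "?F t - ?F 0 = (LBINT x. v (x + t *\<^sub>R h) * \<phi> x - v x * \<phi> x)"
      using i integral_translation_mult[OF v \<phi>(1), of "t *\<^sub>R h"] by simp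
    also have "\<bar>\<dots>\<bar> \<le> (LBINT x. \<bar>v (x + t *\<^sub>R h) * \<phi> x - v x * \<phi> x\<bar>)"
      by (rule integral_abs_bound)
    also have "\<dots> \<le> (LBINT x. indicator K x * \<bar>v (x + t *\<^sub>R h) - v x\<bar>)"
    proof (rule integral_mono)
      show "integrable lborel (\<lambda>x. \<bar>v (x + t *\<^sub>R h) * \<phi> x - v x * \<phi> x\<bar>)" using i by auto
      have "integrable lborel (\<lambda>x. \<bar>v (x + t *\<^sub>R h) - v x\<bar> * indicator K x)"
        using K(1) by (intro integrable_real_mult_indicator integrable_abs Bochner_Integration.integrable_diff integrable_translation v)
          (auto simp: compact_imp_closed)
      then show "integrable lborel (\<lambda>x. indicator K x * \<bar>v (x + t *\<^sub>R h) - v x\<bar>)" by (simp add: mult.commute)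
      fix x
      show "\<bar>v (x + t *\<^sub>R h) * \<phi> x - v x * \<phi> x\<bar> \<le> indicator K x * \<bar>v (x + t *\<^sub>R h) - v x\<bar>"
      proof (cases "x \<in> K")
        case True
        have "\<bar>v (x + t *\<^sub>R h) * \<phi> x - v x * \<phi> x\<bar> = \<bar>v (x + t *\<^sub>R h) - v x\<bar> * \<bar>\<phi> x\<bar>"
          by (simp add: abs_mult flip: left_diff_distrib)
        also have "\<dots> \<le> \<bar>v (x + t *\<^sub>R h) - v x\<bar>" using \<phi>(2)[of x] by (simp add: mult_left_le)
        finally show ?thesis using True by simp
      qed (simp add: K(3))
    qed
    also have "\<dots> \<le> C * norm (t *\<^sub>R h)" using le[OF K(1) r(2), of "t *\<^sub>R h"] elim by simp
    finally show ?case using elim by (simp add: field_simps)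
  qed
  then show ?thesis
    using tendsto_upperbound[OF lim] by (simp add: trivial_limit_at_right_real)
qed

section \<open>Compactness from translation estimates\<close>

text \<open>Mollification with the normalised indicator of a ball. A smooth kernel would bring
  nothing here: equicontinuity of the averages already follows from the \<open>L1\<close> continuity
  of translations of the indicator.\<close>

definition ball_average :: "real \<Rightarrow> ('a::euclidean_space \<Rightarrow> real) \<Rightarrow> 'a \<Rightarrow> real" where
  "ball_average \<rho> w x = (LBINT z. indicator (ball 0 \<rho>) z * w (x + z)) / measure lborel (ball (0::'a) \<rho>)"

lemma measure_ball_pos: "0 < \<rho> \<Longrightarrow> 0 < measure lborel (ball (0::'a::euclidean_space) \<rho>)"
  using content_ball_pos[of \<rho> "0::'a"] by simp

lemma borel_measurable_ball_average:
  fixes w :: "'a::euclidean_space \<Rightarrow> real"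
  assumes [measurable]: "w \<in> borel_measurable borel"
  shows "ball_average \<rho> w \<in> borel_measurable borel"
proof -
  have [measurable]: "ball (0::'a) \<rho> \<in> sets borel" by simp
  have "(\<lambda>x. (LBINT z. indicator (ball 0 \<rho>) z * w (x + z))) \<in> borel_measurable borel"
    by measurable
  then show ?thesis unfolding ball_average_def[abs_def] by (intro borel_measurable_divide) auto
qed

lemma integrable_indicator_bounded:
  fixes f :: "'a::euclidean_space \<Rightarrow> real"
  assumes "f \<in> borel_measurable borel" "\<And>x. \<bar>f x\<bar> \<le> B" "bounded K" "K \<in> sets borel"
  shows "integrable lborel (\<lambda>x. indicator K x * f x)"
proof (rule integrable_lborel_bounded_support[OF _ assms(3)])
  show "(\<lambda>x. indicator K x * f x) \<in> borel_measurable borel" using assms(1,4) by measurable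
  show "\<bar>indicator K x * f x\<bar> \<le> \<bar>B\<bar>" for x
    using assms(2)[of x] by (auto simp: indicator_def)
qed simp

lemma ball_average_bounds:
  fixes w :: "'a::euclidean_space \<Rightarrow> real"
  assumes w: "w \<in> borel_measurable borel" "\<And>x. 0 \<le> w x" "\<And>x. w x \<le> 1" and \<rho>: "0 < \<rho>"
  shows "0 \<le> ball_average \<rho> w x" "ball_average \<rho> w x \<le> 1"
proof -
  have [measurable]: "w \<in> borel_measurable borel" by fact
  show "0 \<le> ball_average \<rho> w x"
    unfolding ball_average_def using w(2) by (intro divide_nonneg_nonneg Bochner_Integration.integral_nonneg) auto
  have "(LBINT z. indicator (ball 0 \<rho>) z * w (x + z)) \<le> (LBINT z. indicator (ball (0::'a) \<rho>) z * 1)"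
  proof (rule integral_mono)
    show "integrable lborel (\<lambda>z. indicator (ball 0 \<rho>) z * w (x + z))"
      by (rule integrable_indicator_bounded[where B=1]) (use w in auto)
    show "integrable lborel (\<lambda>z::'a. indicator (ball 0 \<rho>) z * 1 :: real)"
      by (rule integrable_indicator_bounded[where B=1]) auto
    show "indicator (ball 0 \<rho>) z * w (x + z) \<le> indicator (ball 0 \<rho>) z * 1" for z
      using w(3) by (auto simp: indicator_def)
  qed
  then show "ball_average \<rho> w x \<le> 1"
    unfolding ball_average_def using measure_ball_pos[OF \<rho>, where 'a='a] by simp
qed

text \<open>The shift is transferred from \<open>w\<close> to the indicator. The resulting modulus
  of continuity does not involve \<open>w\<close>, which gives equicontinuity along a whole
  sequence.\<close>

lemma ball_average_translation:
  fixes w :: "'a::euclidean_space \<Rightarrow> real"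
  assumes w: "w \<in> borel_measurable borel" "\<And>x. 0 \<le> w x" "\<And>x. w x \<le> 1"
  shows "\<bar>ball_average \<rho> w x - ball_average \<rho> w y\<bar> \<le>
    (LBINT z. \<bar>indicator (ball 0 \<rho>) (z + (y - x)) - indicator (ball 0 \<rho>) z\<bar>) / measure lborel (ball (0::'a) \<rho>)"
proof -
  have [measurable]: "w \<in> borel_measurable borel" by fact
  let ?B = "ball (0::'a) \<rho>"
  have [measurable]: "?B \<in> sets borel" by simp
  have I: "integrable lborel (indicator ?B :: 'a \<Rightarrow> real)"
    using integrable_indicator_bounded[of "\<lambda>_::'a. 1" 1 ?B] by simp
  have I': "integrable lborel (\<lambda>z. indicator ?B (z + (y - x)) :: real)"
    by (rule integrable_translation[OF I])
  have J: "integrable lborel (\<lambda>z. indicator ?B (z + (y - x)) * w (y + z))" "integrable lborel (\<lambda>z. indicator ?B z * w (y + z))"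
    by (rule Bochner_Integration.integrable_bound[OF I'], use w in \<open>auto simp: indicator_def\<close>)
       (rule Bochner_Integration.integrable_bound[OF I], use w in \<open>auto simp: indicator_def\<close>)
  have "(LBINT z. indicator ?B z * w (x + z)) = (LBINT z. indicator ?B (z + (y - x)) * w (x + (z + (y - x))))"
    by (rule integral_translation[symmetric, of "\<lambda>z. indicator ?B z * w (x + z)"]) measurable
  also have "\<dots> = (LBINT z. indicator ?B (z + (y - x)) * w (y + z))"
    by (simp add: algebra_simps)
  finally have "(LBINT z. indicator ?B z * w (x + z)) - (LBINT z. indicator ?B z * w (y + z))
      = (LBINT z. indicator ?B (z + (y - x)) * w (y + z) - indicator ?B z * w (y + z))"
    using J by simp
  then have "\<bar>(LBINT z. indicator ?B z * w (x + z)) - (LBINT z. indicator ?B z * w (y + z))\<bar>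
      \<le> (LBINT z. \<bar>indicator ?B (z + (y - x)) * w (y + z) - indicator ?B z * w (y + z)\<bar>)"
    by (simp only: integral_abs_bound)
  also have "\<dots> \<le> (LBINT z. \<bar>indicator ?B (z + (y - x)) - indicator ?B z\<bar>)"
  proof (rule integral_mono)
    show "integrable lborel (\<lambda>z. \<bar>indicator ?B (z + (y - x)) * w (y + z) - indicator ?B z * w (y + z)\<bar>)"
      by (rule integrable_abs, rule Bochner_Integration.integrable_diff[OF J])
    show "integrable lborel (\<lambda>z. \<bar>indicator ?B (z + (y - x)) - indicator ?B z\<bar> :: real)"
      by (rule integrable_abs, rule Bochner_Integration.integrable_diff[OF I' I])
    show "\<bar>indicator ?B (z + (y - x)) * w (y + z) - indicator ?B z * w (y + z)\<bar>
        \<le> \<bar>indicator ?B (z + (y - x)) - indicator ?B z\<bar>" for z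
      unfolding left_diff_distrib[symmetric] abs_mult using w(2,3)[of "y + z"] by (intro mult_left_le) auto
  qed
  finally show ?thesis
    unfolding ball_average_def diff_divide_distrib[symmetric] abs_divide
    by (simp add: divide_right_mono)
qed

text \<open>The deviation from the mean is at most the mean of the deviations
  \<open>\<bar>w (x + z) - w x\<bar>\<close> over the ball. Integrating over \<open>K\<close> and
  exchanging the order of integration leaves an average over \<open>z\<close> of translation
  differences, each at most \<open>M\<close>. The computation is done in \<open>ennreal\<close>,
  where the exchange needs only measurability.\<close>

lemma ball_average_approx:
  fixes w :: "'a::euclidean_space \<Rightarrow> real"
  assumes w: "w \<in> borel_measurable borel" "\<And>x. 0 \<le> w x" "\<And>x. w x \<le> 1" and \<rho>: "0 < \<rho>" and K: "compact K"
    and le: "\<And>h. norm h < \<rho> \<Longrightarrow> (LBINT x. indicator K x * \<bar>w (x + h) - w x\<bar>) \<le> M"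
  shows "(LBINT x. indicator K x * \<bar>w x - ball_average \<rho> w x\<bar>) \<le> M"
proof -
  have [measurable]: "w \<in> borel_measurable borel" "K \<in> sets borel" "ball_average \<rho> w \<in> borel_measurable borel"
    using w(1) compact_imp_closed[OF K] borel_measurable_ball_average by auto
  let ?B = "ball (0::'a) \<rho>"
  have [measurable]: "?B \<in> sets borel" by simp
  let ?\<mu> = "measure lborel ?B"
  have \<mu>: "0 < ?\<mu>" by (rule measure_ball_pos[OF \<rho>])
  have M: "0 \<le> M"
    using order_trans[OF _ le[of 0]] \<rho> by simp
  have d: "\<bar>w y - w z\<bar> \<le> 1" for y z using w(2,3)[of y] w(2,3)[of z] by auto
  have intK: "integrable lborel (\<lambda>x. indicator K x * \<bar>w (x + h) - w x\<bar>)" for h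
    by (rule integrable_indicator_bounded[where B=1])
      (use d K in \<open>auto simp: compact_imp_bounded\<close>)
  have pt: "\<bar>w x - ball_average \<rho> w x\<bar> * ?\<mu> \<le> (LBINT z. indicator ?B z * \<bar>w (x + z) - w x\<bar>)" for x
  proof -
    have "integrable lborel (\<lambda>z. indicator ?B z * w (x + z))"
      by (rule integrable_indicator_bounded[where B=1]) (use w in auto)
    moreover have "integrable lborel (\<lambda>z. indicator ?B z * w x)"
      by (rule integrable_indicator_bounded[where B=1]) (use w in auto)
    ultimately have "(ball_average \<rho> w x - w x) * ?\<mu> = (LBINT z. indicator ?B z * (w (x + z) - w x))"
      using \<mu> by (simp add: ball_average_def right_diff_distrib left_diff_distrib)
    then have "\<bar>(ball_average \<rho> w x - w x) * ?\<mu>\<bar> \<le> (LBINT z. \<bar>indicator ?B z * (w (x + z) - w x)\<bar>)"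
      by simp
    then show ?thesis by (simp add: abs_mult abs_minus_commute)
  qed
  have "ennreal (LBINT x. indicator K x * \<bar>w x - ball_average \<rho> w x\<bar>) * ennreal ?\<mu>
     = (\<integral>\<^sup>+x. ennreal (indicator K x * \<bar>w x - ball_average \<rho> w x\<bar>) \<partial>lborel) * ennreal ?\<mu>"
  proof (subst nn_integral_eq_integral)
    show "integrable lborel (\<lambda>x. indicator K x * \<bar>w x - ball_average \<rho> w x\<bar>)"
    proof (rule integrable_indicator_bounded[where B=1])
      show "\<bar>\<bar>w x - ball_average \<rho> w x\<bar>\<bar> \<le> 1" for x
        using w(2,3)[of x] ball_average_bounds[OF w \<rho>, of x] by auto
    qed (use K in \<open>auto simp: compact_imp_bounded\<close>)
  qed auto
  also have "\<dots> = (\<integral>\<^sup>+x. ennreal (indicator K x * (\<bar>w x - ball_average \<rho> w x\<bar> * ?\<mu>)) \<partial>lborel)"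
    by (subst nn_integral_multc[symmetric]) (auto simp: ennreal_mult[symmetric] mult.assoc)
  also have "\<dots> \<le> (\<integral>\<^sup>+x. (\<integral>\<^sup>+z. ennreal (indicator ?B z * (indicator K x * \<bar>w (x + z) - w x\<bar>)) \<partial>lborel) \<partial>lborel)"
  proof (rule nn_integral_mono)
    fix x
    have "ennreal (indicator K x * (\<bar>w x - ball_average \<rho> w x\<bar> * ?\<mu>))
        \<le> ennreal (indicator K x * (LBINT z. indicator ?B z * \<bar>w (x + z) - w x\<bar>))"
      using pt[of x] by (intro ennreal_leI mult_left_mono) auto
    also have "\<dots> = ennreal (LBINT z. indicator ?B z * (indicator K x * \<bar>w (x + z) - w x\<bar>))"
      by (simp add: mult.left_commute[of _ "indicator K x"])
    also have "\<dots> = (\<integral>\<^sup>+z. ennreal (indicator ?B z * (indicator K x * \<bar>w (x + z) - w x\<bar>)) \<partial>lborel)"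
    proof (rule nn_integral_eq_integral[symmetric])
      have "\<bar>w (x + z) - w x\<bar> \<le> 1" for z using w(2,3)[of x] w(2,3)[of "x + z"] by auto
      then show "integrable lborel (\<lambda>z. indicator ?B z * (indicator K x * \<bar>w (x + z) - w x\<bar>))"
        by (intro integrable_indicator_bounded[where B=1]) (auto simp: indicator_def)
    qed auto
    finally show "ennreal (indicator K x * (\<bar>w x - ball_average \<rho> w x\<bar> * ?\<mu>)) \<le>
        (\<integral>\<^sup>+z. ennreal (indicator ?B z * (indicator K x * \<bar>w (x + z) - w x\<bar>)) \<partial>lborel)" .
  qed
  also have "\<dots> = (\<integral>\<^sup>+z. (\<integral>\<^sup>+x. ennreal (indicator ?B z * (indicator K x * \<bar>w (x + z) - w x\<bar>)) \<partial>lborel) \<partial>lborel)"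
    by (rule lborel_pair.Fubini'[symmetric]) measurable
  also have "\<dots> \<le> (\<integral>\<^sup>+z. ennreal (indicator ?B z * M) \<partial>lborel)"
  proof (rule nn_integral_mono)
    fix z :: 'a
    show "(\<integral>\<^sup>+x. ennreal (indicator ?B z * (indicator K x * \<bar>w (x + z) - w x\<bar>)) \<partial>lborel) \<le> ennreal (indicator ?B z * M)"
      using le[of z] nn_integral_eq_integral[OF intK[of z]] by (cases "z \<in> ?B") (auto intro: ennreal_leI)
  qed
  also have "\<dots> = ennreal ?\<mu> * ennreal M"
  proof -
    have "integrable lborel (\<lambda>z. indicator ?B z * M)"
      by (rule integrable_indicator_bounded[where B="\<bar>M\<bar>"]) auto
    then show ?thesis using M
      by (subst nn_integral_eq_integral) (auto simp: ennreal_mult[symmetric])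
  qed
  finally have "ennreal ((LBINT x. indicator K x * \<bar>w x - ball_average \<rho> w x\<bar>) * ?\<mu>) \<le> ennreal (?\<mu> * M)"
    using M by (simp add: ennreal_mult)
  then show ?thesis using \<mu> M by (simp add: mult.commute)
qed

text \<open>Arzela-Ascoli in pointwise form. A diagonal subsequence converges on the countable set
  of pairs of a dense point and a radius index; for each radius, equicontinuity then carries the
  Cauchy property from the dense set to every point.\<close>

lemma ball_averages_convergent_subseq:
  fixes w :: "nat \<Rightarrow> 'a::euclidean_space \<Rightarrow> real"
  assumes w: "\<And>n. w n \<in> borel_measurable borel" "\<And>n x. 0 \<le> w n x" "\<And>n x. w n x \<le> 1"
  obtains k :: "nat \<Rightarrow> nat" where "strict_mono k"
    "\<And>x j. convergent (\<lambda>n. ball_average (inverse (real (Suc j))) (w (k n)) x)"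
proof -
  obtain D :: "'a set" where D: "countable D" "\<And>X. open X \<Longrightarrow> X \<noteq> {} \<Longrightarrow> \<exists>d\<in>D. d \<in> X"
    by (rule countable_dense_setE) blast
  define f where "f n = (\<lambda>(x, j). ball_average (inverse (real (Suc j))) (w n) x)" for n
  have \<rho>: "0 < inverse (real (Suc j))" for j by simp
  have fb: "norm (f n p) \<le> 1" for n p
    using ball_average_bounds[OF w(1) w(2) w(3) \<rho>] by (auto simp: f_def split: prod.split)
  have "countable (D \<times> (UNIV :: nat set))" using D(1) by auto
  from function_convergent_subsequence[OF this, of f 1] fb
  obtain k where k: "strict_mono (k :: nat \<Rightarrow> nat)"
    "\<And>p. p \<in> D \<times> UNIV \<Longrightarrow> \<exists>l. (\<lambda>n. f (k n) p) \<longlonglongrightarrow> l"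
    by metis
  have "convergent (\<lambda>n. ball_average (inverse (real (Suc j))) (w (k n)) x)" for x j
  proof -
    let ?\<rho> = "inverse (real (Suc j))"
    let ?A = "\<lambda>n x. ball_average ?\<rho> (w (k n)) x"
    let ?\<mu> = "measure lborel (ball (0::'a) ?\<rho>)"
    let ?i = "indicator (ball (0::'a) ?\<rho>) :: 'a \<Rightarrow> real"
    have I: "integrable lborel ?i"
      using integrable_indicator_bounded[of "\<lambda>_::'a. 1" 1 "ball 0 ?\<rho>"] by simp
    have "Cauchy (\<lambda>n. ?A n x)"
    proof (rule metric_CauchyI)
      fix e :: real assume e: "0 < e"
      have \<mu>: "0 < ?\<mu>" by (rule measure_ball_pos[OF \<rho>])
      with e have "0 < e / 3 * ?\<mu>" by simp
      from L1_translation_small[OF I this]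
      obtain d where d0: "0 < d" "\<And>z. norm z < d \<Longrightarrow> (LBINT y. \<bar>?i (y + z) - ?i y\<bar>) < e / 3 * ?\<mu>"
        by blast
      have d: "0 < d" "\<And>z. norm z < d \<Longrightarrow> (LBINT y. \<bar>?i (y + z) - ?i y\<bar>) / ?\<mu> < e / 3"
        using d0 \<mu> by (simp_all add: pos_divide_less_eq)
      obtain y where y: "y \<in> D" "y \<in> ball x d" using D(2)[of "ball x d"] d(1) by auto
      have near: "\<bar>?A n x - ?A n y\<bar> < e / 3" for n
      proof -
        have "norm (y - x) < d" using y(2) by (simp add: dist_norm norm_minus_commute)
        from order.strict_trans1[OF ball_average_translation[OF w(1) w(2) w(3)] d(2)[OF this]]
        show ?thesis .
      qed
      have "convergent (\<lambda>n. ?A n y)"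
        using k(2)[of "(y, j)"] y(1) by (simp add: f_def convergent_def)
      then have "Cauchy (\<lambda>n. ?A n y)" by (rule convergent_Cauchy)
      then obtain N where N: "\<And>m n. m \<ge> N \<Longrightarrow> n \<ge> N \<Longrightarrow> dist (?A m y) (?A n y) < e / 3"
        using e unfolding Cauchy_def by (meson divide_pos_pos zero_less_numeral)
      have "dist (?A m x) (?A n x) < e" if "m \<ge> N" "n \<ge> N" for m n
        using near[of m] near[of n] N[OF that] unfolding dist_real_def by linarith
      then show "\<exists>N. \<forall>m\<ge>N. \<forall>n\<ge>N. dist (?A m x) (?A n x) < e" by blast
    qed
    then show ?thesis by (simp add: Cauchy_convergent_iff)
  qed
  with k(1) show ?thesis by (rule that)
qed

lemma compact_inner_approximation:
  fixes \<Omega> :: "'a::euclidean_space set"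
  assumes "open \<Omega>" "bounded \<Omega>" "0 < e"
  obtains K where "compact K" "K \<subseteq> \<Omega>" "measure lborel (\<Omega> - K) < e"
proof -
  obtain T where T: "closed T" "T \<subseteq> \<Omega>" "emeasure lebesgue (\<Omega> - T) < ennreal e"
    using sets_lebesgue_inner_closed[of \<Omega> e] assms by (metis borel_open sets_completionI_sets sets_lborel)
  have "compact T" using T assms(2) by (meson bounded_subset compact_eq_bounded_closed)
  moreover have "emeasure lborel (\<Omega> - T) < ennreal e"
    using T assms(1) by (simp add: emeasure_completion)
  then have "measure lborel (\<Omega> - T) < e"
  proof -
    have "emeasure lborel (\<Omega> - T) \<noteq> top"
      using \<open>emeasure lborel (\<Omega> - T) < ennreal e\<close> by (metis ennreal_less_top order_less_trans less_irrefl)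
    then show ?thesis
      using \<open>emeasure lborel (\<Omega> - T) < ennreal e\<close> by (simp add: emeasure_eq_ennreal_measure ennreal_less_iff)
  qed
  ultimately show ?thesis using that T(2) by blast
qed

text \<open>The Kolmogorov-Riesz argument on interior compact sets: the translation estimate makes
  \<open>w n\<close> close to its ball average uniformly in \<open>n\<close>, and the averages
  converge along a subsequence. The layer near the boundary is absorbed by
  \<open>0 \<le> w \<le> 1\<close> and the small measure of \<open>\<Omega> - K\<close>. An
  \<open>L1\<close> Cauchy sequence has a further subsequence that converges almost
  everywhere.\<close>

lemma translation_estimate_compactness:
  fixes w :: "nat \<Rightarrow> 'a::euclidean_space \<Rightarrow> real"
  assumes \<Omega>: "open \<Omega>" "bounded \<Omega>"
    and w: "\<And>n. w n \<in> borel_measurable borel" "\<And>n x. 0 \<le> w n x" "\<And>n x. w n x \<le> 1"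
    and le: "\<And>n K r h. compact K \<Longrightarrow> (\<And>x. x \<in> K \<Longrightarrow> cball x r \<subseteq> \<Omega>) \<Longrightarrow> norm h < r \<Longrightarrow>
      (LBINT x. indicator K x * \<bar>w n (x + h) - w n x\<bar>) \<le> C * norm h"
  obtains k :: "nat \<Rightarrow> nat" where "strict_mono k" "AE x in lborel. x \<in> \<Omega> \<longrightarrow> convergent (\<lambda>n. w (k n) x)"
proof -
  have [measurable]: "w n \<in> borel_measurable borel" "\<Omega> \<in> sets borel" for n
    using w(1) \<Omega>(1) by auto
  obtain k where k: "strict_mono k"
    "\<And>x j. convergent (\<lambda>n. ball_average (inverse (real (Suc j))) (w (k n)) x)"
    using ball_averages_convergent_subseq[of w] w by metis
  have dw: "\<bar>w i x - w j x\<bar> \<le> 1" for i j x using w(2,3)[of i x] w(2,3)[of j x] by auto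
  have Cauchy: "\<exists>N. \<forall>i\<ge>N. \<forall>j\<ge>N. (LBINT x. norm (indicator \<Omega> x * w (k i) x - indicator \<Omega> x * w (k j) x)) < e"
    if e: "0 < e" for e
  proof -
    obtain K where K: "compact K" "K \<subseteq> \<Omega>" "measure lborel (\<Omega> - K) < e / 5"
      using compact_inner_approximation[OF \<Omega>, of "e / 5"] e by auto
    have [measurable]: "K \<in> sets borel" using K(1) by (simp add: compact_imp_closed)
    have Kb: "bounded K" using K(1) by (rule compact_imp_bounded)
    obtain r where r: "0 < r" "\<And>x. x \<in> K \<Longrightarrow> cball x r \<subseteq> \<Omega>"
      using compact_cball_subset_open[OF K(1) \<Omega>(1) K(2)] by metis
    \<comment> \<open>The radius \<open>1 / (j + 1)\<close> must stay below \<open>r\<close>, so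
      that the translations remain in \<open>\<Omega>\<close>, and must make
      \<open>\<bar>C\<bar> * \<rho>\<close> smaller than \<open>e / 5\<close>. The summand 1 keeps
      the denominator positive, and the absolute value is there because the sign of \<open>C\<close>
      is not prescribed.\<close>
    obtain j :: nat where j: "inverse (real (Suc j)) < min r (e / (5 * (\<bar>C\<bar> + 1)))"
      using reals_Archimedean[of "min r (e / (5 * (\<bar>C\<bar> + 1)))"] r(1) e by auto
    define \<rho> where "\<rho> = inverse (real (Suc j))"
    have \<rho>: "0 < \<rho>" "\<rho> < r" "\<bar>C\<bar> * \<rho> < e / 5"
    proof -
      show "0 < \<rho>" "\<rho> < r" using j by (simp_all add: \<rho>_def)
      have "\<rho> < e / (5 * (\<bar>C\<bar> + 1))" using j by (simp add: \<rho>_def)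
      then have "\<rho> * (\<bar>C\<bar> + 1) < e / 5" by (simp add: field_simps)
      then show "\<bar>C\<bar> * \<rho> < e / 5" using \<open>0 < \<rho>\<close> by (simp add: algebra_simps)
    qed
    let ?A = "\<lambda>n. ball_average \<rho> (w (k n))"
    have [measurable]: "?A n \<in> borel_measurable borel" for n
      by (rule borel_measurable_ball_average[OF w(1)])
    have Ab: "0 \<le> ?A n x" "?A n x \<le> 1" for n x
      by (rule ball_average_bounds[OF w(1) w(2) w(3) \<rho>(1)])+
    define L where "L x = lim (\<lambda>n. ?A n x)" for x
    have L: "(\<lambda>n. ?A n x) \<longlonglongrightarrow> L x" for x
      using k(2)[where j=j and x=x] unfolding L_def \<rho>_def by (simp add: convergent_LIMSEQ_iff)
    have [measurable]: "L \<in> borel_measurable borel"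
      by (rule borel_measurable_LIMSEQ_real[OF L]) measurable
    have Lb: "0 \<le> L x" "L x \<le> 1" for x
      using LIMSEQ_le_const[OF L] LIMSEQ_le_const2[OF L] Ab by blast+
    have dAL: "\<bar>?A n x - L x\<bar> \<le> 1" and dwA: "\<bar>w (k n) x - ?A n x\<bar> \<le> 1" for n x
      using Ab[of n x] Lb[of x] w(2,3)[of "k n" x] by linarith+
    have "(\<lambda>n. LBINT x. indicator K x * \<bar>?A n x - L x\<bar>) \<longlonglongrightarrow> (\<integral>x. 0 \<partial>(lborel :: 'a measure))"
    proof (rule integral_dominated_convergence)
      show "integrable lborel (\<lambda>x. indicator K x * 1 :: real)"
        by (rule integrable_indicator_bounded[where B=1]) (use Kb in auto)
      show "AE x in lborel. norm (indicator K x * \<bar>?A n x - L x\<bar>) \<le> indicator K x * 1" for n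
        using dAL by (intro always_eventually allI) (simp add: indicator_def)
      show "AE x in lborel. (\<lambda>n. indicator K x * \<bar>?A n x - L x\<bar>) \<longlonglongrightarrow> 0"
      proof (rule always_eventually, rule allI)
        fix x
        have "(\<lambda>n. indicator K x * \<bar>?A n x - L x\<bar>) \<longlonglongrightarrow> indicator K x * \<bar>L x - L x\<bar>"
          by (intro tendsto_intros L)
        then show "(\<lambda>n. indicator K x * \<bar>?A n x - L x\<bar>) \<longlonglongrightarrow> 0" by simp
      qed
    qed measurable
    then have "\<forall>\<^sub>F n in sequentially. (LBINT x. indicator K x * \<bar>?A n x - L x\<bar>) < e / 5"
      using e by (intro order_tendstoD) auto
    then obtain N where N: "\<And>n. n \<ge> N \<Longrightarrow> (LBINT x. indicator K x * \<bar>?A n x - L x\<bar>) < e / 5"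
      by (auto simp: eventually_sequentially)
    have approx: "(LBINT x. indicator K x * \<bar>w (k n) x - ?A n x\<bar>) < e / 5" for n
    proof -
      have "(LBINT x. indicator K x * \<bar>w (k n) x - ?A n x\<bar>) \<le> \<bar>C\<bar> * \<rho>"
      proof (rule ball_average_approx[OF w(1) w(2) w(3) \<rho>(1) K(1)])
        fix h :: 'a assume h: "norm h < \<rho>"
        have "(LBINT x. indicator K x * \<bar>w (k n) (x + h) - w (k n) x\<bar>) \<le> C * norm h"
          using h \<rho>(2) by (intro le[OF K(1) r(2)]) auto
        also have "\<dots> \<le> \<bar>C\<bar> * norm h" by (intro mult_right_mono) auto
        also have "\<dots> \<le> \<bar>C\<bar> * \<rho>" using h by (intro mult_left_mono) auto
        finally show "(LBINT x. indicator K x * \<bar>w (k n) (x + h) - w (k n) x\<bar>) \<le> \<bar>C\<bar> * \<rho>" .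
      qed
      then show ?thesis using \<rho>(3) by linarith
    qed
    have "(LBINT x. norm (indicator \<Omega> x * w (k m) x - indicator \<Omega> x * w (k n) x)) < e" if mn: "m \<ge> N" "n \<ge> N" for m n
    proof -
      have i1: "integrable lborel (\<lambda>x. indicator K x * \<bar>w (k n) x - ?A n x\<bar>)" for n
        by (rule integrable_indicator_bounded[where B=1]) (use dwA Kb in simp_all)
      have i2: "integrable lborel (\<lambda>x. indicator K x * \<bar>?A n x - L x\<bar>)" for n
        by (rule integrable_indicator_bounded[where B=1]) (use dAL Kb in simp_all)
      have i3: "integrable lborel (\<lambda>x. indicator (\<Omega> - K) x * 1 :: real)"
        by (rule integrable_indicator_bounded[where B=1]) (use \<Omega>(2) in \<open>simp_all add: bounded_diff\<close>)
      have i4: "integrable lborel (\<lambda>x. norm (indicator \<Omega> x * w (k m) x - indicator \<Omega> x * w (k n) x))"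
        using integrable_indicator_bounded[of "\<lambda>x. \<bar>w (k m) x - w (k n) x\<bar>" 1 \<Omega>] dw \<Omega>(2)
        by (simp add: abs_mult flip: right_diff_distrib)
      \<comment> \<open>Five pieces, each below \<open>e / 5\<close>: the layer
        \<open>\<Omega> - K\<close>, where two values in \<open>[0, 1]\<close> differ by at most 1,
        and on \<open>K\<close> the chain from \<open>w (k m)\<close> through its average, the limit
        \<open>L\<close> and the average of \<open>w (k n)\<close> to
        \<open>w (k n)\<close>.\<close>
      have "(LBINT x. norm (indicator \<Omega> x * w (k m) x - indicator \<Omega> x * w (k n) x)) \<le>
        (LBINT x. indicator (\<Omega> - K) x * 1 + (indicator K x * \<bar>w (k m) x - ?A m x\<bar> + (indicator K x * \<bar>?A m x - L x\<bar>
          + (indicator K x * \<bar>w (k n) x - ?A n x\<bar> + indicator K x * \<bar>?A n x - L x\<bar>))))"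
      proof (rule integral_mono)
        show "norm (indicator \<Omega> x * w (k m) x - indicator \<Omega> x * w (k n) x) \<le>
          indicator (\<Omega> - K) x * 1 + (indicator K x * \<bar>w (k m) x - ?A m x\<bar> + (indicator K x * \<bar>?A m x - L x\<bar>
          + (indicator K x * \<bar>w (k n) x - ?A n x\<bar> + indicator K x * \<bar>?A n x - L x\<bar>)))" for x
          using dw[of "k m" x "k n"] K(2) by (auto simp: indicator_def)
      qed (intro Bochner_Integration.integrable_add i1 i2 i3 i4)+
      also have "\<dots> = (LBINT x. indicator (\<Omega> - K) x * 1) + ((LBINT x. indicator K x * \<bar>w (k m) x - ?A m x\<bar>) + ((LBINT x. indicator K x * \<bar>?A m x - L x\<bar>)
          + ((LBINT x. indicator K x * \<bar>w (k n) x - ?A n x\<bar>) + (LBINT x. indicator K x * \<bar>?A n x - L x\<bar>))))"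
        by (simp only: Bochner_Integration.integral_add Bochner_Integration.integrable_add i1 i2 i3)
      also have "(LBINT x. indicator (\<Omega> - K) x * 1) = measure lborel (\<Omega> - K)" by simp
      finally show ?thesis
        using K(3) approx[of m] approx[of n] N[OF mn(1)] N[OF mn(2)] by linarith
    qed
    then show ?thesis by blast
  qed
  have "integrable lborel (\<lambda>x. indicator \<Omega> x * w (k n) x)" for n
    by (rule integrable_indicator_bounded[where B=1]) (use w \<Omega>(2) in auto)
  from cauchy_L1_AE_cauchy_subseq[OF this Cauchy]
  obtain l where l: "strict_mono l" "AE x in lborel. Cauchy (\<lambda>i. indicator \<Omega> x * w (k (l i)) x)"
    by blast
  show ?thesis
  proof (rule that[of "k \<circ> l"])
    show "strict_mono (k \<circ> l)" using k(1) l(1) by (rule strict_mono_o)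
    show "AE x in lborel. x \<in> \<Omega> \<longrightarrow> convergent (\<lambda>n. w ((k \<circ> l) n) x)"
      using l(2) by eventually_elim (auto simp: Cauchy_convergent_iff)
  qed
qed

section \<open>Translation estimate for the phase function\<close>

text \<open>The function \<Phi> of the overview, a linear ramp of slope \<open>4 / \<delta>\<close>.
  With wells at least \<open>\<delta>\<close> apart, a point closer than \<open>\<delta> / 4\<close>
  to one well lies on the plateau 0 (near \<open>a\<close>) or 1 (near \<open>b\<close>), so the
  phase tells the wells apart exactly.\<close>

definition phase :: "real \<Rightarrow> real \<Rightarrow> real" where
  "phase \<delta> s = max 0 (min 1 (4 * s / \<delta> - 1))"

lemma phase_bounds: "0 \<le> phase \<delta> s" "phase \<delta> s \<le> 1"
  by (auto simp: phase_def)

lemma phase_eq_0: "0 < \<delta> \<Longrightarrow> s \<le> \<delta> / 4 \<Longrightarrow> phase \<delta> s = 0"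
  by (simp add: phase_def field_simps)

lemma phase_eq_1: "0 < \<delta> \<Longrightarrow> \<delta> / 2 \<le> s \<Longrightarrow> phase \<delta> s = 1"
  by (simp add: phase_def field_simps)

lemma phase_continuous: "continuous_on UNIV (phase \<delta>)"
  unfolding phase_def[abs_def] divide_inverse by (intro continuous_intros)

lemma phase_lipschitz:
  assumes "0 < \<delta>"
  shows "\<bar>phase \<delta> s - phase \<delta> t\<bar> \<le> 4 / \<delta> * \<bar>s - t\<bar>"
proof -
  have "\<bar>phase \<delta> s - phase \<delta> t\<bar> \<le> \<bar>4 * s / \<delta> - 4 * t / \<delta>\<bar>"
    unfolding phase_def by (auto simp: max_def min_def)
  also have "\<dots> = \<bar>4 / \<delta> * (s - t)\<bar>" by (simp add: diff_divide_distrib right_diff_distrib)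
  also have "\<dots> = 4 / \<delta> * \<bar>s - t\<bar>" unfolding abs_mult using assms by simp
  finally show ?thesis .
qed

text \<open>The displacement is cut into \<open>Suc m\<close> equal steps. The intermediate points
  lie in \<open>L\<close>, and after translating back every step contributes at most the same
  integral over \<open>L\<close>.\<close>

lemma translation_telescope:
  fixes w :: "'a::euclidean_space \<Rightarrow> real"
  assumes w: "w \<in> borel_measurable borel" "\<And>x. 0 \<le> w x" "\<And>x. w x \<le> 1"
    and K: "K \<in> sets borel" "bounded K" and L: "L \<in> sets borel" "bounded L"
    and KL: "\<And>x t. x \<in> K \<Longrightarrow> 0 \<le> t \<Longrightarrow> t \<le> 1 \<Longrightarrow> x + t *\<^sub>R h \<in> L"
  shows "(LBINT x. indicator K x * \<bar>w (x + h) - w x\<bar>)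
    \<le> real (Suc m) * (LBINT x. indicator L x * \<bar>w (x + inverse (real (Suc m)) *\<^sub>R h) - w x\<bar>)"
proof -
  have [measurable]: "w \<in> borel_measurable borel" by fact
  define s where "s = inverse (real (Suc m))"
  have s: "0 < s" "real (Suc m) * s = 1" by (simp_all add: s_def)
  have d: "\<bar>w x - w y\<bar> \<le> 1" for x y using w(2,3)[of x] w(2,3)[of y] by auto
  let ?D = "\<lambda>x. \<bar>w (x + s *\<^sub>R h) - w x\<bar>"
  have iL: "integrable lborel (\<lambda>x. indicator L x * ?D x)"
    by (rule integrable_indicator_bounded[where B=1]) (use d L in simp_all)
  have i: "integrable lborel (\<lambda>x. indicator L (x + z) * ?D (x + z))" for z
    by (rule integrable_translation[OF iL])
  have "(LBINT x. indicator K x * \<bar>w (x + h) - w x\<bar>)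
      \<le> (LBINT x. (\<Sum>k<Suc m. indicator L (x + (real k * s) *\<^sub>R h) * ?D (x + (real k * s) *\<^sub>R h)))"
  proof (rule integral_mono)
    show "integrable lborel (\<lambda>x. indicator K x * \<bar>w (x + h) - w x\<bar>)"
      by (rule integrable_indicator_bounded[where B=1]) (use d K in simp_all)
    show "integrable lborel (\<lambda>x. \<Sum>k<Suc m. indicator L (x + (real k * s) *\<^sub>R h) * ?D (x + (real k * s) *\<^sub>R h))"
      by (rule Bochner_Integration.integrable_sum) (rule i)
    fix x
    show "indicator K x * \<bar>w (x + h) - w x\<bar> \<le>
        (\<Sum>k<Suc m. indicator L (x + (real k * s) *\<^sub>R h) * ?D (x + (real k * s) *\<^sub>R h))"
    proof (cases "x \<in> K")
      case True
      let ?f = "\<lambda>k. w (x + (real k * s) *\<^sub>R h)"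
      have "w (x + h) - w x = ?f (Suc m) - ?f 0"
        using s(2) by simp
      also have "\<dots> = (\<Sum>k<Suc m. ?f (Suc k) - ?f k)" by (rule sum_lessThan_telescope[symmetric])
      finally have "\<bar>w (x + h) - w x\<bar> \<le> (\<Sum>k<Suc m. \<bar>?f (Suc k) - ?f k\<bar>)"
        by (simp only: sum_abs)
      also have "\<dots> = (\<Sum>k<Suc m. indicator L (x + (real k * s) *\<^sub>R h) * ?D (x + (real k * s) *\<^sub>R h))"
      proof (rule sum.cong[OF refl])
        fix k assume "k \<in> {..<Suc m}"
        then have "real k * s \<le> real (Suc m) * s" using s(1) by (intro mult_right_mono) auto
        then have "real k * s \<le> 1" unfolding s(2) .
        then have "x + (real k * s) *\<^sub>R h \<in> L" using s(1) by (intro KL True) auto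
        moreover have "x + (real (Suc k) * s) *\<^sub>R h = x + (real k * s) *\<^sub>R h + s *\<^sub>R h"
          by (simp add: algebra_simps)
        ultimately show "\<bar>?f (Suc k) - ?f k\<bar> = indicator L (x + (real k * s) *\<^sub>R h) * ?D (x + (real k * s) *\<^sub>R h)"
          by (simp add: add.assoc)
      qed
      finally show ?thesis using True by simp
    qed (simp add: sum_nonneg)
  qed
  also have "\<dots> = (\<Sum>k<Suc m. LBINT x. indicator L (x + (real k * s) *\<^sub>R h) * ?D (x + (real k * s) *\<^sub>R h))"
    by (rule Bochner_Integration.integral_sum) (rule i)
  also have "\<dots> = (\<Sum>k<Suc m. LBINT x. indicator L x * ?D x)"
    by (rule sum.cong[OF refl], rule integral_translation[of "\<lambda>x. indicator L x * ?D x"])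
      (use iL in \<open>simp add: borel_measurable_integrable[of lborel, simplified]\<close>)
  also have "\<dots> = real (Suc m) * (LBINT x. indicator L x * ?D x)" by simp
  finally show ?thesis unfolding s_def .
qed

lemma integrable_indicator_norm:
  fixes f :: "'a::euclidean_space \<Rightarrow> 'b::euclidean_space"
  assumes "integrable lborel f" "K \<in> sets borel"
  shows "integrable lborel (\<lambda>x. indicator K x * norm (f x))"
  using integrable_real_mult_indicator[of K lborel "\<lambda>x. norm (f x)"] assms by (simp add: mult.commute)

text \<open>
  A difference over \<open>h\<close> is split into \<open>m\<close> steps of size \<open>h/m\<close>. In each step the change of \<open>a\<close> costs
  \<open>A |h|/m\<close>; the change of \<open>u\<close> with \<open>a\<close> frozen matters, as \<open>m \<rightarrow> \<infinity>\<close>, only at points of the zone where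
  \<open>phase\<close> is not locally constant.
\<close>

lemma phase_composite_translation_estimate:
  fixes u a g :: "'a::euclidean_space \<Rightarrow> 'b::euclidean_space"
  assumes u: "integrable lborel u" and a: "integrable lborel a" and g: "integrable lborel g" and \<delta>: "0 < \<delta>"
    and A: "\<And>K r z. compact K \<Longrightarrow> (\<And>x. x \<in> K \<Longrightarrow> cball x r \<subseteq> \<Omega>) \<Longrightarrow> norm z < r \<Longrightarrow>
      (LBINT x. indicator K x * norm (a (x + z) - a x)) \<le> A * norm z"
    and diff: "\<And>K r s. compact K \<Longrightarrow> (\<And>x. x \<in> K \<Longrightarrow> cball x r \<subseteq> \<Omega>) \<Longrightarrow> 0 < r \<Longrightarrow> (\<And>n. 0 < s n) \<Longrightarrow> s \<longlonglongrightarrow> 0 \<Longrightarrow>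
      (\<lambda>n. LBINT x. indicator K x * norm ((u (x + s n *\<^sub>R h) - u x) /\<^sub>R s n - g x)) \<longlonglongrightarrow> 0"
    and K: "compact K" "\<And>x. x \<in> K \<Longrightarrow> cball x r \<subseteq> \<Omega>" and h: "norm h < r"
  shows "(LBINT x. indicator K x * \<bar>phase \<delta> (norm (u (x + h) - a (x + h))) - phase \<delta> (norm (u x - a x))\<bar>)
    \<le> 4 / \<delta> * (A * norm h + (LBINT x. indicator {x. \<delta> / 4 \<le> norm (u x - a x) \<and> norm (u x - a x) \<le> \<delta> / 2} x * norm (g x)))"
proof -
  let ?Z = "{x. \<delta> / 4 \<le> norm (u x - a x) \<and> norm (u x - a x) \<le> \<delta> / 2}"
  define w where "w x = phase \<delta> (norm (u x - a x))" for x
  have um [measurable]: "u \<in> borel_measurable borel" "a \<in> borel_measurable borel" "g \<in> borel_measurable borel"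
    using u a g by (auto dest: borel_measurable_integrable)
  have [measurable]: "phase \<delta> \<in> borel_measurable borel"
    using phase_continuous by (rule borel_measurable_continuous_onI)
  have w: "w \<in> borel_measurable borel" "\<And>x. 0 \<le> w x" "\<And>x. w x \<le> 1"
    unfolding w_def[abs_def] by (measurable, auto intro: phase_bounds)
  have Z [measurable]: "?Z \<in> sets borel" by measurable
  \<comment> \<open>\<open>L\<close> is \<open>K\<close> thickened by \<open>norm h\<close>, so it
    contains all points visited on the way from \<open>x\<close> to \<open>x + h\<close>; the margin
    that remains inside \<open>\<Omega>\<close> is \<open>r'\<close>.\<close>
  define L where "L = {x + y | x y. x \<in> K \<and> y \<in> cball 0 (norm h)}"
  have L: "compact L" unfolding L_def by (rule compact_sums[OF K(1) compact_cball])
  have Lb: "bounded L" "L \<in> sets borel" using L by (auto simp: compact_imp_bounded compact_imp_closed)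
  have Kb: "bounded K" "K \<in> sets borel" using K(1) by (auto simp: compact_imp_bounded compact_imp_closed)
  define r' where "r' = r - norm h"
  have r': "0 < r'" using h by (simp add: r'_def)
  have Lr: "cball y r' \<subseteq> \<Omega>" if y: "y \<in> L" for y
  proof -
    obtain x z where xz: "x \<in> K" "norm z \<le> norm h" "y = x + z" using y by (auto simp: L_def)
    have "cball y r' \<subseteq> cball x r"
      using xz(2,3) by (intro cball_subset_cball_iff[THEN iffD2]) (auto simp: r'_def dist_norm)
    with K(2)[OF xz(1)] show ?thesis by blast
  qed
  define \<sigma> where "\<sigma> m = inverse (real (Suc m))" for m
  have \<sigma>: "0 < \<sigma> m" "real (Suc m) * \<sigma> m = 1" for m by (simp_all add: \<sigma>_def)
  have \<sigma>0: "\<sigma> \<longlonglongrightarrow> 0" unfolding \<sigma>_def by (rule LIMSEQ_inverse_real_of_nat)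
  define E where "E m x = (u (x + \<sigma> m *\<^sub>R h) - u x) /\<^sub>R \<sigma> m - g x" for m x
  have Eint: "integrable lborel (E m)" for m
    unfolding E_def by (intro Bochner_Integration.integrable_diff integrable_scaleR_right integrable_translation u g)
  have E0: "(\<lambda>m. LBINT x. indicator L x * norm (E m x)) \<longlonglongrightarrow> 0"
    unfolding E_def by (rule diff[OF L Lr r' \<sigma>(1) \<sigma>0])
  have "(\<lambda>m. LBINT x. norm (indicator L x * norm (E m x))) \<longlonglongrightarrow> 0"
    using E0 by simp
  \<comment> \<open>Whether a point crosses the zone is a pointwise question, and \<open>L1\<close>
    convergence of the quotients answers it only along a subsequence; the final limit is therefore
    taken along \<open>q\<close>.\<close>
  from tendsto_L1_AE_subseq[OF integrable_indicator_norm[OF Eint Lb(2)] this]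
  obtain q where q: "strict_mono (q :: nat \<Rightarrow> nat)" "AE x in lborel. (\<lambda>m. indicator L x * norm (E (q m) x)) \<longlonglongrightarrow> 0"
    by blast
  \<comment> \<open>The phase increment with \<open>a\<close> frozen at the base point: only
    \<open>u\<close> moves.\<close>
  define D where "D m x = phase \<delta> (norm (u (x + \<sigma> m *\<^sub>R h) - a x)) - phase \<delta> (norm (u x - a x))" for m x
  have [measurable]: "D m \<in> borel_measurable borel" for m unfolding D_def by measurable
  define Q where "Q m x = indicator (L \<inter> - ?Z \<inter> {x. D m x \<noteq> 0}) x * norm (g x)" for m x
  have Qset: "L \<inter> - ?Z \<inter> {x. D m x \<noteq> 0} \<in> sets borel" for m
    using Lb(2) by measurable
  have Qint: "integrable lborel (Q m)" for m
    unfolding Q_def by (rule integrable_indicator_norm[OF g Qset])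
  have Q0: "(\<lambda>m. LBINT x. Q (q m) x) \<longlonglongrightarrow> (\<integral>x. 0 \<partial>(lborel :: 'a measure))"
  proof (rule integral_dominated_convergence)
    show "integrable lborel (\<lambda>x. norm (g x))" using g by auto
    show "Q (q m) \<in> borel_measurable lborel" for m using Qint by (rule borel_measurable_integrable)
    show "AE x in lborel. norm (Q (q m) x) \<le> norm (g x)" for m
      by (intro always_eventually allI) (simp add: Q_def indicator_def)
    show "AE x in lborel. (\<lambda>m. Q (q m) x) \<longlonglongrightarrow> 0"
      using q(2)
    proof eventually_elim
      case (elim x)
      show ?case
      proof (cases "x \<in> L \<and> x \<notin> ?Z")
        case False
        then have "Q n x = 0" for n unfolding Q_def by (auto simp: indicator_def)
        then show ?thesis by simp
      next
        case True
        then have "(\<lambda>m. norm (E (q m) x)) \<longlonglongrightarrow> 0" using elim by simp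
        then have e: "(\<lambda>m. E (q m) x) \<longlonglongrightarrow> 0" by (rule tendsto_norm_zero_cancel)
        have "(\<lambda>m. \<sigma> (q m)) \<longlonglongrightarrow> 0"
          using LIMSEQ_subseq_LIMSEQ[OF \<sigma>0 q(1)] by (simp add: comp_def)
        \<comment> \<open>The identity \<open>u (x + \<sigma> h) = u x + \<sigma> (E + g)\<close>
          shows that the shifted values tend to \<open>u x\<close>, although \<open>u\<close> need
          not be continuous at \<open>x\<close>.\<close>
        from tendsto_scaleR[OF this tendsto_add[OF e tendsto_const[of "g x"]]]
        have "(\<lambda>m. u x + \<sigma> (q m) *\<^sub>R (E (q m) x + g x)) \<longlonglongrightarrow> u x + 0"
          by (intro tendsto_add tendsto_const) simp
        moreover have "u x + \<sigma> n *\<^sub>R (E n x + g x) = u (x + \<sigma> n *\<^sub>R h)" for n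
          using \<sigma>(1)[of n] by (simp add: E_def)
        ultimately have "(\<lambda>m. u (x + \<sigma> (q m) *\<^sub>R h)) \<longlonglongrightarrow> u x" by simp
        then have lim: "(\<lambda>m. norm (u (x + \<sigma> (q m) *\<^sub>R h) - a x)) \<longlonglongrightarrow> norm (u x - a x)"
          by (intro tendsto_intros)
        consider "norm (u x - a x) < \<delta> / 4" | "\<delta> / 2 < norm (u x - a x)" using True by force
        then have "\<forall>\<^sub>F m in sequentially. D (q m) x = 0"
        proof cases
          case 1
          from order_tendstoD(2)[OF lim this] show ?thesis
            by eventually_elim (use 1 \<delta> in \<open>simp add: D_def phase_eq_0\<close>)
        next
          case 2
          from order_tendstoD(1)[OF lim this] show ?thesis
            by eventually_elim (use 2 \<delta> in \<open>simp add: D_def phase_eq_1\<close>)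
        qed
        then have "\<forall>\<^sub>F m in sequentially. Q (q m) x = 0" by eventually_elim (simp add: Q_def)
        then show ?thesis by (rule tendsto_eventually)
      qed
    qed
  qed simp
  let ?G = "LBINT x. indicator ?Z x * norm (g x)"
  have step: "(LBINT x. indicator K x * \<bar>w (x + h) - w x\<bar>)
      \<le> 4 / \<delta> * (A * norm h + ((LBINT x. indicator L x * norm (E m x)) + (?G + (LBINT x. Q m x))))"
    if m: "norm (\<sigma> m *\<^sub>R h) < r'" for m
  proof -
    let ?aa = "\<lambda>x. indicator L x * norm (a (x + \<sigma> m *\<^sub>R h) - a x)"
    have ia: "integrable lborel ?aa"
      by (intro integrable_indicator_norm Bochner_Integration.integrable_diff integrable_translation a Lb)
    have iE: "integrable lborel (\<lambda>x. indicator L x * norm (E m x))"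
      by (rule integrable_indicator_norm[OF Eint Lb(2)])
    have iG: "integrable lborel (\<lambda>x. indicator ?Z x * norm (g x))"
      by (rule integrable_indicator_norm[OF g Z])
    have "(LBINT x. indicator K x * \<bar>w (x + h) - w x\<bar>)
        \<le> real (Suc m) * (LBINT x. indicator L x * \<bar>w (x + \<sigma> m *\<^sub>R h) - w x\<bar>)"
      unfolding \<sigma>_def
    proof (rule translation_telescope[OF w Kb(2,1) Lb(2,1)])
      fix x and t :: real assume "x \<in> K" "0 \<le> t" "t \<le> 1"
      then show "x + t *\<^sub>R h \<in> L" unfolding L_def mem_Collect_eq
        by (intro exI[of _ x] exI[of _ "t *\<^sub>R h"]) (simp add: mult_left_le_one_le)
    qed
    also have "\<dots> = (LBINT x. real (Suc m) * (indicator L x * \<bar>w (x + \<sigma> m *\<^sub>R h) - w x\<bar>))" by simp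
    also have "\<dots> \<le> (LBINT x. 4 / \<delta> * (real (Suc m) * ?aa x + (indicator L x * norm (E m x) + (indicator ?Z x * norm (g x) + Q m x))))"
    proof (rule integral_mono)
      have "\<bar>w (x + \<sigma> m *\<^sub>R h) - w x\<bar> \<le> 1" for x using w(2,3)[of x] w(2,3)[of "x + \<sigma> m *\<^sub>R h"] by auto
      then have "integrable lborel (\<lambda>x. indicator L x * \<bar>w (x + \<sigma> m *\<^sub>R h) - w x\<bar>)"
        using w(1) Lb by (intro integrable_indicator_bounded[where B=1]) simp_all
      then show "integrable lborel (\<lambda>x. real (Suc m) * (indicator L x * \<bar>w (x + \<sigma> m *\<^sub>R h) - w x\<bar>))"
        by (rule integrable_mult_right)
      show "integrable lborel (\<lambda>x. 4 / \<delta> * (real (Suc m) * ?aa x + (indicator L x * norm (E m x) + (indicator ?Z x * norm (g x) + Q m x))))"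
        by (intro integrable_mult_right Bochner_Integration.integrable_add ia iE iG Qint)
      fix x
      let ?y = "x + \<sigma> m *\<^sub>R h"
      have gQ: "0 \<le> Q m x" by (simp add: Q_def)
      show "real (Suc m) * (indicator L x * \<bar>w ?y - w x\<bar>)
          \<le> 4 / \<delta> * (real (Suc m) * ?aa x + (indicator L x * norm (E m x) + (indicator ?Z x * norm (g x) + Q m x)))"
      proof (cases "x \<in> L")
        case False
        then show ?thesis using \<delta> gQ by simp
      next
        case True
        \<comment> \<open>The increment of \<open>w\<close> passes through the mixed value with
          \<open>u\<close> taken at \<open>?y\<close> and \<open>a\<close> taken at
          \<open>x\<close>: the first part is charged to the variation of \<open>a\<close>, the
          second is \<open>D m x\<close>.\<close>
        have "\<bar>w ?y - phase \<delta> (norm (u ?y - a x))\<bar> \<le> 4 / \<delta> * \<bar>norm (u ?y - a ?y) - norm (u ?y - a x)\<bar>"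
          unfolding w_def by (rule phase_lipschitz[OF \<delta>])
        also have "\<dots> \<le> 4 / \<delta> * norm (a ?y - a x)"
        proof (rule mult_left_mono)
          show "\<bar>norm (u ?y - a ?y) - norm (u ?y - a x)\<bar> \<le> norm (a ?y - a x)"
            using norm_triangle_ineq3[of "u ?y - a ?y" "u ?y - a x"] by (simp add: norm_minus_commute)
        qed (use \<delta> in simp)
        finally have 1: "\<bar>w ?y - phase \<delta> (norm (u ?y - a x))\<bar> \<le> 4 / \<delta> * norm (a ?y - a x)" .
        have 2: "real (Suc m) * \<bar>D m x\<bar> \<le> 4 / \<delta> * (norm (E m x) + (indicator ?Z x * norm (g x) + Q m x))"
        proof (cases "D m x = 0")
          case True
          then show ?thesis using \<delta> gQ by simp
        next
          case False
          have "\<bar>D m x\<bar> \<le> 4 / \<delta> * \<bar>norm (u ?y - a x) - norm (u x - a x)\<bar>"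
            unfolding D_def by (rule phase_lipschitz[OF \<delta>])
          also have "\<dots> \<le> 4 / \<delta> * norm (u ?y - u x)"
          proof (rule mult_left_mono)
            show "\<bar>norm (u ?y - a x) - norm (u x - a x)\<bar> \<le> norm (u ?y - u x)"
              using norm_triangle_ineq3[of "u ?y - a x" "u x - a x"] by simp
          qed (use \<delta> in simp)
          also have "norm (u ?y - u x) = \<sigma> m * norm (E m x + g x)"
            using \<sigma>(1)[of m] by (simp add: E_def)
          finally have "real (Suc m) * \<bar>D m x\<bar> \<le> real (Suc m) * (4 / \<delta> * (\<sigma> m * norm (E m x + g x)))"
            by (rule mult_left_mono) simp
          also have "\<dots> = 4 / \<delta> * (real (Suc m) * \<sigma> m * norm (E m x + g x))" by simp
          also have "\<dots> \<le> 4 / \<delta> * (norm (E m x) + (indicator ?Z x * norm (g x) + Q m x))"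
          proof (rule mult_left_mono)
            \<comment> \<open>A point of \<open>L\<close> where \<open>D m x\<close> is nonzero
              belongs to the zone or to the set in \<open>Q\<close>, and not to both.\<close>
            have "norm (g x) = indicator ?Z x * norm (g x) + Q m x"
              using False \<open>x \<in> L\<close> by (simp add: Q_def indicator_def)
            then show "real (Suc m) * \<sigma> m * norm (E m x + g x) \<le> norm (E m x) + (indicator ?Z x * norm (g x) + Q m x)"
              using norm_triangle_ineq[of "E m x" "g x"] \<sigma>(2)[of m] by simp
          qed (use \<delta> in simp)
          finally show ?thesis .
        qed
        have "\<bar>w ?y - w x\<bar> \<le> \<bar>w ?y - phase \<delta> (norm (u ?y - a x))\<bar> + \<bar>D m x\<bar>"
          unfolding D_def w_def by linarith
        also have "\<dots> \<le> 4 / \<delta> * norm (a ?y - a x) + \<bar>D m x\<bar>" using 1 by simp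
        finally have "real (Suc m) * \<bar>w ?y - w x\<bar> \<le> real (Suc m) * (4 / \<delta> * norm (a ?y - a x) + \<bar>D m x\<bar>)"
          by (rule mult_left_mono) simp
        also have "\<dots> = 4 / \<delta> * (real (Suc m) * norm (a ?y - a x)) + real (Suc m) * \<bar>D m x\<bar>"
          by (simp only: distrib_left mult.left_commute[of "real (Suc m)" "4 / \<delta>"])
        also have "\<dots> \<le> 4 / \<delta> * (real (Suc m) * norm (a ?y - a x)) + 4 / \<delta> * (norm (E m x) + (indicator ?Z x * norm (g x) + Q m x))"
          using 2 by simp
        finally show ?thesis using True by (simp only: distrib_left indicator_simps mult_1)
      qed
    qed
    also have "\<dots> = 4 / \<delta> * (real (Suc m) * (LBINT x. ?aa x) + ((LBINT x. indicator L x * norm (E m x)) + (?G + (LBINT x. Q m x))))"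
      by (simp only: Bochner_Integration.integral_add Bochner_Integration.integrable_add integrable_mult_right ia iE iG Qint integral_mult_right_zero)
    also have "\<dots> \<le> 4 / \<delta> * (A * norm h + ((LBINT x. indicator L x * norm (E m x)) + (?G + (LBINT x. Q m x))))"
    proof (intro mult_left_mono add_right_mono)
      have "real (Suc m) * (LBINT x. ?aa x) \<le> real (Suc m) * (A * norm (\<sigma> m *\<^sub>R h))"
        by (intro mult_left_mono A[OF L Lr m]) auto
      also have "\<dots> = (real (Suc m) * \<sigma> m) * (A * norm h)" using \<sigma>(1)[of m] by simp
      also have "\<dots> = A * norm h" unfolding \<sigma>(2) by simp
      finally show "real (Suc m) * (LBINT x. ?aa x) \<le> A * norm h" .
    qed (use \<delta> in simp)
    finally show ?thesis .
  qed
  have "(\<lambda>m. norm (\<sigma> (q m) *\<^sub>R h)) \<longlonglongrightarrow> norm (0 *\<^sub>R h)"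
    using LIMSEQ_subseq_LIMSEQ[OF \<sigma>0 q(1)] by (intro tendsto_intros) (simp add: comp_def)
  then have ev: "\<forall>\<^sub>F m in sequentially. norm (\<sigma> (q m) *\<^sub>R h) < r'"
    by (rule order_tendstoD) (use r' in simp)
  have "(\<lambda>m. LBINT x. indicator L x * norm (E (q m) x)) \<longlonglongrightarrow> 0"
    using LIMSEQ_subseq_LIMSEQ[OF E0 q(1)] by (simp add: comp_def)
  then have "(\<lambda>m. 4 / \<delta> * (A * norm h + ((LBINT x. indicator L x * norm (E (q m) x)) + (?G + (LBINT x. Q (q m) x)))))
      \<longlonglongrightarrow> 4 / \<delta> * (A * norm h + (0 + (?G + 0)))"
    using Q0 by (intro tendsto_intros) simp_all
  then have "(LBINT x. indicator K x * \<bar>w (x + h) - w x\<bar>) \<le> 4 / \<delta> * (A * norm h + (0 + (?G + 0)))"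
  proof (rule tendsto_lowerbound)
    show "\<forall>\<^sub>F m in sequentially. (LBINT x. indicator K x * \<bar>w (x + h) - w x\<bar>)
        \<le> 4 / \<delta> * (A * norm h + ((LBINT x. indicator L x * norm (E (q m) x)) + (?G + (LBINT x. Q (q m) x))))"
      using ev by eventually_elim (rule step)
  qed simp
  then show ?thesis by (simp add: w_def)
qed

section \<open>Total variation and weak gradients in terms of translations\<close>

lemma AE_lebesgue_on_iff:
  assumes "\<Omega> \<in> sets borel"
  shows "(AE x in lebesgue_on \<Omega>. P x) \<longleftrightarrow> (AE x in lborel. x \<in> \<Omega> \<longrightarrow> P x)"
  using assms by (simp add: AE_restrict_space_iff AE_completion_iff)

lemma nn_integral_lebesgue_on:
  assumes "\<Omega> \<in> sets borel"
  shows "(\<integral>\<^sup>+x. f x \<partial>lebesgue_on \<Omega>) = (\<integral>\<^sup>+x. f x * indicator \<Omega> x \<partial>lborel)"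
  using assms by (simp add: nn_integral_restrict_space nn_integral_completion)

lemma borel_measurable_lebesgue_on_AE_eq:
  fixes f g :: "'a::euclidean_space \<Rightarrow> 'b::euclidean_space"
  assumes \<Omega>: "\<Omega> \<in> sets borel" and g: "g \<in> borel_measurable borel" and eq: "AE x in lebesgue_on \<Omega>. g x = f x"
  shows "f \<in> borel_measurable (lebesgue_on \<Omega>)"
proof -
  have 1: "(\<lambda>x. indicator \<Omega> x *\<^sub>R g x) \<in> borel_measurable lebesgue"
  proof (rule measurable_completion)
    have [measurable]: "\<Omega> \<in> sets borel" "g \<in> borel_measurable borel" by fact+
    have "(\<lambda>x. indicator \<Omega> x *\<^sub>R g x) \<in> borel_measurable borel" by measurable
    then show "(\<lambda>x. indicator \<Omega> x *\<^sub>R g x) \<in> borel_measurable lborel" by simp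
  qed
  have 2: "AE x in lebesgue. indicator \<Omega> x *\<^sub>R g x = indicator \<Omega> x *\<^sub>R f x"
    using eq unfolding AE_lebesgue_on_iff[OF \<Omega>] AE_completion_iff
    by eventually_elim (auto simp: indicator_def)
  from borel_measurable_AE[OF 1 2] show ?thesis
    using \<Omega> by (simp add: borel_measurable_restrict_space_iff)
qed

text \<open>The bridge to the translation estimates: integrals over \<open>\<Omega>\<close> become
  integrals over the whole space of a Borel representative that vanishes outside
  \<open>\<Omega>\<close>, where shifts and exchange of integrals are available.\<close>

lemma integral_lebesgue_on_AE_eq:
  fixes f g :: "'a::euclidean_space \<Rightarrow> 'b::euclidean_space"
  assumes \<Omega>: "\<Omega> \<in> sets borel" and g: "g \<in> borel_measurable borel" "\<And>x. x \<notin> \<Omega> \<Longrightarrow> g x = 0"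
    and eq: "AE x in lebesgue_on \<Omega>. g x = f x"
  shows "(\<integral>x. f x \<partial>lebesgue_on \<Omega>) = (LBINT x. g x)"
    and "integrable (lebesgue_on \<Omega>) f \<longleftrightarrow> integrable lborel g"
proof -
  have g': "g \<in> borel_measurable lborel" using g by simp
  have g'': "g \<in> borel_measurable (lebesgue_on \<Omega>)"
    by (intro measurable_restrict_space1 measurable_completion g')
  have m: "f \<in> borel_measurable (lebesgue_on \<Omega>)"
    by (rule borel_measurable_lebesgue_on_AE_eq[OF \<Omega> g(1) eq])
  have ind: "(\<lambda>x. indicator \<Omega> x *\<^sub>R g x) = g" using g(2) by (auto simp: indicator_def fun_eq_iff)
  have "(\<integral>x. f x \<partial>lebesgue_on \<Omega>) = (\<integral>x. g x \<partial>lebesgue_on \<Omega>)"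
    by (rule integral_cong_AE[OF m g'']) (use eq in \<open>auto simp: eq_commute\<close>)
  also have "\<dots> = (LBINT x. g x)"
    using \<Omega> ind by (simp add: integral_restrict_space integral_completion[OF g'])
  finally show "(\<integral>x. f x \<partial>lebesgue_on \<Omega>) = (LBINT x. g x)" .
  have "integrable (lebesgue_on \<Omega>) f \<longleftrightarrow> integrable (lebesgue_on \<Omega>) g"
    by (rule integrable_cong_AE[OF m g'']) (use eq in \<open>auto simp: eq_commute\<close>)
  also have "\<dots> \<longleftrightarrow> integrable lborel g"
    using \<Omega> ind by (simp add: integrable_restrict_space integrable_completion[OF g'])
  finally show "integrable (lebesgue_on \<Omega>) f \<longleftrightarrow> integrable lborel g" .
qed

text \<open>The library modifies real functions on null sets; the representative is assembled from
  the coordinates, whose finitely many exceptional sets unite to a null set.\<close>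

lemma borel_representative:
  fixes f :: "'a::euclidean_space \<Rightarrow> 'b::euclidean_space"
  assumes \<Omega>: "\<Omega> \<in> sets borel" and f: "f \<in> borel_measurable (lebesgue_on \<Omega>)"
  obtains g where "g \<in> borel_measurable borel" "\<And>x. x \<notin> \<Omega> \<Longrightarrow> g x = 0" "AE x in lebesgue_on \<Omega>. g x = f x"
proof -
  have "(\<lambda>x. indicator \<Omega> x *\<^sub>R f x) \<in> borel_measurable lebesgue"
    using f \<Omega> by (simp add: borel_measurable_restrict_space_iff)
  then have "\<exists>g\<in>borel_measurable lborel. AE x in lborel. (indicator \<Omega> x *\<^sub>R f x) \<bullet> b = g x" for b
    by (intro completion_ex_borel_measurable_real) (rule borel_measurable_inner, auto)
  then obtain g where g: "\<And>b. g b \<in> borel_measurable lborel" "\<And>b. AE x in lborel. (indicator \<Omega> x *\<^sub>R f x) \<bullet> b = g b x"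
    by metis
  have [measurable]: "g b \<in> borel_measurable borel" "\<Omega> \<in> sets borel" for b using g(1)[of b] \<Omega> by auto
  show ?thesis
  proof (rule that[of "\<lambda>x. indicator \<Omega> x *\<^sub>R (\<Sum>b\<in>Basis. g b x *\<^sub>R b)"])
    show "(\<lambda>x. indicator \<Omega> x *\<^sub>R (\<Sum>b\<in>Basis. g b x *\<^sub>R b)) \<in> borel_measurable borel" by measurable
    have "AE x in lborel. \<forall>b\<in>Basis. (indicator \<Omega> x *\<^sub>R f x) \<bullet> b = g b x"
      using g(2) by (intro AE_finite_allI) auto
    then show "AE x in lebesgue_on \<Omega>. indicator \<Omega> x *\<^sub>R (\<Sum>b\<in>Basis. g b x *\<^sub>R b) = f x"
      unfolding AE_lebesgue_on_iff[OF \<Omega>]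
    proof eventually_elim
      case (elim x)
      show ?case
      proof
        assume "x \<in> \<Omega>"
        then have "(\<Sum>b\<in>Basis. g b x *\<^sub>R b) = (\<Sum>b\<in>Basis. (f x \<bullet> b) *\<^sub>R b)"
          using elim by (intro sum.cong) auto
        then show "indicator \<Omega> x *\<^sub>R (\<Sum>b\<in>Basis. g b x *\<^sub>R b) = f x"
          using \<open>x \<in> \<Omega>\<close> by (simp add: euclidean_representation)
      qed
    qed
  qed simp
qed

text \<open>An open set is a countable union of closed boxes. These are compact, so local
  integrability gives measurability on each box, and the pieces are glued.\<close>

lemma L1_loc_borel_measurable:
  fixes G :: "real ^ 'n \<Rightarrow> 'b::euclidean_space"
  assumes \<Omega>: "open \<Omega>" and G: "G \<in> L1_loc \<Omega>"
  shows "G \<in> borel_measurable (lebesgue_on \<Omega>)"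
proof -
  obtain D where D: "countable D" "D \<subseteq> Pow \<Omega>" "\<And>X. X \<in> D \<Longrightarrow> \<exists>a b. X = cbox a b" "\<Union>D = \<Omega>"
    using open_countable_Union_open_cbox[OF \<Omega>] by metis
  show ?thesis
  proof (rule measurable_piecewise_restrict[OF D(1)])
    fix X assume X: "X \<in> D"
    obtain a b where ab: "X = cbox a b" using D(3)[OF X] by blast
    have sub: "X \<subseteq> \<Omega>" using X D(2) by blast
    have "\<Omega> \<in> sets lebesgue" using \<Omega> by (simp add: borel_open)
    then show "X \<inter> space (lebesgue_on \<Omega>) \<in> sets (lebesgue_on \<Omega>)"
      using ab sub by (simp add: sets_restrict_space_iff Int_absorb2)
    have "integrable (lebesgue_on X) G"
      using G sub ab unfolding L1_loc_def by auto
    then show "G \<in> borel_measurable (restrict_space (lebesgue_on \<Omega>) X)"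
      using sub \<open>\<Omega> \<in> sets lebesgue\<close> ab
      by (subst restrict_restrict_space) (auto simp: Int_absorb1 dest: borel_measurable_integrable)
  qed (use D(4) in auto)
qed

text \<open>Serves both directions between scalar and matrix test fields: multiplying a scalar
  function by a fixed matrix, and extracting a matrix entry.\<close>

lemma C1c_bounded_linear:
  fixes \<Phi> :: "real ^ 'n \<Rightarrow> 'b::real_normed_vector" and T :: "'b \<Rightarrow> 'c::real_normed_vector"
  assumes \<Phi>: "\<Phi> \<in> C1c \<Omega>" and T: "bounded_linear T"
  shows "(\<lambda>x. T (\<Phi> x)) \<in> C1c \<Omega>" "partial_deriv i (\<lambda>x. T (\<Phi> x)) x = T (partial_deriv i \<Phi> x)"
proof -
  have "(\<Phi> has_derivative frechet_derivative \<Phi> (at x)) (at x)" for x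
    using \<Phi> frechet_derivative_works unfolding C1c_def by blast
  then have D: "((\<lambda>x. T (\<Phi> x)) has_derivative (\<lambda>h. T (frechet_derivative \<Phi> (at x) h))) (at x)" for x
    by (rule bounded_linear.has_derivative[OF T])
  then have "frechet_derivative (\<lambda>x. T (\<Phi> x)) (at x) = (\<lambda>h. T (frechet_derivative \<Phi> (at x) h))" for x
    by (rule frechet_derivative_at[symmetric])
  then show p: "partial_deriv i (\<lambda>x. T (\<Phi> x)) x = T (partial_deriv i \<Phi> x)" for i x
    by (simp add: partial_deriv_def)
  have "closure {x. T (\<Phi> x) \<noteq> 0} \<subseteq> closure {x. \<Phi> x \<noteq> 0}"
    using linear_0[OF bounded_linear.linear[OF T]] by (intro closure_mono) auto
  moreover have "compact (closure {x. \<Phi> x \<noteq> 0})" "closure {x. \<Phi> x \<noteq> 0} \<subseteq> \<Omega>" using \<Phi> by (simp_all add: C1c_def)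
  moreover from calculation have "compact (closure {x. T (\<Phi> x) \<noteq> 0})"
    by (metis closed_closure compact_Int_closed inf.absorb_iff2)
  moreover have "continuous_on UNIV (partial_deriv i (\<lambda>x. T (\<Phi> x)))" for i
  proof -
    have "partial_deriv i (\<lambda>x. T (\<Phi> x)) = (\<lambda>x. T (partial_deriv i \<Phi> x))" by (rule ext) (rule p)
    moreover have "continuous_on UNIV (partial_deriv i \<Phi>)" using \<Phi> by (simp add: C1c_def)
    ultimately show ?thesis by (simp add: bounded_linear.continuous_on[OF T])
  qed
  ultimately show "(\<lambda>x. T (\<Phi> x)) \<in> C1c \<Omega>"
    using D unfolding C1c_def differentiable_def by blast
qed

lemmas C1c_scaleR_const = C1c_bounded_linear[OF _ bounded_linear_scaleR_left]

lemmas C1c_matrix_entry = C1c_bounded_linear[OF _ bounded_linear_compose[OF bounded_linear_vec_nth bounded_linear_vec_nth]]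

lemma integrable_vec_nth:
  fixes f :: "'a \<Rightarrow> 'b::euclidean_space ^ 'm"
  shows "integrable M f \<Longrightarrow> integrable M (\<lambda>x. f x $ j)"
  by (rule integrable_bounded_linear[OF bounded_linear_vec_nth])

lemma norm_integral_le_components:
  fixes f :: "'a::euclidean_space \<Rightarrow> real ^ 'm"
  assumes f: "integrable lborel f" and K: "K \<in> sets borel"
  shows "(LBINT x. indicator K x * norm (f x)) \<le> (\<Sum>j\<in>UNIV. LBINT x. indicator K x * \<bar>f x $ j\<bar>)"
proof -
  have i: "integrable lborel (\<lambda>x. indicator K x * \<bar>f x $ j\<bar>)" for j
    using integrable_indicator_norm[OF integrable_vec_nth[OF f] K, of j] by simp
  have "(LBINT x. indicator K x * norm (f x)) \<le> (LBINT x. (\<Sum>j\<in>UNIV. indicator K x * \<bar>f x $ j\<bar>))"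
  proof (rule integral_mono)
    show "integrable lborel (\<lambda>x. indicator K x * norm (f x))" by (rule integrable_indicator_norm[OF f K])
    show "integrable lborel (\<lambda>x. \<Sum>j\<in>UNIV. indicator K x * \<bar>f x $ j\<bar>)"
      by (rule Bochner_Integration.integrable_sum) (rule i)
    show "indicator K x * norm (f x) \<le> (\<Sum>j\<in>UNIV. indicator K x * \<bar>f x $ j\<bar>)" for x
      unfolding sum_distrib_left[symmetric] by (intro mult_left_mono norm_le_l1_cart) auto
  qed
  also have "\<dots> = (\<Sum>j\<in>UNIV. LBINT x. indicator K x * \<bar>f x $ j\<bar>)"
    by (rule Bochner_Integration.integral_sum) (rule i)
  finally show ?thesis .
qed

section \<open>Bounded variation and weak gradients against translations\<close>

lemma norm_axis:
  fixes x :: "'b::real_inner"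
  shows "norm (axis j x :: 'b ^ 'm) = norm x"
  by (simp add: norm_eq_sqrt_inner inner_axis_axis)

text \<open>The test field is \<open>\<phi>\<close> times the matrix \<open>M\<close> whose only
  nonzero row, the \<open>j\<close>-th, is the unit vector along \<open>h\<close> up to sign. Its
  Frobenius norm is 1, so the field is admissible in \<open>variation\<close>, and its divergence is
  the derivative of \<open>\<phi>\<close> along that vector, placed in component
  \<open>j\<close>.\<close>

lemma BV_directional_bound:
  fixes a a' :: "real ^ 'n \<Rightarrow> real ^ 'm"
  assumes \<Omega>: "open \<Omega>" and a: "variation \<Omega> a < \<infinity>"
    and a': "integrable lborel a'" "\<And>x. x \<notin> \<Omega> \<Longrightarrow> a' x = 0" "AE x in lebesgue_on \<Omega>. a' x = a x"
    and \<phi>: "\<phi> \<in> C1c \<Omega>" "\<And>x. \<bar>\<phi> x\<bar> \<le> 1"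
  shows "\<bar>LBINT x. a' x $ j * frechet_derivative \<phi> (at x) h\<bar> \<le> real_of_ereal (variation \<Omega> a) * norm h"
proof (cases "h = 0")
  case True
  then have "frechet_derivative \<phi> (at x) h = 0" for x
    using C1c_has_derivative[OF \<phi>(1), of x] linear_0[OF has_derivative_linear] by blast
  then show ?thesis using True by simp
next
  case False
  let ?V = "real_of_ereal (variation \<Omega> a)"
  have [measurable]: "\<Omega> \<in> sets borel" using \<Omega> by simp
  have am: "a' \<in> borel_measurable borel" using borel_measurable_integrable[OF a'(1)] by simp
  have aj: "integrable lborel (\<lambda>x. a' x $ j)" by (rule integrable_vec_nth[OF a'(1)])
  \<comment> \<open>The sign \<open>c\<close> takes the values 1 and -1, which turns the one-sided
    bound from the supremum into a bound for the absolute value.\<close>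
  have key: "(LBINT x. a' x $ j * frechet_derivative \<phi> (at x) h) * c \<le> ?V * norm h" if c: "\<bar>c\<bar> = 1" for c :: real
  proof -
    define M :: "real ^ 'n ^ 'm" where "M = axis j ((c / norm h) *\<^sub>R h)"
    have M: "norm M = 1" using False c by (simp add: M_def norm_axis)
    let ?\<Phi> = "\<lambda>x. \<phi> x *\<^sub>R M"
    have \<Phi>: "?\<Phi> \<in> C1c \<Omega>" by (rule C1c_scaleR_const(1)[OF \<phi>(1)])
    have div: "v \<bullet> divergence ?\<Phi> x = v $ j * frechet_derivative \<phi> (at x) h * (c / norm h)" for x and v :: "real ^ 'm"
    proof -
      have "divergence ?\<Phi> x = axis j (frechet_derivative \<phi> (at x) h * (c / norm h))"
      proof (subst vec_eq_iff, rule allI)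
        fix l
        have d: "\<phi> differentiable (at x)" using \<phi>(1) by (simp add: C1c_def)
        show "divergence ?\<Phi> x $ l = axis j (frechet_derivative \<phi> (at x) h * (c / norm h)) $ l"
          by (simp add: divergence_def C1c_scaleR_const(2)[OF \<phi>(1)] M_def axis_def
            frechet_derivative_eq_sum_partial_deriv[OF d] sum_divide_distrib sum_distrib_left sum_distrib_right mult_ac)
      qed
      then show ?thesis by (simp add: inner_axis)
    qed
    have "?\<Phi> \<in> {\<phi> \<in> C1c \<Omega>. \<forall>x. norm (\<phi> x) \<le> 1}" using \<Phi> M \<phi>(2) by simp
    then have "ereal (\<integral>x. a x \<bullet> divergence ?\<Phi> x \<partial>lebesgue_on \<Omega>) \<le> variation \<Omega> a"
      unfolding variation_def by (rule SUP_upper)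
    then have le: "(\<integral>x. a x \<bullet> divergence ?\<Phi> x \<partial>lebesgue_on \<Omega>) \<le> ?V"
      using a by (cases "variation \<Omega> a") auto
    have "(\<integral>x. a x \<bullet> divergence ?\<Phi> x \<partial>lebesgue_on \<Omega>) = (LBINT x. a' x $ j * frechet_derivative \<phi> (at x) h * (c / norm h))"
    proof (rule integral_lebesgue_on_AE_eq(1))
      have "integrable lborel (\<lambda>x. a' x $ j * frechet_derivative \<phi> (at x) h)"
        using integrable_mult_C1c(2)[OF aj \<phi>(1), of 0] by simp
      then have "integrable lborel (\<lambda>x. a' x $ j * frechet_derivative \<phi> (at x) h * (c / norm h))"
        by (rule integrable_mult_left)
      then show "(\<lambda>x. a' x $ j * frechet_derivative \<phi> (at x) h * (c / norm h)) \<in> borel_measurable borel"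
        using borel_measurable_integrable by fastforce
      show "AE x in lebesgue_on \<Omega>. a' x $ j * frechet_derivative \<phi> (at x) h * (c / norm h) = a x \<bullet> divergence ?\<Phi> x"
        using a'(3) by eventually_elim (simp only: div)
    qed (use a'(2) in simp_all)
    with le have "(LBINT x. a' x $ j * frechet_derivative \<phi> (at x) h) * c / norm h \<le> ?V" by simp
    then show ?thesis using False by (simp add: divide_le_eq)
  qed
  from key[of 1] key[of "- 1"] show ?thesis by (simp add: abs_le_iff)
qed

text \<open>The estimate is proved for each component; the factor \<open>CARD('m)\<close> is the
  price of replacing the norm by the sum of the components.\<close>

lemma BV_translation_estimate:
  fixes a a' :: "real ^ 'n \<Rightarrow> real ^ 'm"
  assumes \<Omega>: "open \<Omega>" and a: "variation \<Omega> a < \<infinity>"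
    and a': "integrable lborel a'" "\<And>x. x \<notin> \<Omega> \<Longrightarrow> a' x = 0" "AE x in lebesgue_on \<Omega>. a' x = a x"
    and K: "compact K" "\<And>x. x \<in> K \<Longrightarrow> cball x r \<subseteq> \<Omega>" and h: "norm h < r"
  shows "(LBINT x. indicator K x * norm (a' (x + h) - a' x))
    \<le> real CARD('m) * real_of_ereal (variation \<Omega> a) * norm h"
proof -
  have "(LBINT x. indicator K x * norm (a' (x + h) - a' x))
      \<le> (\<Sum>j\<in>UNIV. LBINT x. indicator K x * \<bar>(a' (x + h) - a' x) $ j\<bar>)"
    using K(1) by (intro norm_integral_le_components Bochner_Integration.integrable_diff integrable_translation a')
      (simp add: compact_imp_closed)
  also have "\<dots> \<le> (\<Sum>j\<in>(UNIV :: 'm set). real_of_ereal (variation \<Omega> a) * norm h)"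
  proof (rule sum_mono)
    fix j :: 'm
    have "(LBINT x. indicator K x * \<bar>a' (x + h) $ j - a' x $ j\<bar>) \<le> real_of_ereal (variation \<Omega> a) * norm h"
      by (rule translation_estimate_bounded_variation[OF integrable_vec_nth[OF a'(1)] K h])
        (assumption | rule BV_directional_bound[OF \<Omega> a a'])+
    then show "(LBINT x. indicator K x * \<bar>(a' (x + h) - a' x) $ j\<bar>) \<le> real_of_ereal (variation \<Omega> a) * norm h"
      by simp
  qed
  finally show ?thesis by simp
qed

text \<open>Each entry of an admissible matrix field is a scalar test function bounded by 1, and the
  divergence differentiates it along a coordinate axis. The scalar bound, summed over all
  \<open>CARD('m) * CARD('n)\<close> entries, bounds the variation.\<close>

lemma BV_of_translation_estimate:
  fixes w :: "real ^ 'n \<Rightarrow> real ^ 'm"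
  assumes \<Omega>: "open \<Omega>" and w: "integrable lborel w" "\<And>x. x \<notin> \<Omega> \<Longrightarrow> w x = 0"
    and le: "\<And>K r h. compact K \<Longrightarrow> (\<And>x. x \<in> K \<Longrightarrow> cball x r \<subseteq> \<Omega>) \<Longrightarrow> norm h < r \<Longrightarrow>
      (LBINT x. indicator K x * norm (w (x + h) - w x)) \<le> C * norm h"
  shows "w \<in> BV \<Omega>"
proof -
  have \<Omega>b: "\<Omega> \<in> sets borel" using \<Omega> by simp
  have wm: "w \<in> borel_measurable borel" using borel_measurable_integrable[OF w(1)] by simp
  have bound: "(\<integral>x. w x \<bullet> divergence \<Phi> x \<partial>lebesgue_on \<Omega>) \<le> real CARD('m) * (real CARD('n) * C)"
    if \<Phi>: "\<Phi> \<in> C1c \<Omega>" "\<And>x. norm (\<Phi> x) \<le> 1" for \<Phi>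
  proof -
    have entry: "\<bar>LBINT x. w x $ j * frechet_derivative (\<lambda>x. \<Phi> x $ j $ i) (at x) (axis i 1)\<bar> \<le> C" for i j
    proof -
      have "\<bar>LBINT x. w x $ j * frechet_derivative (\<lambda>x. \<Phi> x $ j $ i) (at x) (axis i 1)\<bar> \<le> C * norm (axis i (1::real))"
      proof (rule variation_bound_of_translation_estimate[OF integrable_vec_nth[OF w(1)] \<Omega>])
        fix K r and h :: "real ^ 'n"
        assume K: "compact K" "\<And>x. x \<in> K \<Longrightarrow> cball x r \<subseteq> \<Omega>" "norm h < r"
        have "(LBINT x. indicator K x * \<bar>w (x + h) $ j - w x $ j\<bar>) \<le> (LBINT x. indicator K x * norm (w (x + h) - w x))"
        proof (rule integral_mono)
          have i: "integrable lborel (\<lambda>x. w (x + h) - w x)"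
            by (intro Bochner_Integration.integrable_diff integrable_translation w)
          have Kb: "K \<in> sets borel" using K(1) by (simp add: compact_imp_closed)
          show "integrable lborel (\<lambda>x. indicator K x * norm (w (x + h) - w x))"
            by (rule integrable_indicator_norm[OF i Kb])
          show "integrable lborel (\<lambda>x. indicator K x * \<bar>w (x + h) $ j - w x $ j\<bar>)"
            using integrable_indicator_norm[OF integrable_vec_nth[OF i] Kb, of j] by simp
          show "indicator K x * \<bar>w (x + h) $ j - w x $ j\<bar> \<le> indicator K x * norm (w (x + h) - w x)" for x
            using component_le_norm_cart[of "w (x + h) - w x" j] by (intro mult_left_mono) auto
        qed
        also have "\<dots> \<le> C * norm h" by (rule le[OF K])
        finally show "(LBINT x. indicator K x * \<bar>w (x + h) $ j - w x $ j\<bar>) \<le> C * norm h" .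
      next
        show "\<bar>\<Phi> x $ j $ i\<bar> \<le> 1" for x
          using component_le_norm_cart[of "\<Phi> x $ j" i] Finite_Cartesian_Product.norm_nth_le[of "\<Phi> x" j] \<Phi>(2)[of x] by linarith
      qed (rule C1c_matrix_entry(1)[OF \<Phi>(1)])
      then show ?thesis by (simp add: norm_axis)
    qed
    have i: "integrable lborel (\<lambda>x. w x $ j * partial_deriv i (\<lambda>x. \<Phi> x $ j $ i) x)" for i j
      using integrable_mult_C1c(2)[OF integrable_vec_nth[OF w(1)] C1c_matrix_entry(1)[OF \<Phi>(1)], where z=0]
      by (simp add: partial_deriv_def)
    have eq: "w x \<bullet> divergence \<Phi> x = (\<Sum>j\<in>UNIV. \<Sum>i\<in>UNIV. w x $ j * partial_deriv i (\<lambda>x. \<Phi> x $ j $ i) x)" for x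
      by (simp add: inner_vec_def divergence_def sum_distrib_left C1c_matrix_entry(2)[OF \<Phi>(1)])
    have "(\<integral>x. w x \<bullet> divergence \<Phi> x \<partial>lebesgue_on \<Omega>) = (LBINT x. w x \<bullet> divergence \<Phi> x)"
    proof (rule integral_lebesgue_on_AE_eq(1)[OF \<Omega>b])
      have "integrable lborel (\<lambda>x. w x \<bullet> divergence \<Phi> x)"
        unfolding eq by (intro Bochner_Integration.integrable_sum i)
      then show "(\<lambda>x. w x \<bullet> divergence \<Phi> x) \<in> borel_measurable borel"
        using borel_measurable_integrable by fastforce
    qed (use w in auto)
    also have "\<dots> = (\<Sum>j\<in>UNIV. \<Sum>i\<in>UNIV. LBINT x. w x $ j * partial_deriv i (\<lambda>x. \<Phi> x $ j $ i) x)"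
      unfolding eq by (simp add: Bochner_Integration.integral_sum Bochner_Integration.integrable_sum i)
    also have "\<dots> \<le> (\<Sum>j\<in>(UNIV :: 'm set). \<Sum>i\<in>(UNIV :: 'n set). C)"
      using entry by (intro sum_mono) (auto simp: partial_deriv_def abs_le_iff)
    also have "\<dots> = real CARD('m) * (real CARD('n) * C)" by simp
    finally show ?thesis .
  qed
  have "variation \<Omega> w \<le> ereal (real CARD('m) * (real CARD('n) * C))"
    unfolding variation_def by (rule SUP_least) (use bound in auto)
  then have "variation \<Omega> w < \<infinity>" by (rule order.strict_trans1) simp
  moreover have "integrable (lebesgue_on \<Omega>) w"
    using integral_lebesgue_on_AE_eq(2)[OF \<Omega>b wm w(2), of w] w(1) by simp
  ultimately show ?thesis by (simp add: BV_def)
qed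

lemma norm_matrix_vector_mult_le:
  fixes A :: "real ^ 'n ^ 'm"
  shows "norm (A *v h) \<le> norm A * norm h"
proof -
  have "norm (A *v h) \<le> L2_set (\<lambda>j. norm (A $ j) * norm h) UNIV"
    unfolding norm_vec_def[of "A *v h"]
  proof (rule L2_set_mono)
    show "norm ((A *v h) $ j) \<le> norm (A $ j) * norm h" for j
      using Cauchy_Schwarz_ineq2[of "A $ j" h] by (simp add: matrix_vector_mul_component)
  qed simp
  also have "\<dots> = norm A * norm h"
    by (simp add: L2_set_left_distrib norm_vec_def[of A])
  finally show ?thesis .
qed

text \<open>Combining the partial derivatives with the coefficients of \<open>h\<close> shows that
  the components of \<open>G' x *v h\<close> are weak derivatives along \<open>h\<close>; the scalar
  convergence then applies to each component. Since \<open>K\<close> keeps a positive distance from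
  the complement of \<open>\<Omega>\<close>, the extension by zero is never seen.\<close>

lemma weak_gradient_difference_quotient_tendsto:
  fixes u :: "real ^ 'n \<Rightarrow> real ^ 'm" and G :: "real ^ 'n \<Rightarrow> real ^ 'n ^ 'm"
  assumes \<Omega>: "open \<Omega>" and weak: "is_weak_gradient \<Omega> u G"
    and u': "integrable lborel u'" "\<And>x. x \<notin> \<Omega> \<Longrightarrow> u' x = 0" "AE x in lebesgue_on \<Omega>. u' x = u x"
    and G': "integrable lborel G'" "\<And>x. x \<notin> \<Omega> \<Longrightarrow> G' x = 0" "AE x in lebesgue_on \<Omega>. G' x = G x"
    and K: "compact K" "\<And>x. x \<in> K \<Longrightarrow> cball x r \<subseteq> \<Omega>" "0 < r"
    and s: "\<And>n. 0 < s n" "s \<longlonglongrightarrow> 0"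
  shows "(\<lambda>n. LBINT x. indicator K x * norm ((u' (x + s n *\<^sub>R h) - u' x) /\<^sub>R s n - G' x *v h)) \<longlonglongrightarrow> 0"
proof -
  have \<Omega>b: "\<Omega> \<in> sets borel" using \<Omega> by simp
  have Gji: "integrable lborel (\<lambda>x. G' x $ j $ i)" for i j
    by (intro integrable_vec_nth G')
  have Gh: "(G' x *v h) $ j = (\<Sum>i\<in>UNIV. h $ i * G' x $ j $ i)" for x j
    by (simp add: matrix_vector_mult_def mult.commute)
  have Ghj: "integrable lborel (\<lambda>x. (G' x *v h) $ j)" for j
    unfolding Gh by (intro Bochner_Integration.integrable_sum integrable_mult_right Gji)
  have bl: "bounded_linear (\<lambda>A :: real ^ 'n ^ 'm. A *v h)"
    by (rule bounded_linear_intro[of _ "norm h"])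
      (auto simp: matrix_vector_mult_add_rdistrib scaleR_matrix_vector_assoc norm_matrix_vector_mult_le)
  have Ghi: "integrable lborel (\<lambda>x. G' x *v h)"
    using integrable_bounded_linear[OF bl G'(1)] .
  have wk: "(LBINT x. u' x $ j * frechet_derivative \<phi> (at x) h) = - (LBINT x. (G' x *v h) $ j * \<phi> x)"
    if \<phi>: "\<phi> \<in> C1c \<Omega>" for \<phi> j
  proof -
    have pm: "partial_deriv i \<phi> \<in> borel_measurable borel" for i
      using \<phi> by (intro borel_measurable_continuous_onI) (simp add: C1c_def)
    have d: "\<phi> differentiable (at x)" for x using \<phi> by (simp add: C1c_def)
    have i1: "integrable lborel (\<lambda>x. u' x $ j * partial_deriv i \<phi> x)" for i
      using integrable_mult_C1c(2)[OF integrable_vec_nth[OF u'(1)] \<phi>, where z=0 and h="axis i 1"] by (simp add: partial_deriv_def)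
    have i2: "integrable lborel (\<lambda>x. G' x $ j $ i * \<phi> x)" for i
      using integrable_mult_C1c(1)[OF Gji \<phi>, where z=0] by simp
    have eq: "(LBINT x. u' x $ j * partial_deriv i \<phi> x) = - (LBINT x. G' x $ j $ i * \<phi> x)" for i
    proof -
      have "(\<integral>x. u x $ j * partial_deriv i \<phi> x \<partial>lebesgue_on \<Omega>) = (LBINT x. u' x $ j * partial_deriv i \<phi> x)"
      proof (rule integral_lebesgue_on_AE_eq(1)[OF \<Omega>b])
        show "(\<lambda>x. u' x $ j * partial_deriv i \<phi> x) \<in> borel_measurable borel"
          using borel_measurable_integrable[OF i1] by simp
        show "AE x in lebesgue_on \<Omega>. u' x $ j * partial_deriv i \<phi> x = u x $ j * partial_deriv i \<phi> x"
          using u'(3) by eventually_elim simp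
      qed (simp add: u'(2))
      moreover have "(\<integral>x. G x $ j $ i * \<phi> x \<partial>lebesgue_on \<Omega>) = (LBINT x. G' x $ j $ i * \<phi> x)"
      proof (rule integral_lebesgue_on_AE_eq(1)[OF \<Omega>b])
        show "(\<lambda>x. G' x $ j $ i * \<phi> x) \<in> borel_measurable borel"
          using borel_measurable_integrable[OF i2] by simp
        show "AE x in lebesgue_on \<Omega>. G' x $ j $ i * \<phi> x = G x $ j $ i * \<phi> x"
          using G'(3) by eventually_elim simp
      qed (simp add: G'(2))
      ultimately show ?thesis using weak \<phi> by (simp add: is_weak_gradient_def)
    qed
    have "(LBINT x. u' x $ j * frechet_derivative \<phi> (at x) h) = (LBINT x. (\<Sum>i\<in>UNIV. h $ i * (u' x $ j * partial_deriv i \<phi> x)))"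
      by (simp add: frechet_derivative_eq_sum_partial_deriv[OF d] sum_distrib_left mult.left_commute)
    also have "\<dots> = (\<Sum>i\<in>UNIV. h $ i * (LBINT x. u' x $ j * partial_deriv i \<phi> x))"
      by (simp add: Bochner_Integration.integral_sum i1)
    also have "\<dots> = - (\<Sum>i\<in>UNIV. h $ i * (LBINT x. G' x $ j $ i * \<phi> x))"
      by (simp add: eq sum_negf)
    also have "(\<Sum>i\<in>UNIV. h $ i * (LBINT x. G' x $ j $ i * \<phi> x)) = (LBINT x. (\<Sum>i\<in>UNIV. h $ i * (G' x $ j $ i * \<phi> x)))"
      by (simp add: Bochner_Integration.integral_sum i2)
    also have "\<dots> = (LBINT x. (G' x *v h) $ j * \<phi> x)"
      by (simp add: Gh sum_distrib_right mult.assoc)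
    finally show ?thesis .
  qed
  have lim: "(\<lambda>n. \<Sum>j\<in>(UNIV :: 'm set). LBINT x. indicator K x * \<bar>(u' (x + s n *\<^sub>R h) $ j - u' x $ j) / s n - (G' x *v h) $ j\<bar>) \<longlonglongrightarrow> (\<Sum>j\<in>(UNIV :: 'm set). 0)"
    by (intro tendsto_sum difference_quotient_tendsto[OF integrable_vec_nth[OF u'(1)] Ghj K wk s])
  have le: "(LBINT x. indicator K x * norm ((u' (x + s n *\<^sub>R h) - u' x) /\<^sub>R s n - G' x *v h))
    \<le> (\<Sum>j\<in>(UNIV :: 'm set). LBINT x. indicator K x * \<bar>(u' (x + s n *\<^sub>R h) $ j - u' x $ j) / s n - (G' x *v h) $ j\<bar>)" for n
  proof -
    have "integrable lborel (\<lambda>x. (u' (x + s n *\<^sub>R h) - u' x) /\<^sub>R s n - G' x *v h)"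
      by (intro Bochner_Integration.integrable_diff integrable_scaleR_right integrable_translation u' Ghi)
    from norm_integral_le_components[OF this, of K] K(1) show ?thesis
      by (simp add: compact_imp_closed divide_inverse mult.commute)
  qed
  show ?thesis
  proof (rule Lim_null_comparison)
    show "\<forall>\<^sub>F n in sequentially. norm (LBINT x. indicator K x * norm ((u' (x + s n *\<^sub>R h) - u' x) /\<^sub>R s n - G' x *v h))
      \<le> (\<Sum>j\<in>(UNIV :: 'm set). LBINT x. indicator K x * \<bar>(u' (x + s n *\<^sub>R h) $ j - u' x $ j) / s n - (G' x *v h) $ j\<bar>)"
      using le by (intro always_eventually allI) (simp add: Bochner_Integration.integral_nonneg)
  qed (use lim in simp)
qed

section \<open>Energy estimates\<close>

text \<open>Only monotonicity of the nonnegative integral is applied to \<open>e\<close>. It holds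
  for arbitrary integrands, so the energy density can be treated as a bare function.\<close>

lemma integral_le_energy:
  fixes F e :: "'a::euclidean_space \<Rightarrow> real"
  assumes F: "integrable lborel F" "\<And>x. 0 \<le> F x" "\<And>x. x \<notin> \<Omega> \<Longrightarrow> F x = 0"
    and c: "0 < c" and C: "0 \<le> C" and le: "AE x in lborel. x \<in> \<Omega> \<longrightarrow> F x \<le> c * e x"
    and energy: "(\<integral>\<^sup>+x. ennreal (e x) * indicator \<Omega> x \<partial>lborel) \<le> ennreal C"
  shows "(LBINT x. F x) \<le> c * C"
proof -
  have i: "integrable lborel (\<lambda>x. F x / c)" using F(1) by simp
  have "ennreal (LBINT x. F x / c) = (\<integral>\<^sup>+x. ennreal (F x / c) \<partial>lborel)"
    using F(2) c by (intro nn_integral_eq_integral[symmetric] i) auto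
  also have "\<dots> \<le> (\<integral>\<^sup>+x. ennreal (e x) * indicator \<Omega> x \<partial>lborel)"
  proof (rule nn_integral_mono_AE)
    show "AE x in lborel. ennreal (F x / c) \<le> ennreal (e x) * indicator \<Omega> x"
      using le
    proof eventually_elim
      case (elim x)
      show ?case
      proof (cases "x \<in> \<Omega>")
        case True
        then have "F x / c \<le> e x" using elim c by (simp add: divide_le_eq mult.commute)
        then show ?thesis using True by (simp add: ennreal_leI)
      qed (simp add: F(3))
    qed
  qed
  also have "\<dots> \<le> ennreal C" by (rule energy)
  finally have "(LBINT x. F x / c) \<le> C" using C by (simp add: ennreal_le_iff)
  then show ?thesis using c by (simp add: field_simps)
qed

text \<open>On \<open>\<Omega>\<close> the distance is at most \<open>\<eta>\<close> plus its excess
  over \<open>\<eta>\<close>. The first part integrates to at most \<open>\<eta>\<close> times the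
  measure of \<open>\<Omega>\<close>; the second lives where \<open>\<eta> < D n x\<close> and
  integrates to at most \<open>c * \<epsilon> n * C\<close>, which vanishes for fixed
  \<open>\<eta>\<close>.\<close>

lemma well_distance_tendsto_0:
  fixes D e :: "nat \<Rightarrow> 'a::euclidean_space \<Rightarrow> real"
  assumes \<Omega>: "bounded \<Omega>" "\<Omega> \<in> sets borel"
    and D: "\<And>n. integrable lborel (D n)" "\<And>n x. 0 \<le> D n x" "\<And>n x. x \<notin> \<Omega> \<Longrightarrow> D n x = 0"
    and \<epsilon>: "\<And>n. 0 < \<epsilon> n" "\<epsilon> \<longlonglongrightarrow> 0" and C: "0 \<le> C"
    and energy: "\<And>n. (\<integral>\<^sup>+x. ennreal (e n x) * indicator \<Omega> x \<partial>lborel) \<le> ennreal C"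
    and le: "\<And>\<eta>. 0 < \<eta> \<Longrightarrow> \<exists>c>0. \<forall>n. AE x in lborel. x \<in> \<Omega> \<longrightarrow> \<eta> < D n x \<longrightarrow> D n x \<le> c * \<epsilon> n * e n x"
    and e: "\<And>n. AE x in lborel. x \<in> \<Omega> \<longrightarrow> 0 \<le> e n x"
  shows "(\<lambda>n. LBINT x. D n x) \<longlonglongrightarrow> 0"
proof (rule LIMSEQ_I)
  fix t :: real assume t: "0 < t"
  let ?\<mu> = "measure lborel \<Omega>"
  \<comment> \<open>Chosen so that the first part is at most \<open>t / 2\<close>; the summand 1
    keeps the denominator positive when \<open>\<Omega>\<close> is a null set.\<close>
  define \<eta> where "\<eta> = t / (2 * (?\<mu> + 1))"
  have \<mu>: "0 \<le> ?\<mu>" by simp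
  have \<eta>: "0 < \<eta>" unfolding \<eta>_def using \<mu> t by (intro divide_pos_pos mult_pos_pos) (auto intro: add_nonneg_pos)
  have "\<eta> * ?\<mu> \<le> \<eta> * (?\<mu> + 1)" using \<eta> by (intro mult_left_mono) auto
  also have "\<dots> = t / 2"
  proof -
    have "t / (2 * m) * m = t / 2" if "m \<noteq> 0" for m :: real using that by simp
    moreover have "?\<mu> + 1 \<noteq> 0" using \<mu> by linarith
    ultimately show ?thesis unfolding \<eta>_def by blast
  qed
  finally have \<eta>\<mu>: "\<eta> * ?\<mu> \<le> t / 2" .
  obtain c where c: "0 < c" "\<And>n. AE x in lborel. x \<in> \<Omega> \<longrightarrow> \<eta> < D n x \<longrightarrow> D n x \<le> c * \<epsilon> n * e n x"
    using le[OF \<eta>] by blast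
  have Dm [measurable]: "D n \<in> borel_measurable borel" for n using borel_measurable_integrable[OF D(1)] by simp
  have est: "(LBINT x. D n x) \<le> t / 2 + c * \<epsilon> n * C" for n
  proof -
    let ?F = "\<lambda>x. max 0 (D n x - \<eta>)"
    have i1: "integrable lborel ?F"
    proof (rule Bochner_Integration.integrable_bound[OF D(1)])
      show "AE x in lborel. norm (?F x) \<le> norm (D n x)"
        using D(2) \<eta> by (intro always_eventually allI) (auto simp: max_def)
    qed measurable
    have i2: "integrable lborel (\<lambda>x. indicator \<Omega> x * \<eta>)"
      by (rule integrable_indicator_bounded[where B="\<bar>\<eta>\<bar>"]) (use \<Omega> in auto)
    have "(LBINT x. ?F x) \<le> (c * \<epsilon> n) * C"
    proof (rule integral_le_energy[OF i1 _ _ _ C _ energy])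
      show "AE x in lborel. x \<in> \<Omega> \<longrightarrow> ?F x \<le> c * \<epsilon> n * e n x"
        using c(2)[of n] e[of n]
      proof eventually_elim
        case (elim x)
        show ?case
        proof
          assume x: "x \<in> \<Omega>"
          have "0 \<le> c * \<epsilon> n * e n x" using elim x c(1) \<epsilon>(1)[of n] by simp
          then show "?F x \<le> c * \<epsilon> n * e n x" using elim x \<eta> by (cases "\<eta> < D n x") auto
        qed
      qed
      show "?F x = 0" if "x \<notin> \<Omega>" for x using D(3)[OF that] \<eta> by simp
    qed (use c(1) \<epsilon>(1)[of n] in auto)
    moreover have "(LBINT x. D n x) \<le> (LBINT x. indicator \<Omega> x * \<eta> + ?F x)"
    proof (rule integral_mono[OF D(1) Bochner_Integration.integrable_add[OF i2 i1]])
      show "D n x \<le> indicator \<Omega> x * \<eta> + ?F x" for x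
        using D(3)[of x n] by (cases "x \<in> \<Omega>") auto
    qed
    moreover have "(LBINT x. indicator \<Omega> x * \<eta> + ?F x) = ?\<mu> * \<eta> + (LBINT x. ?F x)"
      using Bochner_Integration.integral_add[OF i2 i1] by simp
    ultimately show ?thesis using \<eta>\<mu> by (simp add: mult.commute)
  qed
  have "(\<lambda>n. c * \<epsilon> n * C) \<longlonglongrightarrow> c * 0 * C" by (intro tendsto_intros \<epsilon>)
  then have "\<forall>\<^sub>F n in sequentially. c * \<epsilon> n * C < t / 2" by (rule order_tendstoD) (use t in simp)
  then have "\<forall>\<^sub>F n in sequentially. norm ((LBINT x. D n x) - 0) < t"
  proof eventually_elim
    case (elim n)
    have "0 \<le> (LBINT x. D n x)" by (intro Bochner_Integration.integral_nonneg D(2))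
    then show ?case using est[of n] elim by simp
  qed
  then show "\<exists>N. \<forall>n\<ge>N. norm ((LBINT x. D n x) - 0) < t" by (simp add: eventually_sequentially)
qed

text \<open>In the zone the potential term is at least
  \<open>f (\<delta> / 4) / (C1 * \<epsilon>)\<close>, so \<open>C1 / f (\<delta> / 4)\<close> times
  the density pays for \<open>1 / \<epsilon>\<close>. The summand 1 in the constant pays for
  \<open>\<epsilon> * (norm (G x))\<^sup>2\<close>. The bound is therefore independent of
  \<open>\<epsilon>\<close>.\<close>

lemma transition_zone_gradient_bound:
  fixes u a b :: "'a::euclidean_space \<Rightarrow> 'b::euclidean_space" and G :: "'a \<Rightarrow> 'c::euclidean_space"
  assumes G: "integrable lborel G" "\<And>x. x \<notin> \<Omega> \<Longrightarrow> G x = 0"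
    and um: "u \<in> borel_measurable borel" "a \<in> borel_measurable borel"
    and \<delta>: "0 < \<delta>" "AE x in lborel. x \<in> \<Omega> \<longrightarrow> \<delta> \<le> norm (a x - b x)"
    and f: "mono_on {0..} f" "\<And>t. 0 \<le> t \<Longrightarrow> 0 \<le> f t" "\<And>t. 0 \<le> t \<Longrightarrow> f t = 0 \<longleftrightarrow> t = 0"
    and C1: "0 < C1" and \<epsilon>: "0 < \<epsilon>" and C: "0 \<le> C"
    and e: "AE x in lborel. x \<in> \<Omega> \<longrightarrow>
      1 / \<epsilon> * (1 / C1 * f (min (norm (u x - a x)) (norm (u x - b x)))) + \<epsilon> * (norm (G x))\<^sup>2 \<le> e x"
    and energy: "(\<integral>\<^sup>+x. ennreal (e x) * indicator \<Omega> x \<partial>lborel) \<le> ennreal C"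
  shows "(LBINT x. indicator {x. \<delta> / 4 \<le> norm (u x - a x) \<and> norm (u x - a x) \<le> \<delta> / 2} x * norm (G x))
    \<le> (1 + C1 / f (\<delta> / 4)) * C"
proof (rule integral_le_energy[OF _ _ _ _ C _ energy])
  let ?Z = "{x. \<delta> / 4 \<le> norm (u x - a x) \<and> norm (u x - a x) \<le> \<delta> / 2}"
  have [measurable]: "u \<in> borel_measurable borel" "a \<in> borel_measurable borel" by fact+
  have Z: "?Z \<in> sets borel" by measurable
  show "integrable lborel (\<lambda>x. indicator ?Z x * norm (G x))" by (rule integrable_indicator_norm[OF G(1) Z])
  have fp: "0 < f (\<delta> / 4)" using f(2,3)[of "\<delta> / 4"] \<delta>(1) by (simp add: order_less_le)
  show "0 < 1 + C1 / f (\<delta> / 4)" using fp C1 by (simp add: add_pos_pos)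
  show "AE x in lborel. x \<in> \<Omega> \<longrightarrow> indicator ?Z x * norm (G x) \<le> (1 + C1 / f (\<delta> / 4)) * e x"
    using \<delta>(2) e
  proof eventually_elim
    case (elim x)
    show ?case
    proof
      assume x: "x \<in> \<Omega>"
      let ?d = "min (norm (u x - a x)) (norm (u x - b x))"
      have e': "1 / \<epsilon> * (1 / C1 * f ?d) + \<epsilon> * (norm (G x))\<^sup>2 \<le> e x" using elim x by blast
      have fd: "0 \<le> f ?d" by (rule f(2)) simp
      have g0: "0 \<le> \<epsilon> * (norm (G x))\<^sup>2" using \<epsilon> by simp
      have p0: "0 \<le> 1 / \<epsilon> * (1 / C1 * f ?d)" using fd \<epsilon> C1 by simp
      have e0: "0 \<le> e x" using e' g0 p0 by linarith
      show "indicator ?Z x * norm (G x) \<le> (1 + C1 / f (\<delta> / 4)) * e x"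
      proof (cases "x \<in> ?Z")
        case False
        then show ?thesis using e0 fp C1 by simp
      next
        case True
        \<comment> \<open>Being within \<open>\<delta> / 2\<close> of \<open>a\<close> forces a
          distance of at least \<open>\<delta> / 2\<close> from \<open>b\<close>, so
          \<open>\<delta> / 4\<close> bounds the smaller distance from below.\<close>
        have "norm (a x - b x) \<le> norm (u x - a x) + norm (u x - b x)"
          using norm_triangle_ineq4[of "u x - b x" "u x - a x"] by simp
        then have "\<delta> / 4 \<le> ?d" using True elim x \<delta>(1) by auto
        then have "f (\<delta> / 4) \<le> f ?d" using \<delta>(1) by (intro mono_onD[OF f(1)]) auto
        then have "1 / \<epsilon> * (1 / C1 * f (\<delta> / 4)) \<le> 1 / \<epsilon> * (1 / C1 * f ?d)"
          using \<epsilon> C1 by (intro mult_left_mono) auto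
        then have "1 / \<epsilon> * (1 / C1 * f (\<delta> / 4)) \<le> e x" using e' g0 by linarith
        then have "C1 / f (\<delta> / 4) * (1 / \<epsilon> * (1 / C1 * f (\<delta> / 4))) \<le> C1 / f (\<delta> / 4) * e x"
          using C1 fp by (intro mult_left_mono) auto
        then have 1: "1 / \<epsilon> \<le> C1 / f (\<delta> / 4) * e x" using C1 fp by simp
        have "\<epsilon> * (norm (G x))\<^sup>2 \<le> e x" using e' p0 by linarith
        moreover have "2 * norm (G x) \<le> 1 / \<epsilon> + \<epsilon> * (norm (G x))\<^sup>2"
        proof -
          have "0 \<le> (1 - \<epsilon> * norm (G x))\<^sup>2 / \<epsilon>" using \<epsilon> by simp
          also have "\<dots> = 1 / \<epsilon> + \<epsilon> * (norm (G x))\<^sup>2 - 2 * norm (G x)"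
            using \<epsilon> by (simp add: power2_eq_square field_simps)
          finally show ?thesis by simp
        qed
        ultimately have "2 * norm (G x) \<le> (1 + C1 / f (\<delta> / 4)) * e x"
          using 1 by (simp add: distrib_right)
        then have "norm (G x) \<le> (1 + C1 / f (\<delta> / 4)) * e x" using norm_ge_zero[of "G x"] by linarith
        then show ?thesis using True by simp
      qed
    qed
  qed
qed (use G(2) in auto)

text \<open>Two regimes. For \<open>norm u < C2\<close> the distance is at most
  \<open>C2 + M\<close>, and \<open>f \<eta> / C1 \<le> \<epsilon> * e\<close> converts this
  constant into energy. For \<open>norm u \<ge> C2\<close> linear growth bounds
  \<open>norm u\<close> by \<open>C2 * (\<epsilon> * e)\<close>; it also yields
  \<open>1 \<le> \<epsilon> * e\<close>, which absorbs the constant \<open>M\<close>. The final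
  factor adds the constants of both regimes.\<close>

lemma well_distance_le_energy:
  fixes u a b :: "'b::euclidean_space"
  assumes f: "mono_on {0..} f" "\<And>t. 0 \<le> t \<Longrightarrow> 0 \<le> f t" "\<And>t. 0 \<le> t \<Longrightarrow> f t = 0 \<longleftrightarrow> t = 0"
    and C1: "0 < C1" and C2: "0 < C2" and M: "0 \<le> M" "norm a \<le> M" and \<epsilon>: "0 < \<epsilon>" and \<eta>: "0 < \<eta>"
    and e: "1 / \<epsilon> * (1 / C1 * f (min (norm (u - a)) (norm (u - b)))) \<le> e"
      "C2 \<le> norm u \<Longrightarrow> 1 / \<epsilon> * (1 / C2 * norm u) \<le> e"
    and d: "\<eta> < min (norm (u - a)) (norm (u - b))"
  shows "min (norm (u - a)) (norm (u - b)) \<le> ((C2 + M) * C1 / f \<eta> + (C2 + M)) * \<epsilon> * e"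
proof -
  let ?d = "min (norm (u - a)) (norm (u - b))"
  have f\<eta>: "0 < f \<eta>" using f(2,3)[of \<eta>] \<eta> by (simp add: order_less_le)
  have "f \<eta> \<le> f ?d" using \<eta> d by (intro mono_onD[OF f(1)]) auto
  then have "1 / C1 * f \<eta> \<le> 1 / C1 * f ?d" using C1 by (intro mult_left_mono) auto
  moreover have "1 / C1 * f ?d \<le> \<epsilon> * e" using mult_left_mono[OF e(1), of \<epsilon>] \<epsilon> by simp
  ultimately have 1: "f \<eta> / C1 \<le> \<epsilon> * e" by simp
  then have ee: "0 \<le> \<epsilon> * e" using f\<eta> C1 by (meson divide_pos_pos less_imp_le order_trans)
  have du: "?d \<le> norm u + M" using norm_triangle_ineq4[of u a] M by linarith
  let ?k = "(C2 + M) * C1 / f \<eta>"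
  have k: "0 \<le> ?k" using C1 C2 M f\<eta> by simp
  have "?d \<le> ?k * (\<epsilon> * e) + (C2 + M) * (\<epsilon> * e)"
  proof (cases "C2 \<le> norm u")
    case True
    then have "1 / C2 * norm u \<le> \<epsilon> * e" using mult_left_mono[OF e(2)[OF True], of \<epsilon>] \<epsilon> by simp
    then have u: "norm u \<le> C2 * (\<epsilon> * e)" using C2 by (simp add: field_simps)
    with True have "C2 * 1 \<le> C2 * (\<epsilon> * e)" by simp
    then have "1 \<le> \<epsilon> * e" using C2 by (simp only: mult_le_cancel_left_pos)
    then have "M * 1 \<le> M * (\<epsilon> * e)" using M by (intro mult_left_mono) auto
    then have "?d \<le> (C2 + M) * (\<epsilon> * e)" using du u by (simp add: distrib_right)
    then show ?thesis using mult_nonneg_nonneg[OF k ee] by linarith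
  next
    case False
    have "?k * (f \<eta> / C1) \<le> ?k * (\<epsilon> * e)" using 1 k by (rule mult_left_mono)
    moreover have "?k * (f \<eta> / C1) = C2 + M" using C1 f\<eta> by simp
    ultimately have "?d \<le> ?k * (\<epsilon> * e)" using False du by linarith
    moreover have "0 \<le> (C2 + M) * (\<epsilon> * e)" using C2 M by (intro mult_nonneg_nonneg[OF _ ee]) auto
    ultimately show ?thesis by linarith
  qed
  also have "\<dots> = (?k + (C2 + M)) * \<epsilon> * e" by (simp only: distrib_right mult.assoc)
  finally show ?thesis .
qed

section \<open>Identification and regularity of the limit\<close>

lemma well_selection:
  fixes u :: "nat \<Rightarrow> 'b::euclidean_space"
  assumes \<delta>: "0 < \<delta>" "\<delta> \<le> norm (a - b)"
    and d: "(\<lambda>n. min (norm (u n - a)) (norm (u n - b))) \<longlonglongrightarrow> 0"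
    and conv: "(\<lambda>n. phase \<delta> (norm (u n - a))) \<longlonglongrightarrow> c"
  shows "c = 0 \<and> u \<longlonglongrightarrow> a \<or> c = 1 \<and> u \<longlonglongrightarrow> b"
proof -
  have far: "\<delta> \<le> norm (u n - a) + norm (u n - b)" for n
    using \<delta>(2) norm_triangle_ineq4[of "u n - b" "u n - a"] by simp
  have ev: "\<forall>\<^sub>F n in sequentially. min (norm (u n - a)) (norm (u n - b)) < \<delta> / 4"
    using \<delta>(1) by (intro order_tendstoD(2)[OF d]) simp
  show ?thesis
  \<comment> \<open>Once the smaller distance is below \<open>\<delta> / 4\<close>, a phase below 1
    means that the near well is \<open>a\<close>, and then the phase is exactly 0; a positive phase
    likewise means \<open>b\<close> and the value 1. So a limit below 1 must be 0, and any other
    limit must be 1.\<close>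
  proof (cases "c < 1")
    case True
    have "\<forall>\<^sub>F n in sequentially. phase \<delta> (norm (u n - a)) < 1" by (rule order_tendstoD(2)[OF conv True])
    with ev have near: "\<forall>\<^sub>F n in sequentially. norm (u n - a) < \<delta> / 4 \<and> norm (u n - a) \<le> norm (u n - b)"
    proof eventually_elim
      case (elim n)
      have "norm (u n - a) < \<delta> / 2"
        using elim phase_eq_1[OF \<delta>(1), of "norm (u n - a)"] by (cases "norm (u n - a) < \<delta> / 2") auto
      then show ?case using elim far[of n] by (auto simp: min_def split: if_splits)
    qed
    have "(\<lambda>n. norm (u n - a)) \<longlonglongrightarrow> 0"
      using d by (rule Lim_transform_eventually) (use near in eventually_elim, auto simp: min_def)
    then have "u \<longlonglongrightarrow> a" by (simp add: tendsto_norm_zero_iff LIM_zero_iff)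
    moreover have "(\<lambda>n. phase \<delta> (norm (u n - a))) \<longlonglongrightarrow> 0"
      by (rule tendsto_eventually) (use near in eventually_elim, auto intro: phase_eq_0 \<delta>)
    then have "c = 0" using conv LIMSEQ_unique by blast
    ultimately show ?thesis by blast
  next
    case False
    then have "0 < c" by simp
    have "\<forall>\<^sub>F n in sequentially. 0 < phase \<delta> (norm (u n - a))" by (rule order_tendstoD(1)[OF conv \<open>0 < c\<close>])
    with ev have near: "\<forall>\<^sub>F n in sequentially. norm (u n - b) < \<delta> / 4 \<and> norm (u n - b) \<le> norm (u n - a)"
    proof eventually_elim
      case (elim n)
      have "\<delta> / 4 < norm (u n - a)"
        using elim phase_eq_0[OF \<delta>(1), of "norm (u n - a)"] by (cases "\<delta> / 4 < norm (u n - a)") auto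
      then show ?case using elim by (auto simp: min_def split: if_splits)
    qed
    have "(\<lambda>n. norm (u n - b)) \<longlonglongrightarrow> 0"
      using d by (rule Lim_transform_eventually) (use near in eventually_elim, auto simp: min_def)
    then have "u \<longlonglongrightarrow> b" by (simp add: tendsto_norm_zero_iff LIM_zero_iff)
    moreover have "(\<lambda>n. phase \<delta> (norm (u n - a))) \<longlonglongrightarrow> 1"
    proof (rule tendsto_eventually)
      show "\<forall>\<^sub>F n in sequentially. phase \<delta> (norm (u n - a)) = 1"
        using near
      proof eventually_elim
        case (elim n)
        then show ?case using far[of n] \<delta>(1) by (intro phase_eq_1) linarith+
      qed
    qed
    then have "c = 1" using conv LIMSEQ_unique by blast
    ultimately show ?thesis by blast
  qed
qed

text \<open>If \<open>x\<close> and \<open>x + h\<close> are in the same well, the increment of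
  \<open>w\<close> is that of \<open>a\<close> or of \<open>b\<close>. If the well changes, it is at
  most \<open>2 * M\<close>, and \<open>\<bar>\<theta> (x + h) - \<theta> x\<bar>\<close> is exactly
  1, so the phase pays for it. This case distinction stands in for a product rule.\<close>

lemma wells_limit_translation_estimate:
  fixes a b w :: "'a::euclidean_space \<Rightarrow> 'b::euclidean_space" and \<theta> :: "'a \<Rightarrow> real"
  assumes a: "integrable lborel a" and b: "integrable lborel b" and w: "integrable lborel w"
    and \<theta>: "\<theta> \<in> borel_measurable borel" "\<And>x. \<bar>\<theta> x\<bar> \<le> 1"
    and AEw: "AE x in lborel. x \<in> \<Omega> \<longrightarrow> \<theta> x = 0 \<and> w x = a x \<or> \<theta> x = 1 \<and> w x = b x"
    and M: "AE x in lborel. x \<in> \<Omega> \<longrightarrow> norm (a x) \<le> M \<and> norm (b x) \<le> M"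
    and K: "compact K" "\<And>x. x \<in> K \<Longrightarrow> cball x r \<subseteq> \<Omega>" and h: "norm h < r"
    and A: "(LBINT x. indicator K x * norm (a (x + h) - a x)) \<le> A * norm h"
    and B: "(LBINT x. indicator K x * norm (b (x + h) - b x)) \<le> B * norm h"
    and C: "(LBINT x. indicator K x * \<bar>\<theta> (x + h) - \<theta> x\<bar>) \<le> C * norm h"
    and M0: "0 \<le> M"
  shows "(LBINT x. indicator K x * norm (w (x + h) - w x)) \<le> (A + (B + 2 * M * C)) * norm h"
proof -
  have Kb: "K \<in> sets borel" "bounded K" using K(1) by (auto simp: compact_imp_closed compact_imp_bounded)
  have i: "integrable lborel (\<lambda>x. indicator K x * norm (v (x + h) - v x))" if "integrable lborel v" for v :: "'a \<Rightarrow> 'b"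
    by (intro integrable_indicator_norm Bochner_Integration.integrable_diff integrable_translation that Kb)
  have [measurable]: "\<theta> \<in> borel_measurable borel" by fact
  have i\<theta>: "integrable lborel (\<lambda>x. indicator K x * \<bar>\<theta> (x + h) - \<theta> x\<bar>)"
  proof (rule integrable_indicator_bounded[where B=2])
    show "\<bar>\<bar>\<theta> (x + h) - \<theta> x\<bar>\<bar> \<le> 2" for x using \<theta>(2)[of x] \<theta>(2)[of "x + h"] by linarith
  qed (use Kb in auto)
  have "(LBINT x. indicator K x * norm (w (x + h) - w x)) \<le>
    (LBINT x. indicator K x * norm (a (x + h) - a x) + (indicator K x * norm (b (x + h) - b x)
      + 2 * M * (indicator K x * \<bar>\<theta> (x + h) - \<theta> x\<bar>)))"
  proof (rule integral_mono_AE)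
    show "integrable lborel (\<lambda>x. indicator K x * norm (w (x + h) - w x))" by (rule i[OF w])
    show "integrable lborel (\<lambda>x. indicator K x * norm (a (x + h) - a x) + (indicator K x * norm (b (x + h) - b x)
      + 2 * M * (indicator K x * \<bar>\<theta> (x + h) - \<theta> x\<bar>)))"
      by (intro Bochner_Integration.integrable_add integrable_mult_right i a b i\<theta>)
    show "AE x in lborel. indicator K x * norm (w (x + h) - w x) \<le> indicator K x * norm (a (x + h) - a x) +
      (indicator K x * norm (b (x + h) - b x) + 2 * M * (indicator K x * \<bar>\<theta> (x + h) - \<theta> x\<bar>))"
      using AEw M AE_translation[OF AEw, of h] AE_translation[OF M, of h]
    proof eventually_elim
      case (elim x)
      show ?case
      proof (cases "x \<in> K")
        case False
        then show ?thesis by simp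
      next
        case True
        then have "cball x r \<subseteq> \<Omega>" by (rule K(2))
        moreover have "x + h \<in> cball x r" "x \<in> cball x r" using h norm_ge_zero[of h] by (auto simp: dist_norm simp del: norm_ge_zero)
        ultimately have x: "x \<in> \<Omega>" "x + h \<in> \<Omega>" by auto
        have n: "norm (a x) \<le> M" "norm (b x) \<le> M" "norm (a (x + h)) \<le> M" "norm (b (x + h)) \<le> M"
          using elim x by auto
        have mix: "norm (a (x + h) - b x) \<le> 2 * M" "norm (b (x + h) - a x) \<le> 2 * M"
          using norm_triangle_ineq4[of "a (x + h)" "b x"] norm_triangle_ineq4[of "b (x + h)" "a x"] n by linarith+
        have mix': "norm (a (x + h) - b x) \<le> norm (a (x + h) - a x) + (norm (b (x + h) - b x) + 2 * M)"
          "norm (b (x + h) - a x) \<le> norm (a (x + h) - a x) + (norm (b (x + h) - b x) + 2 * M)"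
          using mix norm_ge_zero[of "a (x + h) - a x"] norm_ge_zero[of "b (x + h) - b x"] by linarith+
        consider "\<theta> x = 0" "w x = a x" "\<theta> (x + h) = 0" "w (x + h) = a (x + h)"
          | "\<theta> x = 0" "w x = a x" "\<theta> (x + h) = 1" "w (x + h) = b (x + h)"
          | "\<theta> x = 1" "w x = b x" "\<theta> (x + h) = 0" "w (x + h) = a (x + h)"
          | "\<theta> x = 1" "w x = b x" "\<theta> (x + h) = 1" "w (x + h) = b (x + h)"
          using elim x by blast
        then have "norm (w (x + h) - w x) \<le> norm (a (x + h) - a x) + (norm (b (x + h) - b x) + 2 * M * \<bar>\<theta> (x + h) - \<theta> x\<bar>)"
          by cases (use mix' in simp_all)
        then show ?thesis using True by simp
      qed
    qed
  qed
  also have "\<dots> = (LBINT x. indicator K x * norm (a (x + h) - a x)) + ((LBINT x. indicator K x * norm (b (x + h) - b x))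
      + 2 * M * (LBINT x. indicator K x * \<bar>\<theta> (x + h) - \<theta> x\<bar>))"
    by (simp only: Bochner_Integration.integral_add Bochner_Integration.integrable_add integrable_mult_right i a b i\<theta> integral_mult_right_zero)
  also have "\<dots> \<le> A * norm h + (B * norm h + 2 * M * (C * norm h))"
    using M0 by (intro add_mono A B mult_left_mono C) auto
  also have "\<dots> = (A + (B + 2 * M * C)) * norm h" by (simp add: algebra_simps)
  finally show ?thesis .
qed

text \<open>Convergence is known almost everywhere in \<open>\<Omega>\<close> only. For
  \<open>x\<close> in \<open>K\<close> both \<open>x\<close> and \<open>x + h\<close> lie in
  \<open>\<Omega>\<close>, and a translated null set is null, so the increments converge almost
  everywhere on \<open>K\<close>, dominated by its indicator.\<close>

lemma translation_estimate_limit: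
  fixes v :: "nat \<Rightarrow> 'a::euclidean_space \<Rightarrow> real"
  assumes v: "\<And>n. v n \<in> borel_measurable borel" "\<And>n x. 0 \<le> v n x" "\<And>n x. v n x \<le> 1"
    and \<theta>: "\<theta> \<in> borel_measurable borel"
    and lim: "AE x in lborel. x \<in> \<Omega> \<longrightarrow> (\<lambda>n. v n x) \<longlonglongrightarrow> \<theta> x"
    and K: "compact K" "\<And>x. x \<in> K \<Longrightarrow> cball x r \<subseteq> \<Omega>" and h: "norm h < r"
    and le: "\<And>n. (LBINT x. indicator K x * \<bar>v n (x + h) - v n x\<bar>) \<le> C"
  shows "(LBINT x. indicator K x * \<bar>\<theta> (x + h) - \<theta> x\<bar>) \<le> C"
proof -
  have Kb [measurable]: "K \<in> sets borel" using K(1) by (simp add: compact_imp_closed)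
  have [measurable]: "\<theta> \<in> borel_measurable borel" "v n \<in> borel_measurable borel" for n by fact+
  have "(\<lambda>n. LBINT x. indicator K x * \<bar>v n (x + h) - v n x\<bar>) \<longlonglongrightarrow> (LBINT x. indicator K x * \<bar>\<theta> (x + h) - \<theta> x\<bar>)"
  proof (rule integral_dominated_convergence)
    show "integrable lborel (\<lambda>x::'a. indicator K x * 1 :: real)"
      by (rule integrable_indicator_bounded[where B=1]) (use K(1) Kb in \<open>auto simp: compact_imp_bounded\<close>)
    show "AE x in lborel. norm (indicator K x * \<bar>v n (x + h) - v n x\<bar>) \<le> indicator K x * 1" for n
    proof (intro always_eventually allI)
      fix x
      have "\<bar>v n (x + h) - v n x\<bar> \<le> 1" using v(2,3)[of n x] v(2,3)[of n "x + h"] by linarith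
      then show "norm (indicator K x * \<bar>v n (x + h) - v n x\<bar>) \<le> indicator K x * 1" by (simp add: indicator_def)
    qed
    show "AE x in lborel. (\<lambda>n. indicator K x * \<bar>v n (x + h) - v n x\<bar>) \<longlonglongrightarrow> indicator K x * \<bar>\<theta> (x + h) - \<theta> x\<bar>"
      using lim AE_translation[OF lim, of h]
    proof eventually_elim
      case (elim x)
      show ?case
      proof (cases "x \<in> K")
        case True
        then have "cball x r \<subseteq> \<Omega>" by (rule K(2))
        moreover have "x + h \<in> cball x r" "x \<in> cball x r" using h norm_ge_zero[of h] by (auto simp: dist_norm simp del: norm_ge_zero)
        ultimately have "x \<in> \<Omega>" "x + h \<in> \<Omega>" by auto
        with elim show ?thesis by (intro tendsto_intros) auto
      qed simp
    qed
  qed measurable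
  then show ?thesis by (rule LIMSEQ_le_const2) (use le in blast)
qed

text \<open>The functions \<open>u n\<close> have no common dominating function, but the difference
  between \<open>norm (u n x - w x)\<close> and the distance to the nearer well does: it is at most
  \<open>norm (a x - b x)\<close>. Dominated convergence handles this difference, and the distance
  itself tends to 0 in \<open>L1\<close> by hypothesis.\<close>

lemma L1_convergence_to_wells:
  fixes u :: "nat \<Rightarrow> 'a::euclidean_space \<Rightarrow> 'b::euclidean_space"
  assumes \<Omega>: "bounded \<Omega>" "\<Omega> \<in> sets borel"
    and u: "\<And>n. integrable lborel (u n)" "\<And>n x. x \<notin> \<Omega> \<Longrightarrow> u n x = 0"
    and w: "integrable lborel w" "\<And>x. x \<notin> \<Omega> \<Longrightarrow> w x = 0"
    and a: "integrable lborel a" and b: "integrable lborel b"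
    and ab0: "\<And>x. x \<notin> \<Omega> \<Longrightarrow> a x = 0" "\<And>x. x \<notin> \<Omega> \<Longrightarrow> b x = 0"
    and M: "AE x in lborel. x \<in> \<Omega> \<longrightarrow> norm (a x) \<le> M \<and> norm (b x) \<le> M"
    and lim: "AE x in lborel. x \<in> \<Omega> \<longrightarrow> w x \<in> {a x, b x} \<and> (\<lambda>n. u n x) \<longlonglongrightarrow> w x"
    and d: "(\<lambda>n. LBINT x. min (norm (u n x - a x)) (norm (u n x - b x))) \<longlonglongrightarrow> 0"
    and di: "\<And>n. integrable lborel (\<lambda>x. min (norm (u n x - a x)) (norm (u n x - b x)))"
  shows "(\<lambda>n. LBINT x. norm (u n x - w x)) \<longlonglongrightarrow> 0"
proof -
  let ?d = "\<lambda>n x. min (norm (u n x - a x)) (norm (u n x - b x))"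
  have iu: "integrable lborel (\<lambda>x. norm (u n x - w x))" for n using u(1) w(1) by simp
  have "(\<lambda>n. LBINT x. norm (u n x - w x) - ?d n x) \<longlonglongrightarrow> (\<integral>x. 0 \<partial>(lborel :: 'a measure))"
  proof (rule integral_dominated_convergence)
    show "integrable lborel (\<lambda>x. indicator \<Omega> x * (2 * M))"
      by (rule integrable_indicator_bounded[where B="\<bar>2 * M\<bar>"]) (use \<Omega> in auto)
    show "(\<lambda>x. norm (u n x - w x) - ?d n x) \<in> borel_measurable lborel" for n
      by (rule borel_measurable_integrable[OF Bochner_Integration.integrable_diff[OF iu di]])
    show "AE x in lborel. norm (norm (u n x - w x) - ?d n x) \<le> indicator \<Omega> x * (2 * M)" for n
      using M lim
    proof eventually_elim
      case (elim x)
      show ?case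
      proof (cases "x \<in> \<Omega>")
        case False
        then show ?thesis by (simp add: u(2) w(2) ab0)
      next
        case True
        then have m: "norm (a x) \<le> M" "norm (b x) \<le> M" "w x = a x \<or> w x = b x" using elim by auto
        have "norm (a x - b x) \<le> 2 * M" using norm_triangle_ineq4[of "a x" "b x"] m by linarith
        moreover have "norm (u n x - a x) \<le> norm (u n x - b x) + norm (a x - b x)"
          "norm (u n x - b x) \<le> norm (u n x - a x) + norm (a x - b x)"
          using norm_triangle_ineq4[of "u n x - b x" "a x - b x"] norm_triangle_ineq[of "u n x - a x" "a x - b x"] by simp_all
        ultimately have "\<bar>norm (u n x - w x) - ?d n x\<bar> \<le> 2 * M" using m(3) by (auto simp: min_def)
        then show ?thesis using True by simp
      qed
    qed
    show "AE x in lborel. (\<lambda>n. norm (u n x - w x) - ?d n x) \<longlonglongrightarrow> 0"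
      using lim
    proof eventually_elim
      case (elim x)
      show ?case
      proof (cases "x \<in> \<Omega>")
        case False
        then show ?thesis by (simp add: u(2) w(2) ab0)
      next
        case True
        then have "w x \<in> {a x, b x}" and l: "(\<lambda>n. u n x) \<longlonglongrightarrow> w x" using elim by auto
        then have 0: "min (norm (w x - a x)) (norm (w x - b x)) = 0" by auto
        have "(\<lambda>n. norm (u n x - w x) - ?d n x) \<longlonglongrightarrow> norm (w x - w x) - min (norm (w x - a x)) (norm (w x - b x))"
          by (intro tendsto_intros l)
        then show ?thesis by (simp only: 0 diff_self norm_zero)
      qed
    qed
  qed simp
  from tendsto_add[OF this d]
  have "(\<lambda>n. (LBINT x. norm (u n x - w x) - ?d n x) + (LBINT x. ?d n x)) \<longlonglongrightarrow> 0" by simp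
  moreover have "(LBINT x. norm (u n x - w x) - ?d n x) + (LBINT x. ?d n x) = (LBINT x. norm (u n x - w x))" for n
    by (simp only: Bochner_Integration.integral_diff[OF iu di] diff_add_cancel)
  ultimately show ?thesis by simp
qed

text \<open>The whole argument for Borel functions that vanish outside \<open>\<Omega>\<close>.
  Bounded variation of the wells enters as the translation constants \<open>A\<close> and
  \<open>B\<close>, weak differentiability as convergence of quotients in \<open>diff\<close>, and
  the potential only through the pointwise lower bounds \<open>e\<close> and
  \<open>e2\<close>.\<close>

lemma phase_compactness:
  fixes u :: "nat \<Rightarrow> real ^ 'n \<Rightarrow> real ^ 'm" and G :: "nat \<Rightarrow> real ^ 'n \<Rightarrow> real ^ 'n ^ 'm"
  assumes \<Omega>: "open \<Omega>" "bounded \<Omega>"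
    and a: "integrable lborel a" "\<And>x. x \<notin> \<Omega> \<Longrightarrow> a x = 0"
    and b: "integrable lborel b" "\<And>x. x \<notin> \<Omega> \<Longrightarrow> b x = 0"
    and u: "\<And>n. integrable lborel (u n)" "\<And>n x. x \<notin> \<Omega> \<Longrightarrow> u n x = 0"
    and G: "\<And>n. integrable lborel (G n)" "\<And>n x. x \<notin> \<Omega> \<Longrightarrow> G n x = 0"
    and A: "\<And>K r h. compact K \<Longrightarrow> (\<And>x. x \<in> K \<Longrightarrow> cball x r \<subseteq> \<Omega>) \<Longrightarrow> norm h < r \<Longrightarrow>
      (LBINT x. indicator K x * norm (a (x + h) - a x)) \<le> A * norm h"
    and B: "\<And>K r h. compact K \<Longrightarrow> (\<And>x. x \<in> K \<Longrightarrow> cball x r \<subseteq> \<Omega>) \<Longrightarrow> norm h < r \<Longrightarrow>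
      (LBINT x. indicator K x * norm (b (x + h) - b x)) \<le> B * norm h"
    and diff: "\<And>n h K r s. compact K \<Longrightarrow> (\<And>x. x \<in> K \<Longrightarrow> cball x r \<subseteq> \<Omega>) \<Longrightarrow> 0 < r \<Longrightarrow> (\<And>n. 0 < s n) \<Longrightarrow> s \<longlonglongrightarrow> 0 \<Longrightarrow>
      (\<lambda>k. LBINT x. indicator K x * norm ((u n (x + s k *\<^sub>R h) - u n x) /\<^sub>R s k - G n x *v h)) \<longlonglongrightarrow> 0"
    and M: "0 \<le> M" "AE x in lborel. x \<in> \<Omega> \<longrightarrow> norm (a x) \<le> M \<and> norm (b x) \<le> M"
    and \<delta>: "0 < \<delta>" "AE x in lborel. x \<in> \<Omega> \<longrightarrow> \<delta> \<le> norm (a x - b x)"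
    and f: "mono_on {0..} f" "\<And>t. 0 \<le> t \<Longrightarrow> 0 \<le> f t" "\<And>t. 0 \<le> t \<Longrightarrow> f t = 0 \<longleftrightarrow> t = 0"
    and C1: "0 < C1" and C2: "0 < C2" and \<epsilon>: "\<And>n. 0 < \<epsilon> n" "\<epsilon> \<longlonglongrightarrow> 0" and C: "0 \<le> C"
    and e: "\<And>n. AE x in lborel. x \<in> \<Omega> \<longrightarrow>
      1 / \<epsilon> n * (1 / C1 * f (min (norm (u n x - a x)) (norm (u n x - b x)))) + \<epsilon> n * (norm (G n x))\<^sup>2 \<le> e n x"
    and e2: "\<And>n. AE x in lborel. x \<in> \<Omega> \<longrightarrow> C2 \<le> norm (u n x) \<longrightarrow> 1 / \<epsilon> n * (1 / C2 * norm (u n x)) \<le> e n x"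
    and energy: "\<And>n. (\<integral>\<^sup>+x. ennreal (e n x) * indicator \<Omega> x \<partial>lborel) \<le> ennreal C"
  obtains r :: "nat \<Rightarrow> nat" and w where "strict_mono r" "integrable lborel w" "\<And>x. x \<notin> \<Omega> \<Longrightarrow> w x = 0" "w \<in> BV \<Omega>"
    "AE x in lborel. x \<in> \<Omega> \<longrightarrow> w x \<in> {a x, b x}" "(\<lambda>n. LBINT x. norm (u (r n) x - w x)) \<longlonglongrightarrow> 0"
proof -
  have \<Omega>b [measurable]: "\<Omega> \<in> sets borel" using \<Omega>(1) by simp
  have um [measurable]: "u n \<in> borel_measurable borel" "a \<in> borel_measurable borel" "b \<in> borel_measurable borel" for n
    using u(1) a(1) b(1) by (auto dest: borel_measurable_integrable)
  have [measurable]: "phase \<delta> \<in> borel_measurable borel"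
    using phase_continuous by (rule borel_measurable_continuous_onI)
  define v where "v n x = phase \<delta> (norm (u n x - a x))" for n x
  have v: "v n \<in> borel_measurable borel" "0 \<le> v n x" "v n x \<le> 1" for n x
    unfolding v_def[abs_def] by (measurable, auto intro: phase_bounds)
  have bl: "bounded_linear (\<lambda>A :: real ^ 'n ^ 'm. A *v h)" for h
    by (rule bounded_linear_intro[of _ "norm h"])
      (auto simp: matrix_vector_mult_add_rdistrib scaleR_matrix_vector_assoc norm_matrix_vector_mult_le)
  let ?Z = "\<lambda>n. {x. \<delta> / 4 \<le> norm (u n x - a x) \<and> norm (u n x - a x) \<le> \<delta> / 2}"
  let ?c = "(1 + C1 / f (\<delta> / 4)) * C"
  \<comment> \<open>Slope \<open>4 / \<delta>\<close> of the phase, times the translation constant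
    of \<open>a\<close> plus the energy bound for the gradient in the zone; no term depends on
    \<open>n\<close>.\<close>
  define Cv where "Cv = 4 / \<delta> * (A + ?c)"
  have Zb: "?Z n \<in> sets borel" for n by measurable
  have zone: "(LBINT x. indicator (?Z n) x * norm (G n x)) \<le> ?c" for n
    by (rule transition_zone_gradient_bound[OF G um(1,2) \<delta> f C1 \<epsilon>(1) C e energy])
  have TBv: "(LBINT x. indicator K x * \<bar>v n (x + h) - v n x\<bar>) \<le> Cv * norm h"
    if K: "compact K" "\<And>x. x \<in> K \<Longrightarrow> cball x r \<subseteq> \<Omega>" "norm h < r" for n K r and h :: "real ^ 'n"
  proof -
    have Gh: "integrable lborel (\<lambda>x. G n x *v h)" by (rule integrable_bounded_linear[OF bl G(1)])
    have "(LBINT x. indicator K x * \<bar>v n (x + h) - v n x\<bar>)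
        \<le> 4 / \<delta> * (A * norm h + (LBINT x. indicator (?Z n) x * norm (G n x *v h)))"
      unfolding v_def by (rule phase_composite_translation_estimate[OF u(1) a(1) Gh \<delta>(1) A diff K])
    also have "\<dots> \<le> 4 / \<delta> * (A * norm h + ?c * norm h)"
    proof (intro mult_left_mono add_left_mono)
      have "(LBINT x. indicator (?Z n) x * norm (G n x *v h)) \<le> (LBINT x. (indicator (?Z n) x * norm (G n x)) * norm h)"
      proof (rule integral_mono)
        show "integrable lborel (\<lambda>x. indicator (?Z n) x * norm (G n x *v h))" by (rule integrable_indicator_norm[OF Gh Zb])
        show "integrable lborel (\<lambda>x. (indicator (?Z n) x * norm (G n x)) * norm h)"
          by (rule integrable_mult_left[OF integrable_indicator_norm[OF G(1) Zb]])
        show "indicator (?Z n) x * norm (G n x *v h) \<le> (indicator (?Z n) x * norm (G n x)) * norm h" for x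
          unfolding mult.assoc by (intro mult_left_mono norm_matrix_vector_mult_le) simp
      qed
      also have "\<dots> = (LBINT x. indicator (?Z n) x * norm (G n x)) * norm h" by (rule integral_mult_left_zero)
      also have "\<dots> \<le> ?c * norm h" by (rule mult_right_mono[OF zone]) simp
      finally show "(LBINT x. indicator (?Z n) x * norm (G n x *v h)) \<le> ?c * norm h" .
    qed (use \<delta>(1) in simp)
    also have "\<dots> = Cv * norm h" by (simp only: Cv_def distrib_right mult.assoc)
    finally show ?thesis .
  qed
  have "\<exists>k :: nat \<Rightarrow> nat. strict_mono k \<and> (AE x in lborel. x \<in> \<Omega> \<longrightarrow> convergent (\<lambda>n. v (k n) x))"
  proof (rule translation_estimate_compactness[OF \<Omega>, of v Cv])
    fix n K r and h :: "real ^ 'n"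
    assume K: "compact K" "\<And>x. x \<in> K \<Longrightarrow> cball x r \<subseteq> \<Omega>" "norm h < r"
    show "(LBINT x. indicator K x * \<bar>v n (x + h) - v n x\<bar>) \<le> Cv * norm h" by (rule TBv[OF K])
  next
    fix k :: "nat \<Rightarrow> nat"
    assume "strict_mono k" "AE x in lborel. x \<in> \<Omega> \<longrightarrow> convergent (\<lambda>n. v (k n) x)"
    then show "\<exists>k :: nat \<Rightarrow> nat. strict_mono k \<and> (AE x in lborel. x \<in> \<Omega> \<longrightarrow> convergent (\<lambda>n. v (k n) x))" by blast
  qed (rule v)+
  then obtain k where k: "strict_mono (k :: nat \<Rightarrow> nat)" "AE x in lborel. x \<in> \<Omega> \<longrightarrow> convergent (\<lambda>n. v (k n) x)"
    by (elim exE conjE)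
  define D where "D n x = min (norm (u n x - a x)) (norm (u n x - b x))" for n x
  have Di: "integrable lborel (D n)" for n
    unfolding D_def[abs_def] by (intro integrable_min integrable_norm Bochner_Integration.integrable_diff u a b)
  have "(\<lambda>n. LBINT x. D n x) \<longlonglongrightarrow> 0"
  proof (rule well_distance_tendsto_0[OF \<Omega>(2) \<Omega>b Di _ _ \<epsilon> C energy])
    show "0 \<le> D n x" for n x by (simp add: D_def)
    show "D n x = 0" if "x \<notin> \<Omega>" for n x using that by (simp add: D_def u(2) a(2) b(2))
    show "AE x in lborel. x \<in> \<Omega> \<longrightarrow> 0 \<le> e n x" for n
      using e[of n]
    proof eventually_elim
      case (elim x)
      show ?case
      proof
        assume x: "x \<in> \<Omega>"
        have "0 \<le> f (min (norm (u n x - a x)) (norm (u n x - b x)))" by (rule f(2)) simp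
        then have "0 \<le> 1 / \<epsilon> n * (1 / C1 * f (min (norm (u n x - a x)) (norm (u n x - b x))))"
          using \<epsilon>(1)[of n] C1 by simp
        moreover have "0 \<le> \<epsilon> n * (norm (G n x))\<^sup>2" using \<epsilon>(1)[of n] by simp
        ultimately show "0 \<le> e n x" using elim x by force
      qed
    qed
    fix \<eta> :: real assume \<eta>: "0 < \<eta>"
    let ?k = "(C2 + M) * C1 / f \<eta> + (C2 + M)"
    have "0 < f \<eta>" using f(2,3)[of \<eta>] \<eta> by (simp add: order_less_le)
    moreover have "0 < C2 + M" using C2 M(1) by simp
    ultimately have "0 < ?k" using C1 by (intro add_pos_pos[of "_ / _"] divide_pos_pos mult_pos_pos)
    moreover have "AE x in lborel. x \<in> \<Omega> \<longrightarrow> \<eta> < D n x \<longrightarrow> D n x \<le> ?k * \<epsilon> n * e n x" for n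
      using e[of n] e2[of n] M(2)
    proof eventually_elim
      case (elim x)
      show ?case
      proof (intro impI)
        assume x: "x \<in> \<Omega>" "\<eta> < D n x"
        show "D n x \<le> ?k * \<epsilon> n * e n x"
          unfolding D_def
        proof (rule well_distance_le_energy[OF f C1 C2 M(1) _ \<epsilon>(1) \<eta>])
          have "0 \<le> \<epsilon> n * (norm (G n x))\<^sup>2" using \<epsilon>(1)[of n] by simp
          then show "1 / \<epsilon> n * (1 / C1 * f (min (norm (u n x - a x)) (norm (u n x - b x)))) \<le> e n x"
            using elim x by force
        qed (use elim x in \<open>auto simp: D_def\<close>)
      qed
    qed
    ultimately show "\<exists>c>0. \<forall>n. AE x in lborel. x \<in> \<Omega> \<longrightarrow> \<eta> < D n x \<longrightarrow> D n x \<le> c * \<epsilon> n * e n x" by blast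
  qed
  then have Dk: "(\<lambda>n. LBINT x. D (k n) x) \<longlonglongrightarrow> 0"
    using LIMSEQ_subseq_LIMSEQ[OF _ k(1)] by (force simp: comp_def)
  then have "(\<lambda>n. LBINT x. norm (D (k n) x)) \<longlonglongrightarrow> 0" by (simp add: D_def)
  \<comment> \<open>The well is selected point by point, so a further subsequence is taken along
    which the distance to the wells vanishes almost everywhere.\<close>
  from tendsto_L1_AE_subseq[OF Di this]
  obtain l where l: "strict_mono (l :: nat \<Rightarrow> nat)" "AE x in lborel. (\<lambda>n. D (k (l n)) x) \<longlonglongrightarrow> 0" by blast
  define r where "r n = k (l n)" for n
  have r: "strict_mono r" using strict_mono_o[OF k(1) l(1)] by (simp add: r_def[abs_def] comp_def)
  have Dr: "(\<lambda>n. LBINT x. D (r n) x) \<longlonglongrightarrow> 0"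
    using LIMSEQ_subseq_LIMSEQ[OF Dk l(1)] by (simp add: comp_def r_def)
  have conv: "AE x in lborel. x \<in> \<Omega> \<longrightarrow> convergent (\<lambda>n. v (r n) x)"
    using k(2)
  proof eventually_elim
    case (elim x)
    then show ?case using convergent_subseq_convergent[OF _ l(1), of "\<lambda>n. v (k n) x"] by (auto simp: comp_def r_def)
  qed
  \<comment> \<open>Clipping gives bounds that hold everywhere, including points where the phases do
    not converge; where they do converge, the limit already lies in \<open>[0, 1]\<close> and is
    unchanged.\<close>
  define \<theta> where "\<theta> x = max 0 (min 1 (lim (\<lambda>n. v (r n) x)))" for x
  have [measurable]: "v n \<in> borel_measurable borel" for n by (rule v)
  have \<theta>m [measurable]: "\<theta> \<in> borel_measurable borel" unfolding \<theta>_def[abs_def] by measurable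
  have \<theta>1: "\<bar>\<theta> x\<bar> \<le> 1" for x by (simp add: \<theta>_def)
  have \<theta>lim: "AE x in lborel. x \<in> \<Omega> \<longrightarrow> (\<lambda>n. v (r n) x) \<longlonglongrightarrow> \<theta> x"
    using conv
  proof eventually_elim
    case (elim x)
    show ?case
    proof
      assume "x \<in> \<Omega>"
      then have L: "(\<lambda>n. v (r n) x) \<longlonglongrightarrow> lim (\<lambda>n. v (r n) x)" using elim by (simp add: convergent_LIMSEQ_iff)
      have "0 \<le> lim (\<lambda>n. v (r n) x)" by (rule LIMSEQ_le_const[OF L]) (use v(2) in blast)
      moreover have "lim (\<lambda>n. v (r n) x) \<le> 1" by (rule LIMSEQ_le_const2[OF L]) (use v(3) in blast)
      ultimately show "(\<lambda>n. v (r n) x) \<longlonglongrightarrow> \<theta> x" using L by (simp add: \<theta>_def)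
    qed
  qed
  \<comment> \<open>Almost everywhere in \<open>\<Omega>\<close> the value of
    \<open>\<theta>\<close> turns out to be 0 or 1, so this test selects the correct well; outside
    \<open>\<Omega>\<close> both branches are 0.\<close>
  define w where "w x = (if \<theta> x = 0 then a x else b x)" for x
  have w0: "w x = 0" if "x \<notin> \<Omega>" for x using that by (simp add: w_def a(2) b(2))
  have wi: "integrable lborel w"
  proof (rule Bochner_Integration.integrable_bound)
    show "integrable lborel (\<lambda>x. norm (a x) + norm (b x))" using a(1) b(1) by simp
    have "w \<in> borel_measurable borel" unfolding w_def[abs_def] by measurable
    then show "w \<in> borel_measurable lborel" by simp
    show "AE x in lborel. norm (w x) \<le> norm (norm (a x) + norm (b x))" by (simp add: w_def)
  qed
  have main: "AE x in lborel. x \<in> \<Omega> \<longrightarrow> (\<theta> x = 0 \<and> w x = a x \<or> \<theta> x = 1 \<and> w x = b x) \<and> (\<lambda>n. u (r n) x) \<longlonglongrightarrow> w x"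
    using \<theta>lim l(2) \<delta>(2)
  proof eventually_elim
    case (elim x)
    show ?case
    proof
      assume x: "x \<in> \<Omega>"
      have "\<theta> x = 0 \<and> (\<lambda>n. u (r n) x) \<longlonglongrightarrow> a x \<or> \<theta> x = 1 \<and> (\<lambda>n. u (r n) x) \<longlonglongrightarrow> b x"
        by (rule well_selection[OF \<delta>(1)]) (use elim x in \<open>auto simp: D_def v_def r_def\<close>)
      then show "(\<theta> x = 0 \<and> w x = a x \<or> \<theta> x = 1 \<and> w x = b x) \<and> (\<lambda>n. u (r n) x) \<longlonglongrightarrow> w x"
        by (auto simp: w_def)
    qed
  qed
  have AEw: "AE x in lborel. x \<in> \<Omega> \<longrightarrow> \<theta> x = 0 \<and> w x = a x \<or> \<theta> x = 1 \<and> w x = b x"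
    using main by eventually_elim auto
  have AEl: "AE x in lborel. x \<in> \<Omega> \<longrightarrow> w x \<in> {a x, b x} \<and> (\<lambda>n. u (r n) x) \<longlonglongrightarrow> w x"
    using main by eventually_elim auto
  have BVw: "w \<in> BV \<Omega>"
  proof (rule BV_of_translation_estimate[OF \<Omega>(1) wi w0])
    fix K \<rho> and h :: "real ^ 'n"
    assume K: "compact K" "\<And>x. x \<in> K \<Longrightarrow> cball x \<rho> \<subseteq> \<Omega>" "norm h < \<rho>"
    have "(LBINT x. indicator K x * \<bar>\<theta> (x + h) - \<theta> x\<bar>) \<le> Cv * norm h"
      by (rule translation_estimate_limit[where v="\<lambda>n. v (r n)", OF v \<theta>m \<theta>lim K TBv[OF K]])
    from wells_limit_translation_estimate[OF a(1) b(1) wi \<theta>m \<theta>1 AEw M(2) K A[OF K] B[OF K] this M(1)]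
    show "(LBINT x. indicator K x * norm (w (x + h) - w x)) \<le> (A + (B + 2 * M * Cv)) * norm h" .
  qed
  have "(\<lambda>n. LBINT x. norm (u (r n) x - w x)) \<longlonglongrightarrow> 0"
    by (rule L1_convergence_to_wells[OF \<Omega>(2) \<Omega>b u wi w0 a(1) b(1) a(2) b(2) M(2) AEl])
      (use Dr Di in \<open>simp_all add: D_def[abs_def]\<close>)
  moreover have "AE x in lborel. x \<in> \<Omega> \<longrightarrow> w x \<in> {a x, b x}" using AEl by eventually_elim auto
  ultimately show ?thesis using that[OF r wi w0 BVw] by blast
qed

section \<open>Compactness for the phase separation functional\<close>

text \<open>On the bounded set \<open>\<Omega>\<close> the function
  \<open>1 + (norm (g x))\<^sup>2\<close> is integrable, and it dominates
  \<open>norm (g x)\<close>.\<close>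

lemma integrable_of_square_integrable:
  fixes g :: "'a::euclidean_space \<Rightarrow> 'b::euclidean_space"
  assumes g: "g \<in> borel_measurable borel" "\<And>x. x \<notin> \<Omega> \<Longrightarrow> g x = 0" and \<Omega>: "bounded \<Omega>" "\<Omega> \<in> sets borel"
    and sq: "integrable lborel (\<lambda>x. (norm (g x))\<^sup>2)"
  shows "integrable lborel g"
proof (rule Bochner_Integration.integrable_bound)
  have "integrable lborel (\<lambda>x. indicator \<Omega> x * 1 :: real)"
    by (rule integrable_indicator_bounded[where B=1]) (use \<Omega> in auto)
  then show "integrable lborel (\<lambda>x. indicator \<Omega> x * 1 + (norm (g x))\<^sup>2)"
    using sq by (rule Bochner_Integration.integrable_add)
  show "g \<in> borel_measurable lborel" using g(1) by simp
  show "AE x in lborel. norm (g x) \<le> norm (indicator \<Omega> x * 1 + (norm (g x))\<^sup>2)"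
  proof (intro always_eventually allI)
    fix x
    have "0 \<le> (norm (g x) - 1)\<^sup>2" by simp
    then have "2 * norm (g x) \<le> 1 + (norm (g x))\<^sup>2" by (simp add: power2_eq_square algebra_simps)
    then have "norm (g x) \<le> 1 + (norm (g x))\<^sup>2" using norm_ge_zero[of "g x"] by linarith
    then show "norm (g x) \<le> norm (indicator \<Omega> x * 1 + (norm (g x))\<^sup>2)"
      using g(2)[of x] by (cases "x \<in> \<Omega>") auto
  qed
qed

lemma H1_L2: "u \<in> H1 \<Omega> \<Longrightarrow> u \<in> L2 \<Omega>"
  by (simp add: H1_def)

lemma H1_weak_gradient: "u \<in> H1 \<Omega> \<Longrightarrow> is_weak_gradient \<Omega> u (weak_gradient \<Omega> u)"
  unfolding H1_def weak_gradient_def by (rule someI_ex[of "is_weak_gradient \<Omega> u"]) auto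

lemma L2_representative:
  fixes u :: "real ^ 'n \<Rightarrow> 'b::euclidean_space"
  assumes \<Omega>: "open \<Omega>" "bounded \<Omega>" and u: "u \<in> L2 \<Omega>"
  obtains v where "integrable lborel v" "\<And>x. x \<notin> \<Omega> \<Longrightarrow> v x = 0" "AE x in lebesgue_on \<Omega>. v x = u x"
proof -
  have \<Omega>b: "\<Omega> \<in> sets borel" using \<Omega>(1) by simp
  have um: "u \<in> borel_measurable (lebesgue_on \<Omega>)" using u by (simp add: L2_def)
  obtain v where v: "v \<in> borel_measurable borel" "\<And>x. x \<notin> \<Omega> \<Longrightarrow> v x = 0" "AE x in lebesgue_on \<Omega>. v x = u x"
    by (rule borel_representative[OF \<Omega>b um]) (rule that)
  have "integrable lborel (\<lambda>x. (norm (v x))\<^sup>2) \<longleftrightarrow> integrable (lebesgue_on \<Omega>) (\<lambda>x. (norm (u x))\<^sup>2)"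
  proof (rule integral_lebesgue_on_AE_eq(2)[OF \<Omega>b, symmetric])
    have [measurable]: "v \<in> borel_measurable borel" by (rule v)
    show "(\<lambda>x. (norm (v x))\<^sup>2) \<in> borel_measurable borel" by measurable
    show "AE x in lebesgue_on \<Omega>. (norm (v x))\<^sup>2 = (norm (u x))\<^sup>2" using v(3) by eventually_elim simp
  qed (simp add: v(2))
  then have sq: "integrable lborel (\<lambda>x. (norm (v x))\<^sup>2)" using u by (simp add: L2_def)
  show ?thesis by (rule that[OF integrable_of_square_integrable[OF v(1,2) \<Omega>(2) \<Omega>b sq] v(2,3)])
qed

text \<open>The gradient in \<open>energy\<close> is an arbitrary choice among all weak gradients,
  and the choice guarantees only local integrability. Square integrability is read off from the
  finite energy, which bypasses uniqueness of weak derivatives.\<close>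

lemma weak_gradient_representative:
  fixes G :: "real ^ 'n \<Rightarrow> 'b::euclidean_space"
  assumes \<Omega>: "open \<Omega>" "bounded \<Omega>" and G: "G \<in> L1_loc \<Omega>" and \<epsilon>: "0 < \<epsilon>"
    and energy: "(\<integral>\<^sup>+x. ennreal (e x) * indicator \<Omega> x \<partial>lborel) \<le> ennreal C"
    and e: "\<And>x. x \<in> \<Omega> \<Longrightarrow> \<epsilon> * (norm (G x))\<^sup>2 \<le> e x"
  obtains g where "integrable lborel g" "\<And>x. x \<notin> \<Omega> \<Longrightarrow> g x = 0" "AE x in lebesgue_on \<Omega>. g x = G x"
proof -
  have \<Omega>b: "\<Omega> \<in> sets borel" using \<Omega>(1) by simp
  obtain g where g: "g \<in> borel_measurable borel" "\<And>x. x \<notin> \<Omega> \<Longrightarrow> g x = 0" "AE x in lebesgue_on \<Omega>. g x = G x"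
    by (rule borel_representative[OF \<Omega>b L1_loc_borel_measurable[OF \<Omega>(1) G]]) (rule that)
  have [measurable]: "g \<in> borel_measurable borel" by (rule g)
  have "integrable lborel (\<lambda>x. \<epsilon> * (norm (g x))\<^sup>2)"
  proof (rule integrableI_bounded)
    have "(\<integral>\<^sup>+x. ennreal (norm (\<epsilon> * (norm (g x))\<^sup>2)) \<partial>lborel) \<le> (\<integral>\<^sup>+x. ennreal (e x) * indicator \<Omega> x \<partial>lborel)"
    proof (rule nn_integral_mono_AE)
      show "AE x in lborel. ennreal (norm (\<epsilon> * (norm (g x))\<^sup>2)) \<le> ennreal (e x) * indicator \<Omega> x"
        using g(3) unfolding AE_lebesgue_on_iff[OF \<Omega>b]
      proof eventually_elim
        case (elim x)
        show ?case
        proof (cases "x \<in> \<Omega>")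
          case True
          then show ?thesis using elim e[OF True] \<epsilon> by (simp add: ennreal_leI)
        qed (simp add: g(2))
      qed
    qed
    also have "\<dots> \<le> ennreal C" by (rule energy)
    also have "\<dots> < \<infinity>" by simp
    finally show "(\<integral>\<^sup>+x. ennreal (norm (\<epsilon> * (norm (g x))\<^sup>2)) \<partial>lborel) < \<infinity>" .
  qed measurable
  then have sq: "integrable lborel (\<lambda>x. (norm (g x))\<^sup>2)" using \<epsilon> by simp
  show ?thesis by (rule that[OF integrable_of_square_integrable[OF g(1,2) \<Omega>(2) \<Omega>b sq] g(2,3)])
qed

lemma L1_representative:
  fixes u :: "real ^ 'n \<Rightarrow> 'b::euclidean_space"
  assumes \<Omega>: "open \<Omega>" and u: "integrable (lebesgue_on \<Omega>) u"
  obtains v where "integrable lborel v" "\<And>x. x \<notin> \<Omega> \<Longrightarrow> v x = 0" "AE x in lebesgue_on \<Omega>. v x = u x"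
proof -
  have \<Omega>b: "\<Omega> \<in> sets borel" using \<Omega> by simp
  obtain v where v: "v \<in> borel_measurable borel" "\<And>x. x \<notin> \<Omega> \<Longrightarrow> v x = 0" "AE x in lebesgue_on \<Omega>. v x = u x"
    by (rule borel_representative[OF \<Omega>b borel_measurable_integrable[OF u]]) (rule that)
  have "integrable lborel v" using integral_lebesgue_on_AE_eq(2)[OF \<Omega>b v] u by simp
  then show ?thesis by (rule that[OF _ v(2,3)])
qed

theorem theorem2p16:
  fixes \<Omega> :: "(real ^ 'n) set"
    and W :: "real ^ 'n \<Rightarrow> real ^ 'm \<Rightarrow> real"
    and a b :: "real ^ 'n \<Rightarrow> real ^ 'm"
    and f :: "real \<Rightarrow> real"
    and \<delta> C1 C2 :: real
    and \<epsilon> :: "nat \<Rightarrow> real"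
    and u :: "nat \<Rightarrow> real ^ 'n \<Rightarrow> real ^ 'm"
  assumes "open \<Omega>" and "bounded \<Omega>" and "lipschitz_boundary \<Omega>"
    and W_nonneg: "\<And>x v. x \<in> \<Omega> \<Longrightarrow> 0 \<le> W x v"
    and H1: "caratheodory \<Omega> W"
    and H2: "a \<in> BV \<Omega> \<inter> Linfinity \<Omega>" "b \<in> BV \<Omega> \<inter> Linfinity \<Omega>"
      "AE x in lebesgue_on \<Omega>. \<forall>v. W x v = 0 \<longleftrightarrow> v \<in> {a x, b x}"
    and H3: "0 < \<delta>" "AE x in lebesgue_on \<Omega>. \<delta> \<le> norm (a x - b x)"
    and H4: "continuous_on {0..} f" "mono_on {0..} f" "\<And>t. 0 \<le> t \<Longrightarrow> 0 \<le> f t"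
      "\<And>t. 0 \<le> t \<Longrightarrow> f t = 0 \<longleftrightarrow> t = 0"
      "0 < C1"
      "AE x in lebesgue_on \<Omega>. \<forall>v.
         1 / C1 * f (min (norm (v - a x)) (norm (v - b x))) \<le> W x v \<and>
         W x v \<le> C1 * f (min (norm (v - a x)) (norm (v - b x)))"
    and H5: "0 < C2"
      "AE x in lebesgue_on \<Omega>. \<forall>v. C2 \<le> norm v \<longrightarrow> 1 / C2 * norm v \<le> W x v"
    and eps: "\<And>n. 0 < \<epsilon> n" "\<epsilon> \<longlonglongrightarrow> 0"
    and u_H1: "\<And>n. u n \<in> H1 \<Omega>"
    and bound: "(SUP n. energy \<Omega> W (\<epsilon> n) (u n)) < \<infinity>"
  shows "\<exists>(r :: nat \<Rightarrow> nat) w. strict_mono r \<and> w \<in> BV_wells \<Omega> a b \<and> tendsto_L1 \<Omega> (u \<circ> r) w"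
proof -
  have \<Omega>b: "\<Omega> \<in> sets borel" using \<open>open \<Omega>\<close> by simp
  note AE_iff = AE_lebesgue_on_iff[OF \<Omega>b]
  define C where "C = enn2real (SUP n. energy \<Omega> W (\<epsilon> n) (u n))"
  have C: "0 \<le> C" by (simp add: C_def)
  define G where "G n = weak_gradient \<Omega> (u n)" for n
  have G: "is_weak_gradient \<Omega> (u n) (G n)" for n
    unfolding G_def by (rule H1_weak_gradient[OF u_H1])
  define e where "e n x = 1 / \<epsilon> n * W x (u n x) + \<epsilon> n * (norm (G n x))\<^sup>2" for n x
  have energy: "(\<integral>\<^sup>+x. ennreal (e n x) * indicator \<Omega> x \<partial>lborel) \<le> ennreal C" for n
  proof -
    have "(\<integral>\<^sup>+x. ennreal (e n x) * indicator \<Omega> x \<partial>lborel) = energy \<Omega> W (\<epsilon> n) (u n)"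
      using u_H1 by (simp add: energy_def e_def G_def nn_integral_lebesgue_on[OF \<Omega>b])
    also have "\<dots> \<le> (SUP n. energy \<Omega> W (\<epsilon> n) (u n))" by (rule SUP_upper) simp
    also have "\<dots> = ennreal C" using bound by (simp add: C_def)
    finally show ?thesis .
  qed
  \<comment> \<open>From here on \<open>a\<close>, \<open>b\<close>, \<open>u n\<close> and the
    gradients are replaced by Borel functions that agree with them almost everywhere on
    \<open>\<Omega>\<close> and vanish outside, so that translations make sense on the whole space.
    The density \<open>e n\<close> keeps the original functions; \<open>e1\<close> and
    \<open>e2\<close> connect the two.\<close>
  have iab: "integrable (lebesgue_on \<Omega>) a" "integrable (lebesgue_on \<Omega>) b"
    using H2(1,2) by (simp_all add: BV_def)
  obtain a' where a': "integrable lborel a'" "\<And>x. x \<notin> \<Omega> \<Longrightarrow> a' x = 0" "AE x in lebesgue_on \<Omega>. a' x = a x"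
    by (rule L1_representative[OF \<open>open \<Omega>\<close> iab(1)]) (rule that)
  obtain b' where b': "integrable lborel b'" "\<And>x. x \<notin> \<Omega> \<Longrightarrow> b' x = 0" "AE x in lebesgue_on \<Omega>. b' x = b x"
    by (rule L1_representative[OF \<open>open \<Omega>\<close> iab(2)]) (rule that)
  have "\<forall>n. \<exists>v. integrable lborel v \<and> (\<forall>x. x \<notin> \<Omega> \<longrightarrow> v x = 0) \<and> (AE x in lebesgue_on \<Omega>. v x = u n x)"
  proof
    fix n
    from L2_representative[OF \<open>open \<Omega>\<close> \<open>bounded \<Omega>\<close> H1_L2[OF u_H1[of n]]]
    show "\<exists>v. integrable lborel v \<and> (\<forall>x. x \<notin> \<Omega> \<longrightarrow> v x = 0) \<and> (AE x in lebesgue_on \<Omega>. v x = u n x)"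
      by blast
  qed
  from choice[OF this] obtain u' where u': "\<And>n. integrable lborel (u' n)" "\<And>n x. x \<notin> \<Omega> \<Longrightarrow> u' n x = 0"
    "\<And>n. AE x in lebesgue_on \<Omega>. u' n x = u n x"
    by blast
  have "\<forall>n. \<exists>g. integrable lborel g \<and> (\<forall>x. x \<notin> \<Omega> \<longrightarrow> g x = 0) \<and> (AE x in lebesgue_on \<Omega>. g x = G n x)"
  proof
    fix n
    have "G n \<in> L1_loc \<Omega>" using G[of n] by (simp add: is_weak_gradient_def)
    moreover have "\<epsilon> n * (norm (G n x))\<^sup>2 \<le> e n x" if "x \<in> \<Omega>" for x
      using W_nonneg[OF that, of "u n x"] eps(1)[of n] by (simp add: e_def)
    ultimately show "\<exists>g. integrable lborel g \<and> (\<forall>x. x \<notin> \<Omega> \<longrightarrow> g x = 0) \<and> (AE x in lebesgue_on \<Omega>. g x = G n x)"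
      using weak_gradient_representative[OF \<open>open \<Omega>\<close> \<open>bounded \<Omega>\<close> _ eps(1) energy, of "G n" n] by blast
  qed
  from choice[OF this] obtain G' where G': "\<And>n. integrable lborel (G' n)" "\<And>n x. x \<notin> \<Omega> \<Longrightarrow> G' n x = 0"
    "\<And>n. AE x in lebesgue_on \<Omega>. G' n x = G n x"
    by blast
  obtain Ma Mb where Mab: "AE x in lebesgue_on \<Omega>. norm (a x) \<le> Ma" "AE x in lebesgue_on \<Omega>. norm (b x) \<le> Mb"
    using H2(1,2) by (auto simp: Linfinity_def)
  define M where "M = max 0 (max Ma Mb)"
  have M0: "0 \<le> M" by (simp add: M_def)
  have M: "AE x in lborel. x \<in> \<Omega> \<longrightarrow> norm (a' x) \<le> M \<and> norm (b' x) \<le> M"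
    using Mab a'(3) b'(3) unfolding AE_iff by eventually_elim (auto simp: M_def)
  have \<delta>: "AE x in lborel. x \<in> \<Omega> \<longrightarrow> \<delta> \<le> norm (a' x - b' x)"
    using H3(2) a'(3) b'(3) unfolding AE_iff by eventually_elim auto
  have e1: "AE x in lborel. x \<in> \<Omega> \<longrightarrow>
      1 / \<epsilon> n * (1 / C1 * f (min (norm (u' n x - a' x)) (norm (u' n x - b' x)))) + \<epsilon> n * (norm (G' n x))\<^sup>2 \<le> e n x" for n
    using H4(6) a'(3) b'(3) u'(3)[of n] G'(3)[of n] unfolding AE_iff
  proof eventually_elim
    case (elim x)
    show ?case
    proof
      assume x: "x \<in> \<Omega>"
      then have "1 / C1 * f (min (norm (u n x - a x)) (norm (u n x - b x))) \<le> W x (u n x)" using elim by blast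
      then have "1 / \<epsilon> n * (1 / C1 * f (min (norm (u n x - a x)) (norm (u n x - b x)))) \<le> 1 / \<epsilon> n * W x (u n x)"
        using eps(1)[of n] by (intro mult_left_mono) auto
      then show "1 / \<epsilon> n * (1 / C1 * f (min (norm (u' n x - a' x)) (norm (u' n x - b' x)))) + \<epsilon> n * (norm (G' n x))\<^sup>2 \<le> e n x"
        using elim x by (simp add: e_def)
    qed
  qed
  have e2: "AE x in lborel. x \<in> \<Omega> \<longrightarrow> C2 \<le> norm (u' n x) \<longrightarrow> 1 / \<epsilon> n * (1 / C2 * norm (u' n x)) \<le> e n x" for n
    using H5(2) u'(3)[of n] unfolding AE_iff
  proof eventually_elim
    case (elim x)
    show ?case
    proof (intro impI)
      assume x: "x \<in> \<Omega>" "C2 \<le> norm (u' n x)"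
      then have "1 / C2 * norm (u n x) \<le> W x (u n x)" "u' n x = u n x" using elim by auto
      then have "1 / \<epsilon> n * (1 / C2 * norm (u' n x)) \<le> 1 / \<epsilon> n * W x (u n x)"
        using eps(1)[of n] by (intro mult_left_mono) auto
      moreover have "0 \<le> \<epsilon> n * (norm (G n x))\<^sup>2" using eps(1)[of n] by simp
      ultimately show "1 / \<epsilon> n * (1 / C2 * norm (u' n x)) \<le> e n x" unfolding e_def by linarith
    qed
  qed
  have va: "variation \<Omega> a < \<infinity>" "variation \<Omega> b < \<infinity>" using H2 by (auto simp: BV_def)
  obtain r w where r: "strict_mono (r :: nat \<Rightarrow> nat)" and w: "integrable lborel w" "\<And>x. x \<notin> \<Omega> \<Longrightarrow> w x = 0" "w \<in> BV \<Omega>"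
    "AE x in lborel. x \<in> \<Omega> \<longrightarrow> w x \<in> {a' x, b' x}" "(\<lambda>n. LBINT x. norm (u' (r n) x - w x)) \<longlonglongrightarrow> 0"
  proof (rule phase_compactness[OF \<open>open \<Omega>\<close> \<open>bounded \<Omega>\<close> a'(1,2) b'(1,2) u'(1,2) G'(1,2) _ _ _ M0 M H3(1) \<delta>
        H4(2,3,4) H4(5) H5(1) eps C e1 e2 energy])
    fix K r and h :: "real ^ 'n"
    assume K: "compact K" "\<And>x. x \<in> K \<Longrightarrow> cball x r \<subseteq> \<Omega>" "norm h < r"
    show "(LBINT x. indicator K x * norm (a' (x + h) - a' x)) \<le> real CARD('m) * real_of_ereal (variation \<Omega> a) * norm h"
      by (rule BV_translation_estimate[OF \<open>open \<Omega>\<close> va(1) a' K])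
    show "(LBINT x. indicator K x * norm (b' (x + h) - b' x)) \<le> real CARD('m) * real_of_ereal (variation \<Omega> b) * norm h"
      by (rule BV_translation_estimate[OF \<open>open \<Omega>\<close> va(2) b' K])
  next
    fix n K r and s :: "nat \<Rightarrow> real" and h :: "real ^ 'n"
    assume K: "compact K" "\<And>x. x \<in> K \<Longrightarrow> cball x r \<subseteq> \<Omega>" "0 < r" "\<And>n. 0 < s n" "s \<longlonglongrightarrow> 0"
    show "(\<lambda>k. LBINT x. indicator K x * norm ((u' n (x + s k *\<^sub>R h) - u' n x) /\<^sub>R s k - G' n x *v h)) \<longlonglongrightarrow> 0"
      by (rule weak_gradient_difference_quotient_tendsto[OF \<open>open \<Omega>\<close> G u' G' K])
  next
    fix r :: "nat \<Rightarrow> nat" and w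
    assume lim: "strict_mono r" "integrable lborel w" "\<And>x. x \<notin> \<Omega> \<Longrightarrow> w x = 0" "w \<in> BV \<Omega>"
      "AE x in lborel. x \<in> \<Omega> \<longrightarrow> w x \<in> {a' x, b' x}" "(\<lambda>n. LBINT x. norm (u' (r n) x - w x)) \<longlonglongrightarrow> 0"
    show thesis by (rule that[OF lim])
  qed
  have um: "u' n \<in> borel_measurable borel" "w \<in> borel_measurable borel" for n
    using borel_measurable_integrable[OF u'(1)[of n]] borel_measurable_integrable[OF w(1)] by simp_all
  have "AE x in lebesgue_on \<Omega>. w x \<in> {a x, b x}"
    using w(4) a'(3) b'(3) unfolding AE_iff by eventually_elim auto
  then have "w \<in> BV_wells \<Omega> a b" using w(3) by (simp add: BV_wells_def)
  moreover have "tendsto_L1 \<Omega> (u \<circ> r) w"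
    unfolding tendsto_L1_def
  proof (intro conjI allI)
    show "integrable (lebesgue_on \<Omega>) ((u \<circ> r) n)" for n
      using integral_lebesgue_on_AE_eq(2)[OF \<Omega>b um(1) u'(2,3)] u'(1) by simp
    show "integrable (lebesgue_on \<Omega>) w" using w(3) by (simp add: BV_def)
    have "(\<integral>x. norm ((u \<circ> r) n x - w x) \<partial>lebesgue_on \<Omega>) = (LBINT x. norm (u' (r n) x - w x))" for n
    proof (rule integral_lebesgue_on_AE_eq(1)[OF \<Omega>b])
      have [measurable]: "u' (r n) \<in> borel_measurable borel" "w \<in> borel_measurable borel" by (rule um)+
      show "(\<lambda>x. norm (u' (r n) x - w x)) \<in> borel_measurable borel" by measurable
      show "AE x in lebesgue_on \<Omega>. norm (u' (r n) x - w x) = norm ((u \<circ> r) n x - w x)"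
        using u'(3)[of "r n"] by eventually_elim simp
    qed (simp add: u'(2) w(2))
    then show "(\<lambda>n. \<integral>x. norm ((u \<circ> r) n x - w x) \<partial>lebesgue_on \<Omega>) \<longlonglongrightarrow> 0"
      using w(5) by (simp only:)
  qed
  ultimately show ?thesis using r by blast
qed

end
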